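(* Let $G$ be a finite nonsolvable group. If $G\in\mathcal{D}_4$, then $G\cong\mathrm{A}_5$.
   Context: $\mathcal{D}(G)$ denotes the number of conjugacy classes of nontrivial subgroups $H$ of the finite group $G$ with $N_G(H)\neq H$; $\mathcal{D}_n$ is the family of finite groups $G$ with $\mathcal{D}(G)=n$. *)

theory Defs
  imports "HOL-Algebra.Algebra"
begin

definition subgroup_conj_class :: "('a, 'b) monoid_scheme \<Rightarrow> 'a set \<Rightarrow> 'a set set" where
  "subgroup_conj_class G H = {g <#\<^bsub>G\<^esub> H #>\<^bsub>G\<^esub> inv\<^bsub>G\<^esub> g | g. g \<in> carrier G}"

definition D_num :: "('a, 'b) monoid_scheme \<Rightarrow> nat" where
  "D_num G = card {subgroup_conj_class G H | H.
       subgroup H G \<and> H \<noteq> {\<one>\<^bsub>G\<^esub>} \<and> normalizer G H \<noteq> H}"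

end

theory Submission
  imports Defs "HOL-Number_Theory.Cong"
begin

text \<open>
  Call a nontrivial subgroup bad if it is not self-normalizing. The number of orders of bad subgroups is
  at most \<open>D(G)\<close>, and it drops when one passes from \<open>G\<close> to a proper nonabelian simple section \<open>N/M\<close> with
  \<open>N\<close> normal in \<open>G\<close> and \<open>M\<close> normal in \<open>N\<close>: it loses the order of \<open>M\<close> or that of \<open>N\<close>.

  Let \<open>G\<close> be nonabelian simple. By Burnside's transfer an abelian Sylow subgroup \<open>P\<close> has \<open>N(P) \<noteq> C(P)\<close>, so it
  is bad; all smaller nontrivial \<open>p\<close>-subgroups are bad because normalizers grow in \<open>p\<close>-groups. Hence the smallest
  prime divisor \<open>r\<close> contributes the orders \<open>r\<close> and \<open>r\<^sup>2\<close>, every other prime divisor \<open>p\<close> contributes \<open>p\<close>, and also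
  \<open>p\<^sup>2\<close> if \<open>p\<^sup>2\<close> divides the order. As \<open>|G| = r\<^sup>a q\<close> is impossible, there are at least four bad orders; so a
  nonsolvable group with \<open>D(G) = 4\<close> is simple, has exactly four, and its bad subgroups of equal order are conjugate.
  The Sylow \<open>r\<close>-subgroup then has order \<open>r\<^sup>2\<close> or \<open>r\<^sup>3\<close>. Order \<open>r\<^sup>3\<close> contradicts the conjugacy of the subgroups of
  order \<open>r\<close> and \<open>r\<^sup>2\<close>. If the order is \<open>r\<^sup>2\<close>, a prime \<open>s > r\<close> acts nontrivially on it, which forces
  \<open>r = 2\<close>, \<open>s = 3\<close>; counting Sylow subgroups leaves \<open>|G| = 60\<close> with five Sylow \<open>2\<close>-subgroups.
\<close>

hide_const (open) Divisibility.prime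

section \<open>Conjugates, normalizers and centralizers\<close>

text \<open>Orders are counted instead of classes because orders behave well under sections: the
  preimage of a bad subgroup \<open>K\<close> of \<open>N/M\<close> has order
  \<open>|M| |K|\<close>, so distinct orders stay distinct, whereas classes of \<open>N\<close> may
  fuse in \<open>G\<close>. Classes return once four orders face four classes: each order then
  belongs to a single class, and this conjugacy is what the case \<open>r^3\<close> rests on. The
  prime \<open>r\<close> stays arbitrary until a group of order \<open>q^n\<close> with
  \<open>q > r\<close> acts nontrivially on one of order \<open>r^2\<close>. Then \<open>q\<close>
  divides \<open>(r - 1)(r + 1)\<close>, hence \<open>q = r + 1\<close>, and \<open>2, 3\<close> is
  the only pair of consecutive primes. With two primes the order \<open>r^a q\<close> has to be
  excluded separately, since only \<open>b >= 2\<close> supplies the fourth order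
  \<open>q^2\<close>. The main obstacle is a Sylow subgroup of order \<open>r^3\<close>: it may be
  nonabelian, so Burnside's transfer says nothing about its normalizer.\<close>

definition conj_set :: "('a, 'b) monoid_scheme \<Rightarrow> 'a \<Rightarrow> 'a set \<Rightarrow> 'a set" where
  "conj_set G g H = (\<lambda>h. g \<otimes>\<^bsub>G\<^esub> h \<otimes>\<^bsub>G\<^esub> inv\<^bsub>G\<^esub> g) ` H"

definition centralizer :: "('a, 'b) monoid_scheme \<Rightarrow> 'a set \<Rightarrow> 'a set" where
  "centralizer G H = {g \<in> carrier G. \<forall>h\<in>H. g \<otimes>\<^bsub>G\<^esub> h = h \<otimes>\<^bsub>G\<^esub> g}"

locale finite_group = group +
  assumes fin [simp]: "finite (carrier G)"

context group
begin

lemma inv_mult_cancel [simp]: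
  assumes "g \<in> carrier G" "x \<in> carrier G"
  shows "inv g \<otimes> (g \<otimes> x) = x" "g \<otimes> (inv g \<otimes> x) = x"
  using assms by (simp_all flip: m_assoc)

lemma conj_set_eq_cosets: "conj_set G g H = g <# H #> inv g"
  by (auto simp: conj_set_def l_coset_def r_coset_def)

lemma mem_normalizer:
  "H \<subseteq> carrier G \<Longrightarrow> g \<in> normalizer G H \<longleftrightarrow> g \<in> carrier G \<and> conj_set G g H = H"
  by (simp add: normalizer_def stabilizer_def conj_set_eq_cosets)

lemma conj_set_one [simp]: "H \<subseteq> carrier G \<Longrightarrow> conj_set G \<one> H = H"
  by (force simp: conj_set_def)

lemma conj_set_mult:
  assumes "H \<subseteq> carrier G" "g \<in> carrier G" "h \<in> carrier G"
  shows "conj_set G g (conj_set G h H) = conj_set G (g \<otimes> h) H"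
proof -
  have "\<And>x. x \<in> H \<Longrightarrow> g \<otimes> (h \<otimes> x \<otimes> inv h) \<otimes> inv g = g \<otimes> h \<otimes> x \<otimes> inv (g \<otimes> h)"
    using assms by (auto simp: inv_mult_group m_assoc subset_iff)
  then show ?thesis
    by (auto simp: conj_set_def image_iff)
qed

lemma conj_set_carrier:
  "H \<subseteq> carrier G \<Longrightarrow> g \<in> carrier G \<Longrightarrow> conj_set G g H \<subseteq> carrier G"
  by (auto simp: conj_set_def)

lemma conj_set_inv [simp]:
  assumes "H \<subseteq> carrier G" "g \<in> carrier G"
  shows "conj_set G (inv g) (conj_set G g H) = H" "conj_set G g (conj_set G (inv g) H) = H"
  using assms by (simp_all add: conj_set_mult)

lemma conj_set_mono: "H \<subseteq> K \<Longrightarrow> conj_set G g H \<subseteq> conj_set G g K"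
  by (auto simp: conj_set_def)

lemma conj_set_subset_iff:
  assumes "H \<subseteq> carrier G" "K \<subseteq> carrier G" "g \<in> carrier G"
  shows "conj_set G g H \<subseteq> K \<longleftrightarrow> H \<subseteq> conj_set G (inv g) K"
  using assms conj_set_mono conj_set_inv by (metis inv_closed)

lemma inj_on_conj: "H \<subseteq> carrier G \<Longrightarrow> g \<in> carrier G \<Longrightarrow> inj_on (\<lambda>h. g \<otimes> h \<otimes> inv g) H"
  by (auto simp: inj_on_def subset_iff)

lemma card_conj_set [simp]:
  "H \<subseteq> carrier G \<Longrightarrow> g \<in> carrier G \<Longrightarrow> card (conj_set G g H) = card H"
  unfolding conj_set_def by (intro card_image inj_on_conj)

lemma subgroup_conj_set:
  "subgroup H G \<Longrightarrow> g \<in> carrier G \<Longrightarrow> subgroup (conj_set G g H) G"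
  unfolding conj_set_eq_cosets by (rule subgroup_conjugation_is_surj2)

lemma subgroup_normalizer: "subgroup H G \<Longrightarrow> subgroup (normalizer G H) G"
  by (simp add: normalizer_imp_subgroup subgroup.subset)

lemma conj_set_self: "subgroup H G \<Longrightarrow> g \<in> H \<Longrightarrow> conj_set G g H = H"
  by (simp add: conj_set_eq_cosets coset_join2 coset_join3 subgroup.mem_carrier subgroup.m_inv_closed
      subgroup.subset)

lemma subgroup_subset_normalizer: "subgroup H G \<Longrightarrow> H \<subseteq> normalizer G H"
  by (auto simp: mem_normalizer subgroup.subset conj_set_self subgroup.mem_carrier)

lemma normal_iff_normalizer: "H \<lhd> G \<longleftrightarrow> subgroup H G \<and> normalizer G H = carrier G"
proof
  assume H: "H \<lhd> G"
  then interpret normal H G .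
  have "conj_set G g H = H" if g: "g \<in> carrier G" for g
  proof
    show "conj_set G g H \<subseteq> H" using inv_op_closed2 g by (auto simp: conj_set_def)
    have "conj_set G (inv g) H \<subseteq> H" using inv_op_closed1 g by (auto simp: conj_set_def)
    then show "H \<subseteq> conj_set G g H" using g by (simp add: conj_set_subset_iff subset)
  qed
  then show "subgroup H G \<and> normalizer G H = carrier G"
    using subgroup_axioms by (auto simp: mem_normalizer subset)
next
  assume H: "subgroup H G \<and> normalizer G H = carrier G"
  then have "conj_set G g H = H" if "g \<in> carrier G" for g
    using that mem_normalizer[of H g] by (simp add: subgroup.subset)
  then show "H \<lhd> G"
    using H by (auto simp: normal_inv_iff conj_set_def)
qed

lemma subgroup_centralizer:
  assumes "H \<subseteq> carrier G"
  shows "subgroup (centralizer G H) G"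
proof (rule subgroupI)
  fix a b assume a: "a \<in> centralizer G H" and b: "b \<in> centralizer G H"
  show "inv a \<in> centralizer G H"
  proof -
    have "inv a \<otimes> h = h \<otimes> inv a" if "h \<in> H" for h
    proof -
      have ah: "a \<in> carrier G" "h \<in> carrier G" "a \<otimes> h = h \<otimes> a"
        using a that assms by (auto simp: centralizer_def)
      have "a \<otimes> (h \<otimes> inv a) = (h \<otimes> a) \<otimes> inv a"
        using ah by (simp flip: m_assoc)
      then have "h = a \<otimes> (h \<otimes> inv a)" using ah by (simp add: m_assoc)
      then have "h \<otimes> inv a = inv a \<otimes> h" using ah by (subst inv_solve_left) auto
      then show ?thesis by simp
    qed
    then show ?thesis using a by (auto simp: centralizer_def)
  qed
  have "a \<otimes> b \<otimes> h = h \<otimes> (a \<otimes> b)" if "h \<in> H" for h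
  proof -
    have "a \<in> carrier G" "b \<in> carrier G" "h \<in> carrier G" "a \<otimes> h = h \<otimes> a"
        "b \<otimes> h = h \<otimes> b"
      using a b that assms by (auto simp: centralizer_def)
    then show ?thesis by (metis m_assoc)
  qed
  then show "a \<otimes> b \<in> centralizer G H"
    using a b by (auto simp: centralizer_def)
qed (use assms in \<open>auto simp: centralizer_def subset_iff intro!: exI[of _ \<one>]\<close>)

lemma centralizer_subset_normalizer:
  assumes "H \<subseteq> carrier G"
  shows "centralizer G H \<subseteq> normalizer G H"
proof
  fix g assume g: "g \<in> centralizer G H"
  have "g \<otimes> h \<otimes> inv g = h" if "h \<in> H" for h
    using that g assms by (auto simp: centralizer_def subset_iff m_assoc)
  then have "conj_set G g H = H" by (auto simp: conj_set_def)
  then show "g \<in> normalizer G H" using g assms by (auto simp: mem_normalizer centralizer_def)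
qed

lemma conj_set_restrict:
  "subgroup H G \<Longrightarrow> g \<in> H \<Longrightarrow> conj_set (G\<lparr>carrier := H\<rparr>) g K = conj_set G g K"
  by (simp add: conj_set_def m_inv_consistent)

lemma normalizer_restrict:
  assumes "subgroup H G" "K \<subseteq> H"
  shows "normalizer (G\<lparr>carrier := H\<rparr>) K = H \<inter> normalizer G K"
proof -
  interpret H: group "G\<lparr>carrier := H\<rparr>" by (rule subgroup_imp_group[OF assms(1)])
  show ?thesis
    using assms H.mem_normalizer[of K] mem_normalizer[of K] subgroup.subset[OF assms(1)]
    by (auto simp: conj_set_restrict)
qed

lemma subgroup_restrict_iff:
  assumes "subgroup H G"
  shows "subgroup K (G\<lparr>carrier := H\<rparr>) \<longleftrightarrow> subgroup K G \<and> K \<subseteq> H"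
  using incl_subgroup[OF assms] subgroup_incl[OF _ assms] subgroup.subset[of K "G\<lparr>carrier := H\<rparr>"] by auto

text \<open>The inclusion \<open>sub\<close> is a computation; the other one is \<open>sub\<close>
  for the conjugate set and \<open>inv g\<close>, carried back by
  \<open>conj_set_subset_iff\<close>.\<close>

lemma centralizer_conj_set:
  assumes "H \<subseteq> carrier G" "g \<in> carrier G"
  shows "centralizer G (conj_set G g H) = conj_set G g (centralizer G H)"
proof -
  have sub: "conj_set G g (centralizer G K) \<subseteq> centralizer G (conj_set G g K)"
    if "K \<subseteq> carrier G" "g \<in> carrier G" for K g
  proof -
    have "g \<otimes> x \<otimes> inv g \<otimes> (g \<otimes> h \<otimes> inv g) = g \<otimes> h \<otimes> inv g \<otimes> (g \<otimes> x \<otimes> inv g)"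
      if "x \<in> carrier G" "h \<in> K" "x \<otimes> h = h \<otimes> x" for x h
    proof -
      have [simp]: "h \<in> carrier G" "g \<in> carrier G" using that \<open>K \<subseteq> carrier G\<close>
          \<open>g \<in> carrier G\<close> by auto
      have "g \<otimes> u \<otimes> inv g \<otimes> (g \<otimes> v \<otimes> inv g) = g \<otimes> (u \<otimes> v) \<otimes> inv g"
        if "u \<in> carrier G" "v \<in> carrier G" for u v
        using that by (simp add: m_assoc)
      then show ?thesis using that by simp
    qed
    then show ?thesis using that by (auto simp: centralizer_def conj_set_def)
  qed
  show ?thesis
  proof
    have "conj_set G (inv g) (centralizer G (conj_set G g H)) \<subseteq> centralizer G H"
      using sub[of "conj_set G g H" "inv g"] assms by (simp add: conj_set_carrier)
    then show "centralizer G (conj_set G g H) \<subseteq> conj_set G g (centralizer G H)"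
      using conj_set_subset_iff[of "centralizer G (conj_set G g H)" "centralizer G H" "inv g"] assms
      by (auto simp: centralizer_def)
  qed (use sub assms in blast)
qed

end

section \<open>Actions of p-groups, counted modulo p\<close>

text \<open>Orbits of a \<open>p\<close>-group have length \<open>1\<close> or divisible by \<open>p\<close>.\<close>

lemma (in group_action) p_group_fixed_points:
  assumes "prime p" "order G = p ^ n" "finite E"
  shows "[card E = card {x \<in> E. \<forall>g\<in>carrier G. \<phi> g x = x}] (mod p)"
proof -
  let ?O = "orbits G E \<phi>" and ?F = "{x \<in> E. \<forall>g\<in>carrier G. \<phi> g x = x}"
  interpret group_hom G "BijGroup E" \<phi> by (rule group_hom)
  have finO: "finite ?O" using assms(3) by (simp add: orbits_def)
  have cov: "\<Union>?O = E" by (rule orbits_coverture)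
  have sing: "orbit G \<phi> x = {x}" if "x \<in> ?F" for x
    using that orbit_refl[of x] by (auto simp: orbit_def)
  have dvd: "(p dvd card b) \<or> (\<exists>x\<in>?F. b = {x})" if "b \<in> ?O" for b
  proof -
    obtain x where x: "x \<in> E" "b = orbit G \<phi> x" using \<open>b \<in> ?O\<close> by (auto simp: orbits_def)
    have "card b dvd p ^ n" using orbit_stabilizer_theorem[OF x(1)] x(2) assms(2) by (metis dvd_triv_left)
    then obtain k where k: "card b = p ^ k" using assms(1) by (auto simp: divides_primepow_nat)
    show ?thesis
    proof (cases "k = 0")
      case True
      then obtain y where y: "b = {y}" using k card_1_singletonE by (metis power_0)
      then have "y = x" using orbit_refl[OF x(1)] x(2) by auto
      then have "x \<in> ?F" using y x by (auto simp: orbit_def)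
      then show ?thesis using y \<open>y = x\<close> by auto
    next
      case False then show ?thesis using k by simp
    qed
  qed
  have "card E = (\<Sum>b\<in>?O. card b)"
    using disjoint_sum[OF assms(3), of "\<lambda>_. 1::nat"] by simp
  also have "[\<dots> = (\<Sum>b\<in>?O. if \<exists>x\<in>?F. b = {x} then 1 else 0)] (mod p)"
    using dvd by (intro cong_sum) (auto simp: cong_0_iff)
  also have "(\<Sum>b\<in>?O. if \<exists>x\<in>?F. b = {x} then 1 else 0) = card {b \<in> ?O. \<exists>x\<in>?F. b = {x}}"
    using finO by (simp add: sum.If_cases Int_def)
  also have "{b \<in> ?O. \<exists>x\<in>?F. b = {x}} = (\<lambda>x. {x}) ` ?F"
    using sing by (auto simp: orbits_def)
  also have "card \<dots> = card ?F"
    by (simp add: card_image)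
  finally show ?thesis .
qed

text \<open>\<open>BijGroup E\<close> consists of maps extensional on \<open>E\<close>, hence the
  restriction; bijectivity comes from \<open>act (inv g)\<close> inverting
  \<open>act g\<close>.\<close>

lemma (in group) group_actionI:
  assumes cl: "\<And>g x. g \<in> carrier G \<Longrightarrow> x \<in> E \<Longrightarrow> act g x \<in> E"
    and one: "\<And>x. x \<in> E \<Longrightarrow> act \<one> x = x"
    and mult: "\<And>g h x. g \<in> carrier G \<Longrightarrow> h \<in> carrier G \<Longrightarrow> x \<in> E \<Longrightarrow> act (g \<otimes> h) x = act g (act h x)"
  shows "group_action G E (\<lambda>g. restrict (act g) E)"
proof -
  have inv1: "act (inv g) (act g x) = x" "act g (act (inv g) x) = x"
    if "g \<in> carrier G" "x \<in> E" for g x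
    using that mult[of "inv g" g x] mult[of g "inv g" x] one by auto
  have bij: "restrict (act g) E \<in> Bij E" if "g \<in> carrier G" for g
  proof -
    have "bij_betw (act g) E E"
      by (rule bij_betwI[where g = "act (inv g)"]) (use that cl inv1 in auto)
    then show ?thesis by (simp add: Bij_def)
  qed
  have "(\<lambda>g. restrict (act g) E) \<in> hom G (BijGroup E)"
  proof (rule homI)
    fix g h assume gh: "g \<in> carrier G" "h \<in> carrier G"
    show "restrict (act (g \<otimes> h)) E = restrict (act g) E \<otimes>\<^bsub>BijGroup E\<^esub> restrict (act h) E"
      using gh bij mult cl by (auto simp: BijGroup_def compose_def fun_eq_iff)
  qed (use bij in \<open>simp add: BijGroup_def\<close>)
  then show ?thesis
    by (simp add: group_action_def group_hom_def group_hom_axioms_def group_BijGroup is_group)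
qed

lemma (in group) p_group_action_fixed_points:
  assumes "prime p" "order G = p ^ n" "finite E"
    and cl: "\<And>g x. g \<in> carrier G \<Longrightarrow> x \<in> E \<Longrightarrow> act g x \<in> E"
    and one: "\<And>x. x \<in> E \<Longrightarrow> act \<one> x = x"
    and mult: "\<And>g h x. g \<in> carrier G \<Longrightarrow> h \<in> carrier G \<Longrightarrow> x \<in> E \<Longrightarrow> act (g \<otimes> h) x = act g (act h x)"
  shows "[card E = card {x \<in> E. \<forall>g\<in>carrier G. act g x = x}] (mod p)"
proof -
  interpret group_action G E "\<lambda>g. restrict (act g) E"
    by (rule group_actionI) (use cl one mult in auto)
  have "{x \<in> E. \<forall>g\<in>carrier G. restrict (act g) E x = x} = {x \<in> E. \<forall>g\<in>carrier G. act g x = x}" by auto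
  then show ?thesis using p_group_fixed_points[OF assms(1-3)] by simp
qed

section \<open>Sylow theory\<close>

context finite_group
begin

lemma finite_subset_carrier [simp]: "H \<subseteq> carrier G \<Longrightarrow> finite H"
  using finite_subset fin by blast

lemma finite_subgroup [simp]: "subgroup H G \<Longrightarrow> finite H"
  by (simp add: subgroup.subset)

lemma finite_group_restrict: "subgroup H G \<Longrightarrow> finite_group (G\<lparr>carrier := H\<rparr>)"
  by (simp add: finite_group_def finite_group_axioms_def subgroup_imp_group)

lemma subgroup_nonempty [simp]: "subgroup H G \<Longrightarrow> H \<noteq> {}"
  using subgroup.one_closed by blast

lemma card_subgroup_pos [simp]: "subgroup H G \<Longrightarrow> 0 < card H"
  using card_gt_0_iff subgroup.one_closed by (metis empty_iff finite_subgroup)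

lemma order_pos [simp]: "0 < order G"
  by (simp add: order_gt_0_iff_finite)

lemma card_subgroup_dvd_order: "subgroup H G \<Longrightarrow> card H dvd order G"
  using lagrange dvd_triv_right by metis

lemma card_subgroup_dvd:
  assumes "subgroup K G" "subgroup H G" "K \<subseteq> H"
  shows "card K dvd card H"
proof -
  interpret H: finite_group "G\<lparr>carrier := H\<rparr>" by (rule finite_group_restrict[OF assms(2)])
  show ?thesis using H.card_subgroup_dvd_order[of K] assms by (simp add: subgroup_incl order_def)
qed

text \<open>In a finite group one inclusion is enough, since conjugation preserves
  cardinality.\<close>

lemma normalizer_eqI:
  assumes "H \<subseteq> carrier G" "g \<in> carrier G" "conj_set G g H \<subseteq> H"
  shows "g \<in> normalizer G H"
  using assms card_subset_eq[of H "conj_set G g H"] by (simp add: mem_normalizer)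

lemma exists_prime_power_subgroup:
  assumes "prime p" "subgroup H G" "p ^ n dvd card H"
  obtains K where "subgroup K G" "K \<subseteq> H" "card K = p ^ n"
proof -
  obtain m where "card H = p ^ n * m" using assms(3) by auto
  then obtain K where K: "subgroup K (G\<lparr>carrier := H\<rparr>)" "card K = p ^ n"
    using sylow_thm[OF assms(1) subgroup_imp_group[OF assms(2)], of n m] assms(2)
    by (auto simp: order_def)
  then show ?thesis using that assms(2) by (auto simp: subgroup_restrict_iff)
qed

text \<open>\<open>K x t = K x\<close> unfolds to \<open>x t x^-1 \<in> K\<close>. Fixed cosets thus
  correspond to conjugates of \<open>T\<close> inside \<open>K\<close>, which turns orbit counting
  into Sylow's theorems.\<close>

lemma r_coset_fixed_iff:
  assumes "subgroup K G" "T \<subseteq> carrier G" "x \<in> carrier G"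
  shows "(\<forall>t\<in>T. K #> x #> t = K #> x) \<longleftrightarrow> conj_set G x T \<subseteq> K"
proof -
  have "K #> x #> t = K #> x \<longleftrightarrow> x \<otimes> t \<otimes> inv x \<in> K" if "t \<in> T" for t
  proof -
    have [simp]: "t \<in> carrier G" using that assms by auto
    have "K #> x #> t = K #> (x \<otimes> t)"
      using assms by (simp add: coset_mult_assoc subgroup.subset)
    moreover have "K #> (x \<otimes> t) = K #> x \<longleftrightarrow> x \<otimes> t \<in> K #> x"
      using assms repr_independence[of "x \<otimes> t" K x] rcos_self[of "x \<otimes> t" K] by auto
    moreover have "x \<otimes> t \<in> K #> x \<longleftrightarrow> x \<otimes> t \<otimes> inv x \<in> K"
      using assms by (simp add: subgroup.rcos_module[OF assms(1)])
    ultimately show ?thesis by simp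
  qed
  then show ?thesis by (auto simp: conj_set_def)
qed

text \<open>\<open>T\<close> acts on the right cosets of \<open>K\<close> by right multiplication.
  For a Sylow subgroup \<open>K\<close> this gives conjugacy, for \<open>T = K\<close> the growth of
  normalizers.\<close>

lemma p_subgroup_rcosets_cong:
  assumes "prime p" "subgroup K G" "subgroup T G" "card T = p ^ n"
  shows "[card (rcosets K) = card {c \<in> rcosets K. \<forall>t\<in>T. c #> t = c}] (mod p)"
proof -
  interpret T: finite_group "G\<lparr>carrier := T\<rparr>" by (rule finite_group_restrict[OF assms(3)])
  have Tc: "T \<subseteq> carrier G" and Kc: "K \<subseteq> carrier G" using assms subgroup.subset by auto
  have sub: "c \<subseteq> carrier G" if "c \<in> rcosets K" for c
    using that subgroup.rcosets_carrier[OF assms(2) is_group] by auto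
  have fin_rc: "finite (rcosets K)"
    by (rule finite_subset[of _ "Pow (carrier G)"]) (use sub in auto)
  \<comment> \<open>Right multiplication is a right action, so \<open>g\<close> acts by
    \<open>inv g\<close>; the inverse disappears afterwards because \<open>T\<close> is closed under
    it.\<close>
  have "[card (rcosets K) =
      card {c \<in> rcosets K. \<forall>g\<in>carrier (G\<lparr>carrier := T\<rparr>). c #> inv g = c}] (mod p)"
  proof (rule T.p_group_action_fixed_points[OF assms(1) _ fin_rc])
    fix g c assume g: "g \<in> carrier (G\<lparr>carrier := T\<rparr>)" and c: "c \<in> rcosets K"
    then obtain x where "x \<in> carrier G" "c = K #> x" by (auto simp: RCOSETS_def)
    then show "c #> inv g \<in> rcosets K"
      using g Tc Kc rcosetsI[OF Kc, of "x \<otimes> inv g"] by (auto simp: coset_mult_assoc subset_iff)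
  next
    fix g h c assume g: "g \<in> carrier (G\<lparr>carrier := T\<rparr>)"
        "h \<in> carrier (G\<lparr>carrier := T\<rparr>)"
      and c: "c \<in> rcosets K"
    show "c #> inv (g \<otimes>\<^bsub>G\<lparr>carrier := T\<rparr>\<^esub> h) = c #> inv h #> inv g"
      using g Tc sub[OF c] by (auto simp: inv_mult_group coset_mult_assoc subset_iff)
  qed (use assms(4) sub in \<open>auto simp: order_def\<close>)
  moreover have "(\<forall>g\<in>T. c #> inv g = c) \<longleftrightarrow> (\<forall>t\<in>T. c #> t = c)" for c
    using subgroup.m_inv_closed[OF assms(3)] Tc by (metis inv_inv subsetD)
  ultimately show ?thesis by simp
qed

lemma card_rcosets_eq: "subgroup H G \<Longrightarrow> card (rcosets H) = order G div card H"
  using lagrange[of H] card_subgroup_pos[of H] by (metis nonzero_mult_div_cancel_right less_numeral_extra(3))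

text \<open>The number of cosets of \<open>P\<close> is prime to \<open>p\<close>, so the action of
  \<open>T\<close> on them fixes one.\<close>

lemma p_subgroup_conj_into_sylow:
  assumes "prime p" "subgroup P G" "\<not> p dvd order G div card P" "subgroup T G" "card T = p ^ n"
  obtains x where "x \<in> carrier G" "conj_set G x T \<subseteq> P"
proof -
  have "{c \<in> rcosets P. \<forall>t\<in>T. c #> t = c} \<noteq> {}"
    using p_subgroup_rcosets_cong[OF assms(1,2,4,5)] assms(3) card_rcosets_eq[OF assms(2)]
    by (metis card.empty cong_0_iff)
  then obtain x where "x \<in> carrier G" "\<forall>t\<in>T. P #> x #> t = P #> x"
    by (auto simp: RCOSETS_def)
  then show ?thesis using that r_coset_fixed_iff assms subgroup.subset by blast
qed

text \<open>The case \<open>T = K\<close>: the coset \<open>K x\<close> is fixed exactly if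
  \<open>x\<close> normalizes \<open>K\<close>, so the fixed cosets are those of \<open>K\<close> in
  its normalizer.\<close>

lemma p_subgroup_normalizer_index_cong:
  assumes "prime p" "subgroup K G" "card K = p ^ n"
  shows "[order G div card K = card (normalizer G K) div card K] (mod p)"
proof -
  have Kc: "K \<subseteq> carrier G" using assms subgroup.subset by auto
  have N: "subgroup (normalizer G K) G" by (rule subgroup_normalizer[OF assms(2)])
  interpret N: finite_group "G\<lparr>carrier := normalizer G K\<rparr>" by (rule finite_group_restrict[OF N])
  have K: "subgroup K (G\<lparr>carrier := normalizer G K\<rparr>)"
    using subgroup_incl[OF assms(2) N subgroup_subset_normalizer[OF assms(2)]] .
  have "{c \<in> rcosets K. \<forall>t\<in>K. c #> t = c} = rcosets\<^bsub>G\<lparr>carrier := normalizer G K\<rparr>\<^esub> K"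
  proof -
    have "(\<forall>t\<in>K. K #> x #> t = K #> x) \<longleftrightarrow> x \<in> normalizer G K" if
        "x \<in> carrier G" for x
      using that r_coset_fixed_iff[OF assms(2) Kc that] normalizer_eqI[OF Kc that] Kc
      by (auto simp: mem_normalizer)
    moreover have "normalizer G K \<subseteq> carrier G" using N subgroup.subset by auto
    ultimately show ?thesis by (auto simp: RCOSETS_def)
  qed
  then show ?thesis
    using p_subgroup_rcosets_cong[OF assms(1,2,2,3)] card_rcosets_eq[OF assms(2)] N.card_rcosets_eq[OF K]
    by (simp add: order_def)
qed

lemma p_subgroup_normalizer_grows:
  assumes "prime p" "subgroup K G" "card K = p ^ n" "p * card K dvd order G"
  shows "p * card K dvd card (normalizer G K)"
proof -
  have pos: "card K \<noteq> 0" using assms(2) by simp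
  have "p dvd order G div card K" using assms(4) pos by (metis dvd_div_iff_mult dvd_mult_right)
  then have "p dvd card (normalizer G K) div card K"
    using p_subgroup_normalizer_index_cong[OF assms(1-3)] cong_dvd_iff by blast
  moreover have "card K dvd card (normalizer G K)"
    using card_subgroup_dvd[OF assms(2) subgroup_normalizer] subgroup_subset_normalizer assms(2) by blast
  ultimately show ?thesis using pos by (simp add: dvd_div_iff_mult)
qed

text \<open>The index of \<open>P\<close> is \<open>k * l\<close>, with \<open>k\<close> its index
  in the normalizer and \<open>l\<close> the number of conjugates. It is congruent to
  \<open>k\<close>, and \<open>k\<close> is prime to \<open>p\<close>, so \<open>k\<close>
  cancels.\<close>

lemma sylow_number_cong:
  assumes "prime p" "subgroup P G" "card P = p ^ n" "\<not> p dvd order G div card P"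
  shows "[order G div card (normalizer G P) = 1] (mod p)"
proof -
  let ?N = "normalizer G P"
  have N: "subgroup ?N G" by (rule subgroup_normalizer[OF assms(2)])
  have d: "card P dvd card ?N" "card ?N dvd order G"
    using card_subgroup_dvd[OF assms(2) N] subgroup_subset_normalizer assms(2) card_subgroup_dvd_order[OF N] by auto
  obtain k where k: "card ?N = card P * k" using d by auto
  obtain l where l: "order G = card ?N * l" using d by auto
  have pos: "card P > 0" "card ?N > 0" using assms(2) N by auto
  have "order G div card P = k * l" using k l pos by (simp add: mult.assoc)
  moreover have "card ?N div card P = k" using k pos by simp
  moreover have "order G div card ?N = l" using l pos by simp
  moreover have "coprime p k"
    using assms(1,4) calculation by (auto intro!: prime_imp_coprime)
  moreover note p_subgroup_normalizer_index_cong[OF assms(1-3)]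
  ultimately have "[k * l = k * 1] (mod p)" "coprime k p" by (auto simp: coprime_commute)
  then show ?thesis using \<open>order G div card ?N = l\<close> cong_mult_lcancel_nat by blast
qed

text \<open>The fixed points of conjugation by \<open>T\<close> are the elements of \<open>A\<close>
  commuting with \<open>T\<close>. With \<open>A = T\<close> this yields the centre of a p-group,
  with \<open>card A\<close> prime to \<open>p\<close> the results on coprime action.\<close>

lemma p_subgroup_conj_fixed_cong:
  assumes "prime p" "subgroup T G" "card T = p ^ n" "A \<subseteq> carrier G" "T \<subseteq> normalizer G A"
  shows "[card A = card (A \<inter> centralizer G T)] (mod p)"
proof -
  interpret T: finite_group "G\<lparr>carrier := T\<rparr>" by (rule finite_group_restrict[OF assms(2)])
  have Tc: "T \<subseteq> carrier G" by (rule subgroup.subset[OF assms(2)])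
  have "[card A = card {x \<in> A. \<forall>g\<in>carrier (G\<lparr>carrier := T\<rparr>). g \<otimes> x \<otimes> inv g = x}] (mod p)"
  proof (rule T.p_group_action_fixed_points[OF assms(1)])
    fix g x assume "g \<in> carrier (G\<lparr>carrier := T\<rparr>)" "x \<in> A"
    then show "g \<otimes> x \<otimes> inv g \<in> A"
      using assms(4,5) mem_normalizer[of A g] by (auto simp: conj_set_def)
  next
    fix g h x assume g: "g \<in> carrier (G\<lparr>carrier := T\<rparr>)"
        "h \<in> carrier (G\<lparr>carrier := T\<rparr>)" "x \<in> A"
    then have "g \<in> carrier G" "h \<in> carrier G" "x \<in> carrier G" using Tc assms(4) by auto
    then show "g \<otimes>\<^bsub>G\<lparr>carrier := T\<rparr>\<^esub> h \<otimes> x \<otimes> inv (g \<otimes>\<^bsub>G\<lparr>carrier := T\<rparr>\<^esub> h)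
        = g \<otimes> (h \<otimes> x \<otimes> inv h) \<otimes> inv g"
      by (simp add: inv_mult_group m_assoc)
  qed (use assms in \<open>auto simp: order_def\<close>)
  moreover have "{x \<in> A. \<forall>g\<in>carrier (G\<lparr>carrier := T\<rparr>). g \<otimes> x \<otimes> inv g = x} = A \<inter> centralizer G T"
  proof -
    have "g \<otimes> x \<otimes> inv g = x \<longleftrightarrow> x \<otimes> g = g \<otimes> x" if "g \<in> T"
        "x \<in> A" for g x
      using that Tc assms(4) inv_solve_right'[of x "g \<otimes> x" g] by (auto simp: subset_iff)
    then show ?thesis using assms(4) by (auto simp: centralizer_def)
  qed
  ultimately show ?thesis by simp
qed

lemma exists_sylow_subgroup:
  assumes "prime p" "subgroup H G"
  obtains P where "subgroup P G" "P \<subseteq> H" "card P = p ^ multiplicity p (card H)"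
  using exists_prime_power_subgroup[OF assms, of "multiplicity p (card H)"] multiplicity_dvd by blast

lemma not_dvd_div_prime_power_multiplicity:
  fixes n :: nat
  assumes "prime p" "n > 0"
  shows "\<not> p dvd n div p ^ multiplicity p n"
  using assms multiplicity_decompose[of n p] prime_gt_1_nat[of p] by simp

lemma p_subgroup_conj_into_sylow_of:
  assumes "prime p" "subgroup H G" "subgroup P G" "P \<subseteq> H" "card P = p ^ multiplicity p (card H)"
    and "subgroup T G" "T \<subseteq> H" "card T = p ^ n"
  obtains x where "x \<in> H" "conj_set G x T \<subseteq> P"
proof -
  interpret H: finite_group "G\<lparr>carrier := H\<rparr>" by (rule finite_group_restrict[OF assms(2)])
  have "\<not> p dvd order (G\<lparr>carrier := H\<rparr>) div card P"
    using not_dvd_div_prime_power_multiplicity[OF assms(1), of "card H"] assms(2,5) by (simp add: order_def)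
  then obtain x where "x \<in> H" "conj_set (G\<lparr>carrier := H\<rparr>) x T \<subseteq> P"
    using H.p_subgroup_conj_into_sylow[OF assms(1) _ _ _ assms(8), of P] assms
    by (auto simp: subgroup_restrict_iff)
  then show ?thesis using that assms by (simp add: conj_set_restrict)
qed

lemma p_subgroup_normalizer_grows_in:
  assumes "prime p" "subgroup H G" "subgroup K G" "K \<subseteq> H" "card K = p ^ n" "p * card K dvd card H"
  shows "p * card K dvd card (H \<inter> normalizer G K)"
proof -
  interpret H: finite_group "G\<lparr>carrier := H\<rparr>" by (rule finite_group_restrict[OF assms(2)])
  show ?thesis
    using H.p_subgroup_normalizer_grows[OF assms(1) _ assms(5)] assms
    by (simp add: subgroup_restrict_iff order_def normalizer_restrict)
qed

text \<open>Equality of two subgroups is tested one prime at a time, so that each prime can have its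
  own argument.\<close>

lemma subgroup_eqI_sylow:
  assumes "subgroup C G" "subgroup H G" "C \<subseteq> H"
    and "\<And>q. prime q \<Longrightarrow> q dvd card H \<Longrightarrow> q ^ multiplicity q (card H) dvd card C"
  shows "C = H"
proof -
  have "card H dvd card C"
  proof (rule multiplicity_le_imp_dvd)
    show "card H \<noteq> 0" using assms(2) by simp
    fix q :: nat assume "prime q"
    then show "multiplicity q (card H) \<le> multiplicity q (card C)"
      using assms(1) assms(4)[of q] by (cases "q dvd card H")
        (auto simp: not_dvd_imp_multiplicity_0 intro!: multiplicity_geI dest: not_prime_unit)
  qed
  then have "card C = card H" using card_subgroup_dvd[OF assms(1-3)] by (rule dvd_antisym[rotated])
  then show ?thesis using assms card_subset_eq[of H C] by auto
qed

lemma p_group_center_nontrivial: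
  assumes "prime p" "subgroup P G" "card P = p ^ n" "n > 0"
  shows "p dvd card (P \<inter> centralizer G P)"
proof -
  have "p dvd card P" using assms by simp
  then show ?thesis
    using p_subgroup_conj_fixed_cong[OF assms(1-3), of P] assms subgroup_subset_normalizer cong_dvd_iff
      subgroup.subset by blast
qed

lemma card_one_subgroup_iff: "subgroup H G \<Longrightarrow> card H = 1 \<longleftrightarrow> H = {\<one>}"
  using subgroup.one_closed by (metis card_1_singleton_iff singletonD is_singletonI is_singleton_altdef)

lemma subgroup_inter_centralizer:
  "subgroup H G \<Longrightarrow> K \<subseteq> carrier G \<Longrightarrow> subgroup (H \<inter> centralizer G K) G"
  by (intro subgroups_Inter_pair subgroup_centralizer)

text \<open>If \<open>x\<close> is not central then its centralizer lies strictly between \<open>Z(P)\<close> and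
    \<open>P\<close>.\<close>

lemma abelian_of_central_index_prime:
  assumes "prime p" "subgroup P G" "subgroup Z G" "Z \<subseteq> P \<inter> centralizer G P" "card P = p * card Z"
  shows "P \<subseteq> centralizer G P"
proof
  fix x assume x: "x \<in> P"
  have Pc: "P \<subseteq> carrier G" using assms subgroup.subset by auto
  show "x \<in> centralizer G P"
  proof (cases "x \<in> Z")
    case True then show ?thesis using assms by auto
  next
    case False
    let ?C = "P \<inter> centralizer G {x}"
    have C: "subgroup ?C G" using subgroup_inter_centralizer[OF assms(2), of "{x}"] x Pc by auto
    have ZC: "Z \<subseteq> ?C" using assms(4) x by (auto simp: centralizer_def)
    have xC: "x \<in> ?C" using x Pc by (auto simp: centralizer_def)
    obtain k where k: "card ?C = card Z * k" using card_subgroup_dvd[OF assms(3) C ZC] by auto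
    have "card ?C dvd card P" using card_subgroup_dvd[OF C assms(2)] by auto
    then have "k dvd p" using k assms(3,5) by (simp add: mult.commute)
    moreover have "k \<noteq> 1"
    proof
      assume "k = 1"
      then have "Z = ?C" using k ZC C card_subset_eq[of ?C Z] by auto
      then show False using xC False by auto
    qed
    ultimately have "k = p" using assms(1) by (auto simp: prime_nat_iff)
    then have "?C = P" using k assms(5) card_subset_eq[of P ?C] assms(2) by (auto simp: mult.commute)
    then have "P \<subseteq> centralizer G {x}" by blast
    then have "y \<otimes> x = x \<otimes> y" if "y \<in> P" for y using that by (auto simp: centralizer_def)
    then show ?thesis using x Pc by (auto simp: centralizer_def)
  qed
qed

text \<open>The centre has a subgroup of order \<open>p\<close>, and its index in \<open>P\<close>
  is \<open>p\<close>.\<close>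

lemma order_prime_square_abelian:
  assumes "prime p" "subgroup P G" "card P = p ^ 2"
  shows "P \<subseteq> centralizer G P"
proof -
  have Pc: "P \<subseteq> carrier G" using assms subgroup.subset by auto
  let ?Z = "P \<inter> centralizer G P"
  have Z: "subgroup ?Z G" using subgroup_inter_centralizer[OF assms(2) Pc] .
  obtain Z where Z: "subgroup Z G" "Z \<subseteq> ?Z" "card Z = p ^ 1"
    using exists_prime_power_subgroup[OF assms(1) Z, of 1] p_group_center_nontrivial[OF assms] by auto
  then show ?thesis
    using abelian_of_central_index_prime[OF assms(1,2) Z(1,2)] assms(3) by (simp add: power2_eq_square)
qed

lemma order_prime_abelian:
  assumes "prime p" "subgroup P G" "card P = p"
  shows "P \<subseteq> centralizer G P"
  using abelian_of_central_index_prime[OF assms(1,2) triv_subgroup] assms(2,3)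
  by (auto simp: centralizer_def subgroup.one_closed subgroup.mem_carrier)

end

section \<open>Burnside's transfer\<close>

context finite_group
begin

lemma sylow_multiplicity_between:
  assumes "prime p" "subgroup P G" "subgroup H G" "P \<subseteq> H" "card P = p ^ multiplicity p (order G)"
  shows "multiplicity p (card H) = multiplicity p (order G)"
proof (rule antisym)
  have u: "\<not> is_unit p" using assms(1) not_prime_unit by blast
  show "multiplicity p (card H) \<le> multiplicity p (order G)"
    using card_subgroup_dvd_order[OF assms(3)] by (intro dvd_imp_multiplicity_le) auto
  show "multiplicity p (order G) \<le> multiplicity p (card H)"
    using card_subgroup_dvd[OF assms(2-4)] assms(3,5) u by (intro multiplicity_geI) auto
qed

lemma conj_mult_distrib:
  assumes "g \<in> carrier G" "x \<in> carrier G" "y \<in> carrier G"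
  shows "g \<otimes> x \<otimes> inv g \<otimes> (g \<otimes> y \<otimes> inv g) = g \<otimes> (x \<otimes> y) \<otimes> inv g"
  using assms by (simp add: m_assoc)

text \<open>Burnside: both \<open>P\<close> and its conjugate are Sylow subgroups of the centralizer of
    \<open>g x g\<^sup>-\<^sup>1\<close>.\<close>

lemma abelian_sylow_fusion:
  assumes p: "prime p" and P: "subgroup P G" "card P = p ^ multiplicity p (order G)"
    and ab: "P \<subseteq> centralizer G P" and N: "normalizer G P \<subseteq> centralizer G P"
    and x: "x \<in> P" and g: "g \<in> carrier G" and y: "g \<otimes> x \<otimes> inv g \<in> P"
  shows "g \<otimes> x \<otimes> inv g = x"
proof -
  let ?y = "g \<otimes> x \<otimes> inv g" and ?C = "centralizer G {g \<otimes> x \<otimes> inv g}"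
  have Pc: "P \<subseteq> carrier G" using P subgroup.subset by auto
  then have [simp]: "x \<in> carrier G" "g \<in> carrier G" using x g by auto
  have C: "subgroup ?C G" by (rule subgroup_centralizer) auto
  have comm: "u \<otimes> v = v \<otimes> u" if "u \<in> P" "v \<in> P" for u v
    using ab that by (auto simp: centralizer_def)
  have PC: "P \<subseteq> ?C" using comm y Pc by (auto simp: centralizer_def)
  have gPC: "conj_set G g P \<subseteq> ?C"
  proof -
    have "g \<otimes> h \<otimes> inv g \<otimes> ?y = ?y \<otimes> (g \<otimes> h \<otimes> inv g)" if "h \<in> P"
        for h
      using that Pc comm[OF that x] by (auto simp: conj_mult_distrib subset_iff)
    then show ?thesis using Pc by (auto simp: conj_set_def centralizer_def)
  qed
  have gP: "subgroup (conj_set G g P) G" "card (conj_set G g P) = p ^ multiplicity p (order G)"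
    using P Pc by (auto simp: subgroup_conj_set)
  have "card P = p ^ multiplicity p (card ?C)"
    using sylow_multiplicity_between[OF p P(1) C PC P(2)] P(2) by simp
  then obtain c where c: "c \<in> ?C" "conj_set G c (conj_set G g P) \<subseteq> P"
    using p_subgroup_conj_into_sylow_of[OF p C P(1) PC _ gP(1) gPC gP(2)] by blast
  then have cc: "c \<in> carrier G" "c \<otimes> ?y = ?y \<otimes> c" by (auto simp: centralizer_def)
  \<comment> \<open>\<open>c\<close> carries the conjugate back to \<open>P\<close>, so
    \<open>c \<otimes> g\<close> normalizes and therefore centralizes \<open>P\<close>. As
    \<open>c\<close> also commutes with \<open>?y\<close>, conjugating \<open>x\<close> by
    \<open>c \<otimes> g\<close> gives both \<open>x\<close> and \<open>?y\<close>.\<close>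
  have "c \<otimes> g \<in> normalizer G P"
    using c cc Pc by (intro normalizer_eqI) (auto simp: conj_set_mult)
  then have "c \<otimes> g \<otimes> x = x \<otimes> (c \<otimes> g)" using N x by (auto simp: centralizer_def)
  then have "c \<otimes> g \<otimes> x \<otimes> inv (c \<otimes> g) = x" using cc by (simp add: m_assoc inv_mult_group)
  moreover have "c \<otimes> g \<otimes> x \<otimes> inv (c \<otimes> g) = c \<otimes> ?y \<otimes> inv c"
    using cc(1) by (simp add: m_assoc inv_mult_group)
  moreover have "c \<otimes> ?y \<otimes> inv c = ?y"
    unfolding cc(2) using cc(1) by (simp add: m_assoc)
  ultimately show ?thesis by simp
qed

text \<open>The transfer \<open>g \<mapsto> \<Prod> t(c) g t(cg)\<^sup>-\<^sup>1\<close>, the product running over the right cosets \<open>c\<close> of \<open>P\<close>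
  and \<open>t\<close> choosing a representative of each of them.\<close>

lemma burnside_transfer:
  assumes p: "prime p" "p dvd order G" and P: "subgroup P G" "card P = p ^ multiplicity p (order G)"
    and ab: "P \<subseteq> centralizer G P" and N: "normalizer G P \<subseteq> centralizer G P"
  obtains V x where "V \<in> hom G (G\<lparr>carrier := P\<rparr>)" "x \<in> P" "V x \<noteq> \<one>"
proof -
  let ?P = "G\<lparr>carrier := P\<rparr>"
  interpret P: finite_group ?P by (rule finite_group_restrict[OF P(1)])
  interpret P: comm_group ?P
    using ab by (intro P.group_comm_groupI) (auto simp: centralizer_def)
  have Pc: "P \<subseteq> carrier G" using P subgroup.subset by auto
  define t where "t c = (SOME x. x \<in> c)" for c :: "'a set"
  define f where "f g c = t c \<otimes> g \<otimes> inv (t (c #> g))" for g c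
  have sub: "c \<subseteq> carrier G" if "c \<in> rcosets P" for c
    using that subgroup.rcosets_carrier[OF P(1) is_group] by auto
  have finX: "finite (rcosets P)"
    by (rule finite_subset[of _ "Pow (carrier G)"]) (use sub in auto)
  have t: "t c \<in> c" if "c \<in> rcosets P" for c
    unfolding t_def using subgroup.rcosets_non_empty[OF P(1) that] by (metis all_not_in_conv someI_ex)
  have tc [simp]: "t c \<in> carrier G" if "c \<in> rcosets P" for c using t[OF that] sub[OF that] by auto
  have act [simp]: "c #> g \<in> rcosets P" if "c \<in> rcosets P" "g \<in> carrier G" for c g
  proof -
    obtain a where "a \<in> carrier G" "c = P #> a" using \<open>c \<in> rcosets P\<close> by (auto simp: RCOSETS_def)
    then show ?thesis using that Pc rcosetsI[OF Pc, of "a \<otimes> g"] by (simp add: coset_mult_assoc)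
  qed
  have act_mult: "c #> g #> h = c #> (g \<otimes> h)" if "c \<in> rcosets P" "g \<in> carrier G" "h \<in> carrier G"
      for c g h
    using that sub by (simp add: coset_mult_assoc)
  have act_one [simp]: "c #> \<one> = c" if "c \<in> rcosets P" for c using that sub by simp
  have fP: "f g c \<in> P" if "c \<in> rcosets P" "g \<in> carrier G" for g c
  proof -
    have "t c \<otimes> g \<in> c #> g" using t[OF that(1)] by (auto simp: r_coset_def)
    then show ?thesis unfolding f_def using diff_neutralizes[OF P(1) act[OF that]] t[OF act[OF that]] by blast
  qed
  define V where "V g = finprod ?P (f g) (rcosets P)" for g
  have "V \<in> hom G ?P"
  proof (rule homI)
    fix g assume "g \<in> carrier G"
    then show "V g \<in> carrier ?P" unfolding V_def by (intro P.finprod_closed) (auto simp: fP)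
  next
    fix g h assume gh: "g \<in> carrier G" "h \<in> carrier G"
    \<comment> \<open>The representative of \<open>cg\<close> cancels between the two factors; the
      second factor is then reindexed by the permutation \<open>c \<mapsto> cg\<close>.\<close>
    have "V (g \<otimes> h) = finprod ?P (\<lambda>c. f g c \<otimes>\<^bsub>?P\<^esub> f h (c #> g)) (rcosets P)"
      unfolding V_def
    proof (rule P.finprod_cong')
      fix c assume c: "c \<in> rcosets P"
      then show "f (g \<otimes> h) c = f g c \<otimes>\<^bsub>?P\<^esub> f h (c #> g)"
        using gh by (simp add: f_def act_mult m_assoc)
    qed (use gh fP in \<open>auto intro!: subgroup.m_closed[OF P(1)]\<close>)
    also have "\<dots> = V g \<otimes>\<^bsub>?P\<^esub> finprod ?P (\<lambda>c. f h (c #> g)) (rcosets P)"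
      unfolding V_def using gh by (intro P.finprod_multf) (auto simp: fP)
    also have "finprod ?P (\<lambda>c. f h (c #> g)) (rcosets P) = V h"
    proof -
      have bij: "bij_betw (\<lambda>c. c #> g) (rcosets P) (rcosets P)"
        by (rule bij_betwI[where g = "\<lambda>c. c #> inv g"]) (use gh in \<open>auto simp: act_mult\<close>)
      show ?thesis
        unfolding V_def using P.finprod_reindex[of "f h" "\<lambda>c. c #> g" "rcosets P"] bij gh fP
        by (auto simp: bij_betw_def)
    qed
    finally show "V (g \<otimes> h) = V g \<otimes>\<^bsub>?P\<^esub> V h" .
  qed
  have pow: "x [^]\<^bsub>?P\<^esub> (n::nat) = x [^] n" for x n by (simp flip: nat_pow_consistent)
  \<comment> \<open>An arbitrary set \<open>Y\<close> of cosets stable under \<open>x\<close> lets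
    strong induction split off one cycle of right multiplication by \<open>x\<close> at a
    time.\<close>
  have eval: "finprod ?P (f x) Y = x [^] card Y"
    if x: "x \<in> P" and "Y \<subseteq> rcosets P" "\<And>c. c \<in> Y \<Longrightarrow> c #> x \<in> Y" for x Y
    using that(2,3)
  proof (induction "card Y" arbitrary: Y rule: less_induct)
    case less
    have xc [simp]: "x \<in> carrier G" using x Pc by auto
    have finY: "finite Y" using less.prems(1) finX finite_subset by blast
    show ?case
    proof (cases "Y = {}")
      case False
      then obtain c0 where c0: "c0 \<in> Y" by auto
      then have c0X [simp]: "c0 \<in> rcosets P" using less.prems by auto
      define \<omega> where "\<omega> j = c0 #> (x [^] j)" for j :: nat
      have \<omega>X [simp]: "\<omega> j \<in> rcosets P" for j by (simp add: \<omega>_def)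
      have \<omega>Suc: "\<omega> (Suc j) = \<omega> j #> x" for j by (simp add: \<omega>_def act_mult)
      have \<omega>Y: "\<omega> j \<in> Y" for j
        by (induction j) (use c0 less.prems(2) in \<open>simp_all add: \<omega>Suc, simp add: \<omega>_def\<close>)
      have ex: "\<exists>m>0. \<omega> m = c0"
        using order_pos by (intro exI[of _ "order G"]) (simp add: \<omega>_def pow_order_eq_1)
      define m where "m = (LEAST m. m > 0 \<and> \<omega> m = c0)"
      have m: "m > 0" "\<omega> m = c0" using LeastI_ex[OF ex] by (auto simp: m_def)
      have least: "m \<le> k" if "k > 0" "\<omega> k = c0" for k
        unfolding m_def using that by (intro Least_le) auto
      have ne: "\<omega> i \<noteq> \<omega> j" if "i < j" "j < m" for i j
      proof
        assume eq: "\<omega> i = \<omega> j"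
        have "\<omega> j #> inv (x [^] i) = \<omega> (j - i)"
        proof -
          have "x [^] j \<otimes> inv (x [^] i) = x [^] (j - i)"
            using \<open>i < j\<close> nat_pow_mult[of x "j - i" i] inv_solve_right'[of "x [^] (j - i)" "x [^] j" "x [^] i"]
            by simp
          then show ?thesis by (simp add: \<omega>_def act_mult)
        qed
        moreover have "\<omega> i #> inv (x [^] i) = c0" by (simp add: \<omega>_def act_mult)
        ultimately have "\<omega> (j - i) = c0" using eq by simp
        then show False using least[of "j - i"] that by auto
      qed
      have inj: "inj_on \<omega> {..<m}"
        using ne by (auto simp: inj_on_def) (metis linorder_neqE_nat)
      define O' where "O' = \<omega> ` {..<m}"
      have cardO: "card O' = m" using inj by (simp add: O'_def card_image)
      have OY: "O' \<subseteq> Y" using \<omega>Y by (auto simp: O'_def)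
      \<comment> \<open>Along a cycle the inner representatives cancel; only those of the first and
        the last coset survive.\<close>
      have tele: "finprod ?P (\<lambda>j. f x (\<omega> j)) {..<k} = t c0 \<otimes> x [^] k \<otimes> inv (t (\<omega> k))" for k
      proof (induction k)
        case 0 then show ?case by (simp add: \<omega>_def)
      next
        case (Suc k)
        have "finprod ?P (\<lambda>j. f x (\<omega> j)) {..<Suc k}
            = f x (\<omega> k) \<otimes>\<^bsub>?P\<^esub> finprod ?P (\<lambda>j. f x (\<omega> j)) {..<k}"
          unfolding lessThan_Suc by (rule P.finprod_insert) (auto simp: fP)
        \<comment> \<open>\<open>finprod_insert\<close> puts the new factor in front; in the abelian
          \<open>P\<close> it can move to the end, where it cancels.\<close>
        also have "\<dots> = finprod ?P (\<lambda>j. f x (\<omega> j)) {..<k} \<otimes>\<^bsub>?P\<^esub> f x (\<omega> k)"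
          by (rule P.m_comm[OF _ P.finprod_closed]) (auto simp: fP)
        also have "\<dots> = t c0 \<otimes> x [^] Suc k \<otimes> inv (t (\<omega> (Suc k)))"
          unfolding Suc by (simp add: f_def \<omega>Suc m_assoc)
        finally show ?case .
      qed
      have prodO: "finprod ?P (f x) O' = x [^] m"
      proof -
        have xm: "x [^] m \<in> P" using x P.nat_pow_closed[of x m] by (simp add: pow)
        have "finprod ?P (f x) O' = finprod ?P (\<lambda>j. f x (\<omega> j)) {..<m}"
          unfolding O'_def by (rule P.finprod_reindex) (use inj in \<open>auto simp: fP\<close>)
        also have eq: "\<dots> = t c0 \<otimes> x [^] m \<otimes> inv (t c0)" using tele[of m] m by simp
        also have "\<dots> = x [^] m"
        \<comment> \<open>When the cycle closes, the product is a conjugate of \<open>x^m\<close> in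
          \<open>G\<close> that lies in \<open>P\<close>, so by the fusion lemma it is
          \<open>x^m\<close> itself, whatever the representative.\<close>
        proof (rule abelian_sylow_fusion[OF p(1) P ab N xm])
          have "finprod ?P (\<lambda>j. f x (\<omega> j)) {..<m} \<in> carrier ?P"
            by (rule P.finprod_closed) (auto simp: fP)
          then show "t c0 \<otimes> x [^] m \<otimes> inv (t c0) \<in> P" using eq by simp
        qed simp
        finally show ?thesis .
      qed
      \<comment> \<open>The induction needs the complement of the cycle to be stable under
        \<open>x\<close>: no coset outside may be moved into the cycle.\<close>
      have orbit_back: "c \<in> O'" if "c \<in> rcosets P" "c #> x \<in> O'" for c
      proof -
        obtain j where j: "j < m" "c #> x = \<omega> j" using \<open>c #> x \<in> O'\<close> by (auto simp: O'_def)
        obtain i where i: "i < m" "\<omega> (Suc i) = \<omega> j"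
        proof (cases j)
          case 0
          have "\<omega> (Suc (m - 1)) = \<omega> 0" using m by (simp add: \<omega>_def)
          then show ?thesis using 0 that[of "m - 1"] m by auto
        next
          case (Suc i) then show ?thesis using j that[of i] by auto
        qed
        have "c = c #> x #> inv x" using \<open>c \<in> rcosets P\<close> by (simp add: act_mult)
        also have "\<dots> = \<omega> i #> x #> inv x" using i j by (simp add: \<omega>Suc)
        also have "\<dots> = \<omega> i" by (simp add: act_mult)
        finally show ?thesis using i by (auto simp: O'_def)
      qed
      have "card (Y - O') < card Y"
        using finY cardO m OY by (intro psubset_card_mono) (auto simp: O'_def)
      then have "finprod ?P (f x) (Y - O') = x [^] card (Y - O')"
        using less.hyps[of "Y - O'"] less.prems orbit_back by blast
      moreover have "finprod ?P (f x) (O' \<union> (Y - O')) = finprod ?P (f x) O' \<otimes>\<^bsub>?P\<^esub> finprod ?P (f x) (Y - O')"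
        using finY OY less.prems(1) fP by (intro P.finprod_Un_disjoint) (auto simp: O'_def)
      moreover have "O' \<union> (Y - O') = Y" using OY by auto
      moreover have "m + card (Y - O') = card Y"
        using finY OY cardO by (metis card_Diff_subset card_mono finite_subset le_add_diff_inverse)
      ultimately show ?thesis using prodO by (simp add: nat_pow_mult)
    qed simp
  qed
  \<comment> \<open>An element of order \<open>p\<close> is a witness: its transfer is its power by
    the index of \<open>P\<close>, which is prime to \<open>p\<close>.\<close>
  have "p ^ 1 dvd card P" using p P(2) by (simp add: prime_multiplicity_gt_zero_iff)
  then obtain K where K: "subgroup K G" "K \<subseteq> P" "card K = p"
    using exists_prime_power_subgroup[OF p(1) P(1), of 1] by auto
  then have "K \<noteq> {\<one>}" using p(1) by auto
  then obtain x where x: "x \<in> K" "x \<noteq> \<one>" using subgroup.one_closed[OF K(1)] by auto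
  have xP: "x \<in> P" using x K by auto
  have "V x = x [^] card (rcosets P)"
    unfolding V_def using eval[OF xP, of "rcosets P"] xP Pc by auto
  moreover have "x [^] card (rcosets P) \<noteq> \<one>"
  proof
    assume "x [^] card (rcosets P) = \<one>"
    then have 1: "ord x dvd card (rcosets P)" using xP Pc by (auto simp: pow_eq_id)
    interpret K: finite_group "G\<lparr>carrier := K\<rparr>" by (rule finite_group_restrict[OF K(1)])
    have "x [^] p = \<one>"
      using K.pow_order_eq_1[of x] x K(3) by (simp add: order_def flip: nat_pow_consistent)
    then have "ord x dvd p" using xP Pc by (auto simp: pow_eq_id)
    moreover have "ord x \<noteq> 1" using x xP Pc ord_eq_1[of x] by auto
    ultimately have "ord x = p" using p(1) by (auto simp: prime_nat_iff)
    then have "p dvd order G div card P" using 1 card_rcosets_eq[OF P(1)] by simp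
    then show False using not_dvd_div_prime_power_multiplicity[OF p(1), of "order G"] P(2) by simp
  qed
  ultimately show ?thesis using that[OF \<open>V \<in> hom G ?P\<close> xP] by simp
qed

end

section \<open>Nonabelian simple groups\<close>

context finite_group
begin

lemma card_conjugates:
  assumes "H \<subseteq> carrier G"
  shows "card ((\<lambda>g. conj_set G g H) ` carrier G) * card (normalizer G H) = order G"
proof -
  let ?\<phi> = "\<lambda>g. \<lambda>H \<in> {H. H \<subseteq> carrier G}. g <# H #> (inv g)"
  interpret group_action G "{H. H \<subseteq> carrier G}" ?\<phi>
    by (rule action_by_conjugation_on_power_set)
  have "orbit G ?\<phi> H = (\<lambda>g. conj_set G g H) ` carrier G"
    using assms by (auto simp: orbit_def conj_set_eq_cosets)
  then show ?thesis
    using orbit_stabilizer_theorem[of H] assms by (simp add: normalizer_def)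
qed

lemma prime_power_subgroup_card:
  assumes "prime p" "subgroup H G" "subgroup K G" "K \<subseteq> H" "card H = p ^ n"
  obtains k where "k \<le> n" "card K = p ^ k"
  using card_subgroup_dvd[OF assms(3,2,4)] assms(1,5) by (auto simp: divides_primepow_nat)

lemma subset_centralizer_commute:
  "A \<subseteq> carrier G \<Longrightarrow> B \<subseteq> carrier G \<Longrightarrow> A \<subseteq> centralizer G B \<longleftrightarrow> B \<subseteq> centralizer G A"
  by (auto simp: centralizer_def subset_iff)

text \<open>The fixed points form a subgroup, so their number is \<open>1\<close> or
  \<open>r\<close>; it is congruent to \<open>r\<close> modulo \<open>q\<close>, and
  \<open>1 < r < q\<close> excludes \<open>1\<close>.\<close>

lemma p_subgroup_centralizes_order_prime:
  assumes "prime q" "subgroup T G" "card T = q ^ n" "prime r" "r < q"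
    and "subgroup A G" "card A = r" "T \<subseteq> normalizer G A"
  shows "T \<subseteq> centralizer G A"
proof -
  have sub: "T \<subseteq> carrier G" "A \<subseteq> carrier G" using assms subgroup.subset by auto
  let ?F = "A \<inter> centralizer G T"
  have F: "subgroup ?F G" using subgroup_inter_centralizer[OF assms(6) sub(1)] .
  have cong: "[r = card ?F] (mod q)"
    using p_subgroup_conj_fixed_cong[OF assms(1-3) sub(2) assms(8)] assms(7) by simp
  have "card ?F dvd r" using card_subgroup_dvd[OF F assms(6)] assms(7) by auto
  then have "card ?F = 1 \<or> card ?F = r" using assms(4) by (auto simp: prime_nat_iff)
  moreover have "card ?F \<noteq> 1"
  proof
    assume "card ?F = 1"
    then have "[r = 1] (mod q)" using cong by simp
    then show False using assms(1,4,5) prime_gt_1_nat[of q] prime_gt_1_nat[of r] by (simp add: cong_def)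
  qed
  ultimately have "?F = A" using card_subset_eq[of A ?F] assms(6,7) by auto
  then have "A \<subseteq> centralizer G T" by blast
  then show ?thesis using subset_centralizer_commute sub by blast
qed

text \<open>There are \<open>r^k\<close> fixed points, and \<open>q\<close> divides
  \<open>r^2 - r^k\<close>. For \<open>k = 1\<close> it would divide \<open>r\<close> or
  \<open>r - 1\<close>, both too small; for \<open>k = 0\<close> it divides \<open>r + 1\<close>.
  This is the origin of the pair \<open>2, 3\<close>.\<close>

lemma p_subgroup_centralizes_order_prime_square:
  assumes "prime q" "subgroup T G" "card T = q ^ n" "prime r" "r < q"
    and "subgroup A G" "card A = r ^ 2" "T \<subseteq> normalizer G A"
  shows "T \<subseteq> centralizer G A \<or> r = 2 \<and> q = 3"
proof -
  have sub: "T \<subseteq> carrier G" "A \<subseteq> carrier G" using assms subgroup.subset by auto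
  let ?F = "A \<inter> centralizer G T"
  have F: "subgroup ?F G" using subgroup_inter_centralizer[OF assms(6) sub(1)] .
  have cong: "[r ^ 2 = card ?F] (mod q)"
    using p_subgroup_conj_fixed_cong[OF assms(1-3) sub(2) assms(8)] assms(7) by simp
  obtain k where k: "k \<le> 2" "card ?F = r ^ k"
    using prime_power_subgroup_card[OF assms(4,6) F _ assms(7)] by auto
  have r1: "r > 1" using assms(4) prime_gt_1_nat by blast
  have dvd: "q dvd r ^ 2 - r ^ k"
    using cong k r1 by (metis cong_altdef_nat cong_sym less_imp_le_nat power_increasing)
  have nq: "\<not> q dvd r - 1" "\<not> q dvd r"
    using r1 assms(5) by (auto dest!: dvd_imp_le)
  consider "k = 2" | "k = 1" | "k = 0" using k(1) by linarith
  then show ?thesis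
  proof cases
    case 1
    then have "?F = A" using card_subset_eq[of A ?F] assms(6,7) k by auto
    then have "A \<subseteq> centralizer G T" by blast
    then show ?thesis using subset_centralizer_commute sub by blast
  next
    case 2
    then have "q dvd r * (r - 1)" using dvd by (simp add: power2_eq_square right_diff_distrib')
    then show ?thesis using nq assms(1) prime_dvd_mult_nat by blast
  next
    case 3
    have "r ^ 2 - 1 = (r + 1) * (r - 1)"
      by (simp add: power2_eq_square algebra_simps)
    then have "q dvd (r + 1) * (r - 1)" using dvd 3 by simp
    then have "q dvd r + 1" using nq assms(1) prime_dvd_mult_nat by blast
    then have q: "q = r + 1" using dvd_imp_le[of q "r + 1"] assms(5) by auto
    have "r = 2"
    proof (rule ccontr)
      assume "r \<noteq> 2"
      then have "odd r" "odd q" using assms(1,4,5) r1 prime_odd_nat[of r] prime_odd_nat[of q] by auto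
      then show False using q by simp
    qed
    then show ?thesis using q by simp
  qed
qed

end

text \<open>\<open>simple_group\<close> also admits the cyclic groups of prime order; the added
  assumption excludes them.\<close>

locale nonabelian_simple_group = finite_group + simple_group +
  assumes nonabelian: "\<exists>x\<in>carrier G. \<exists>y\<in>carrier G. x \<otimes> y \<noteq> y \<otimes> x"
begin

lemma not_carrier_subset_centralizer: "\<not> carrier G \<subseteq> centralizer G (carrier G)"
  using nonabelian by (auto simp: centralizer_def)

lemma normal_trivial: "H \<lhd> G \<Longrightarrow> H = carrier G \<or> H = {\<one>}"
  by (rule no_real_normal_subgroup)

lemma normalizer_proper:
  assumes "subgroup H G" "H \<noteq> {\<one>}" "H \<noteq> carrier G"
  shows "normalizer G H \<noteq> carrier G"
  using assms normal_trivial normal_iff_normalizer by blast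

lemma centralizer_proper:
  assumes "subgroup H G" "H \<noteq> {\<one>}"
  shows "centralizer G H \<noteq> carrier G"
proof
  assume eq: "centralizer G H = carrier G"
  have Hc: "H \<subseteq> carrier G" using assms subgroup.subset by auto
  then have "normalizer G H = carrier G"
    using centralizer_subset_normalizer[OF Hc] eq subgroup.subset[OF subgroup_normalizer[OF assms(1)]] by auto
  then have "H = carrier G" using normalizer_proper assms by blast
  then show False using eq not_carrier_subset_centralizer by auto
qed

text \<open>Otherwise transfer gives a nontrivial homomorphism to the abelian \<open>P\<close>; by
  simplicity it is injective, which makes \<open>G\<close> abelian.\<close>

lemma abelian_sylow_normalizer:
  assumes "prime p" "p dvd order G" "subgroup P G" "card P = p ^ multiplicity p (order G)"
    and "P \<subseteq> centralizer G P"
  shows "\<not> normalizer G P \<subseteq> centralizer G P"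
proof
  assume "normalizer G P \<subseteq> centralizer G P"
  then obtain V x where V: "V \<in> hom G (G\<lparr>carrier := P\<rparr>)" and x: "x \<in> P" "V x \<noteq> \<one>"
    using burnside_transfer assms by blast
  interpret V: group_hom G "G\<lparr>carrier := P\<rparr>" V
    using V assms(3) by (simp add: group_hom_def group_hom_axioms_def subgroup_imp_group)
  have "kernel G (G\<lparr>carrier := P\<rparr>) V = {\<one>}"
  proof -
    have "x \<notin> kernel G (G\<lparr>carrier := P\<rparr>) V" "x \<in> carrier G"
      using x assms(3) subgroup.mem_carrier by (auto simp: kernel_def)
    then show ?thesis using normal_trivial[OF V.normal_kernel] by auto
  qed
  then have inj: "inj_on V (carrier G)" by (rule V.trivial_ker_imp_inj)
  have "y \<otimes> z = z \<otimes> y" if "y \<in> carrier G" "z \<in> carrier G" for y z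
  proof -
    have VP: "V y \<in> P" "V z \<in> P" using V.hom_closed that by auto
    then have "V y \<otimes> V z = V z \<otimes> V y" using assms(5) by (auto simp: centralizer_def)
    then have "V (y \<otimes> z) = V (z \<otimes> y)" using that by simp
    then show ?thesis using inj that by (auto simp: inj_on_def)
  qed
  then show False using nonabelian by auto
qed

text \<open>Turns the transfer result into an action of coprime order. If every such
  \<open>T\<close> centralized \<open>P\<close>, the centralizer would contain the full
  \<open>q\<close>-part of the normalizer for \<open>q \<noteq> p\<close>, and the
  \<open>p\<close>-part because it contains \<open>P\<close>; the two would coincide.\<close>

lemma abelian_sylow_noncentral_action:
  assumes "prime p" "p dvd order G" "subgroup P G" "card P = p ^ multiplicity p (order G)"
    and "P \<subseteq> centralizer G P"
  obtains q T n where "prime q" "q \<noteq> p" "subgroup T G" "card T = q ^ n" "T \<subseteq> normalizer G P"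
    "\<not> T \<subseteq> centralizer G P"
proof (rule ccontr)
  assume H: "\<not> thesis"
  have Pc: "P \<subseteq> carrier G" using assms subgroup.subset by auto
  have N: "subgroup (normalizer G P) G" and C: "subgroup (centralizer G P) G"
    using assms Pc subgroup_normalizer subgroup_centralizer by auto
  have CN: "centralizer G P \<subseteq> normalizer G P" by (rule centralizer_subset_normalizer[OF Pc])
  have "centralizer G P = normalizer G P"
  proof (rule subgroup_eqI_sylow[OF C N CN])
    fix q :: nat assume q: "prime q" "q dvd card (normalizer G P)"
    show "q ^ multiplicity q (card (normalizer G P)) dvd card (centralizer G P)"
    proof (cases "q = p")
      case True
      then show ?thesis
        using sylow_multiplicity_between[OF assms(1,3) N _ assms(4)] subgroup_subset_normalizer[OF assms(3)]
          card_subgroup_dvd[OF assms(3) C assms(5)] assms(4) by simp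
    next
      case False
      obtain T where T: "subgroup T G" "T \<subseteq> normalizer G P"
          "card T = q ^ multiplicity q (card (normalizer G P))"
        using exists_sylow_subgroup[OF q(1) N] by blast
      then have "T \<subseteq> centralizer G P" using H that q(1) False by blast
      then show ?thesis using card_subgroup_dvd[OF T(1) C] T(3) by simp
    qed
  qed
  then show False using abelian_sylow_normalizer[OF assms] by simp
qed

text \<open>The action on the right cosets of \<open>H\<close>. An element of its kernel fixes the
  coset \<open>H\<close> and so lies in \<open>H\<close>; the kernel is proper, hence
  trivial.\<close>

lemma embeds_sym_group_index:
  assumes "subgroup H G" "H \<noteq> carrier G"
  obtains \<phi> where "\<phi> \<in> hom G (sym_group (order G div card H))" "inj_on \<phi> (carrier G)"
proof -
  let ?X = "rcosets H" and ?n = "order G div card H"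
  have Hc: "H \<subseteq> carrier G" using assms subgroup.subset by auto
  have sub: "c \<subseteq> carrier G" if "c \<in> ?X" for c
    using that subgroup.rcosets_carrier[OF assms(1) is_group] by auto
  have finX: "finite ?X" by (rule finite_subset[of _ "Pow (carrier G)"]) (use sub in auto)
  obtain b where b: "bij_betw b {1..?n} ?X"
    using ex_bij_betw_nat_finite_1[OF finX] card_rcosets_eq[OF assms(1)] by auto
  let ?b' = "inv_into {1..?n} b"
  have act: "c #> g \<in> ?X" if "c \<in> ?X" "g \<in> carrier G" for c g
  proof -
    obtain a where "a \<in> carrier G" "c = H #> a" using \<open>c \<in> ?X\<close> by (auto simp: RCOSETS_def)
    then show ?thesis using that Hc rcosetsI[OF Hc, of "a \<otimes> g"] by (simp add: coset_mult_assoc)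
  qed
  have bX: "b i \<in> ?X" if "i \<in> {1..?n}" for i using b that by (auto simp: bij_betw_def)
  have b'n: "?b' c \<in> {1..?n}" if "c \<in> ?X" for c using b that by (metis bij_betw_def inv_into_into)
  have bb': "b (?b' c) = c" if "c \<in> ?X" for c using b that by (metis bij_betw_inv_into_right)
  have b'b: "?b' (b i) = i" if "i \<in> {1..?n}" for i using b that by (metis bij_betw_inv_into_left)
  \<comment> \<open>The cosets are numbered by \<open>b\<close> because \<open>sym_group\<close>
    acts on an initial segment. The inverse makes a left action of right multiplication, and
    \<open>permutes\<close> demands the identity outside the segment.\<close>
  define \<phi> where "\<phi> g i = (if i \<in> {1..?n} then ?b' (b i #> inv g) else i)" for g i
  have comp: "\<phi> (g \<otimes> h) = \<phi> g \<circ> \<phi> h" if "g \<in> carrier G" "h \<in> carrier G" for g h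
  proof
    fix i
    show "\<phi> (g \<otimes> h) i = (\<phi> g \<circ> \<phi> h) i"
    proof (cases "i \<in> {1..?n}")
      case True
      then have "b i \<in> ?X" "b i #> inv h \<in> ?X" using bX act that by auto
      then show ?thesis
        using True that sub b'n[of "b i #> inv h"] bb'[of "b i #> inv h"]
        by (auto simp: \<phi>_def coset_mult_assoc inv_mult_group)
    qed (auto simp: \<phi>_def)
  qed
  have one: "\<phi> \<one> = id" using b'b bX sub by (auto simp: \<phi>_def fun_eq_iff)
  have perm: "\<phi> g permutes {1..?n}" if "g \<in> carrier G" for g
  proof (rule bij_imp_permutes)
    show "bij_betw (\<phi> g) {1..?n} {1..?n}"
    proof (rule bij_betwI[where g = "\<phi> (inv g)"])
      show "\<phi> g \<in> {1..?n} \<rightarrow> {1..?n}" "\<phi> (inv g) \<in> {1..?n} \<rightarrow> {1..?n}"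
        using that bX act b'n by (auto simp: \<phi>_def)
      show "\<phi> (inv g) (\<phi> g i) = i" "\<phi> g (\<phi> (inv g) i) = i" for i
        using comp[of "inv g" g] comp[of g "inv g"] one that by (auto simp: fun_eq_iff)
    qed
  qed (auto simp: \<phi>_def)
  have hom: "\<phi> \<in> hom G (sym_group ?n)"
    by (rule homI) (use perm comp in \<open>auto simp: sym_group_def\<close>)
  interpret \<phi>: group_hom G "sym_group ?n" \<phi>
    using hom by (simp add: group_hom_def group_hom_axioms_def sym_group_is_group)
  have "kernel G (sym_group ?n) \<phi> \<noteq> carrier G"
  proof
    assume ker: "kernel G (sym_group ?n) \<phi> = carrier G"
    have HX: "H \<in> ?X" using subgroup.subgroup_in_rcosets[OF assms(1) is_group] .
    have "g \<in> H" if g: "g \<in> carrier G" for g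
    proof -
      have "inv g \<in> kernel G (sym_group ?n) \<phi>" using ker g by simp
      then have "\<phi> (inv g) = id" by (simp add: kernel_def sym_group_one del: \<phi>.hom_inv)
      then have "\<phi> (inv g) (?b' H) = ?b' H" by simp
      then have "?b' (H #> g) = ?b' H" using b'n[OF HX] bb'[OF HX] g by (auto simp: \<phi>_def simp del: \<phi>.hom_inv)
      then have "H #> g = H" using bb' HX act[OF HX g] by metis
      then show ?thesis using coset_join1[OF _ g assms(1)] by simp
    qed
    then show False using assms(2) Hc by auto
  qed
  then have "kernel G (sym_group ?n) \<phi> = {\<one>}" using normal_trivial[OF \<phi>.normal_kernel] by blast
  then have "inj_on \<phi> (carrier G)" by (rule \<phi>.trivial_ker_imp_inj)
  then show ?thesis using that hom by blast
qed

lemma order_le_fact_index: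
  assumes "subgroup H G" "H \<noteq> carrier G"
  shows "order G \<le> fact (order G div card H)"
proof -
  obtain \<phi> where "\<phi> \<in> hom G (sym_group (order G div card H))" "inj_on \<phi> (carrier G)"
    using embeds_sym_group_index[OF assms] .
  then have "card (carrier G) \<le> card (carrier (sym_group (order G div card H)))"
    by (intro card_inj_on_le[of \<phi>]) (auto simp: hom_def sym_group_def finite_permutations)
  then show ?thesis by (simp add: order_def sym_group_card_carrier)
qed

end

section \<open>Excluded orders: primes, prime powers, a prime power times a prime\<close>

context nonabelian_simple_group
begin

lemma order_not_prime:
  assumes "prime (order G)" shows False
  using order_prime_abelian[OF assms subgroup_self] not_carrier_subset_centralizer by (simp add: order_def)

text \<open>The centre would be nontrivial with all of \<open>G\<close> as its centralizer, which
  \<open>centralizer_proper\<close> forbids.\<close>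

lemma order_not_prime_power:
  assumes "prime p" shows "order G \<noteq> p ^ n"
proof
  assume ord: "order G = p ^ n"
  then have "n > 0" using order_gt_one by (cases n) auto
  have Z: "subgroup (centralizer G (carrier G)) G" by (rule subgroup_centralizer) simp
  have "p dvd card (carrier G \<inter> centralizer G (carrier G))"
    using p_group_center_nontrivial[OF assms subgroup_self _ \<open>n > 0\<close>] ord by (simp add: order_def)
  moreover have "carrier G \<inter> centralizer G (carrier G) = centralizer G (carrier G)"
    by (auto simp: centralizer_def)
  ultimately have "centralizer G (carrier G) \<noteq> {\<one>}" using assms by auto
  moreover have "centralizer G (centralizer G (carrier G)) = carrier G"
    by (auto simp: centralizer_def)
  ultimately show False using centralizer_proper[OF Z] by blast
qed

text \<open>If distinct Sylow \<open>r\<close>-subgroups meet trivially, their elements leave room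
    for only one subgroup of
  order \<open>q\<close>. Otherwise a maximal intersection \<open>D\<close> of two of them is normalized by a subgroup
      \<open>Q\<close> of
  order \<open>q\<close>, and \<open>Q\<close> permutes all Sylow \<open>r\<close>-subgroups transitively, so
      \<open>D\<close> lies in their intersection.\<close>

lemma order_not_prime_power_times_prime:
  assumes r: "prime r" and q: "prime q" and "r \<noteq> q" and ord: "order G = r ^ a * q"
  shows False
proof -
  have cop: "coprime (r ^ a) q" using r q \<open>r \<noteq> q\<close> by (simp add: primes_coprime)
  have r1: "r > 1" and q1: "q > 1" using r q prime_gt_1_nat by auto
  have a: "a > 0"
  proof (rule ccontr)
    assume "\<not> a > 0"
    then show False using ord q order_not_prime by simp
  qed
  then have ra1: "r ^ a > 1" using one_less_power[OF r1] by blast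
  define S where "S = {R. subgroup R G \<and> card R = r ^ a}"
  have S: "subgroup R G" "card R = r ^ a" "R \<subseteq> carrier G" if "R \<in> S" for R
    using that subgroup.subset by (auto simp: S_def)
  have Sproper: "R \<noteq> {\<one>}" "R \<noteq> carrier G" if "R \<in> S" for R
    using S(2)[OF that] ra1 q1 r1 ord by (auto simp: order_def)
  \<comment> \<open>\<open>R\<close> has prime index \<open>q\<close>, so its normalizer is
    \<open>R\<close> or \<open>G\<close>, and simplicity excludes \<open>G\<close>.\<close>
  have norm: "normalizer G R = R" if R: "R \<in> S" for R
  proof -
    have N: "subgroup (normalizer G R) G" using subgroup_normalizer S(1)[OF R] by blast
    have RN: "R \<subseteq> normalizer G R" using subgroup_subset_normalizer S(1)[OF R] by blast
    obtain k where k: "card (normalizer G R) = r ^ a * k"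
      using card_subgroup_dvd[OF S(1)[OF R] N RN] S(2)[OF R] by auto
    have "card (normalizer G R) dvd order G" by (rule card_subgroup_dvd_order[OF N])
    then have "k dvd q" using k ord r1 by simp
    moreover have "k \<noteq> q"
    proof
      assume "k = q"
      then have "normalizer G R = carrier G"
        using k ord subgroup.subset[OF N] card_subset_eq[of "carrier G"] by (simp add: order_def)
      then show False using normalizer_proper S(1)[OF R] Sproper[OF R] by blast
    qed
    ultimately have "k = 1" using q by (auto simp: prime_nat_iff)
    then show ?thesis using k S(2)[OF R] RN N card_subset_eq[of "normalizer G R" R] by auto
  qed
  have into: "\<exists>R'\<in>S. T \<subseteq> R'" if T: "subgroup T G" "card T = r ^ n" and R: "R \<in> S" for T n R
  proof -
    have "\<not> r dvd order G div card R" using ord S(2)[OF R] ra1 r q \<open>r \<noteq> q\<close>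
        by (auto dest: primes_dvd_imp_eq)
    then obtain x where x: "x \<in> carrier G" "conj_set G x T \<subseteq> R"
      using p_subgroup_conj_into_sylow[OF r S(1)[OF R] _ T] by blast
    then have "T \<subseteq> conj_set G (inv x) R"
      using conj_set_subset_iff[OF subgroup.subset[OF T(1)] S(3)[OF R] x(1)] by simp
    moreover have "conj_set G (inv x) R \<in> S"
      using x S[OF R] by (auto simp: S_def subgroup_conj_set)
    ultimately show ?thesis by blast
  qed
  obtain R0 where R0: "R0 \<in> S"
    using exists_prime_power_subgroup[OF r subgroup_self, of a] ord by (auto simp: S_def order_def)
  have conj: "\<exists>x\<in>carrier G. R' = conj_set G x R" if R: "R \<in> S" and R': "R' \<in> S" for R R'
  proof -
    have "\<not> r dvd order G div card R'" using ord S(2) that ra1 r q \<open>r \<noteq> q\<close>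
        by (auto dest: primes_dvd_imp_eq)
    then obtain x where x: "x \<in> carrier G" "conj_set G x R \<subseteq> R'"
      using p_subgroup_conj_into_sylow[OF r S(1)[OF R'] _ S(1,2)[OF R]] by blast
    moreover have "card (conj_set G x R) = card R'" using x S that by auto
    ultimately show ?thesis using card_subset_eq[of R'] S that by (metis finite_subgroup)
  qed
  have Sconj: "S = (\<lambda>x. conj_set G x R) ` carrier G" if R: "R \<in> S" for R
    using conj[OF R] S[OF R] by (auto simp: S_def subgroup_conj_set)
  have finS: "finite S" using Sconj[OF R0] by simp
  have cardS: "card S = q"
    using card_conjugates[OF S(3)[OF R0]] Sconj[OF R0] norm[OF R0] S(2)[OF R0] ord r1 by simp
  have Qint: "Q \<inter> R = {\<one>}" if "subgroup Q G" "card Q = q" "R \<in> S" for Q R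
  proof -
    have I: "subgroup (Q \<inter> R) G" using subgroups_Inter_pair that S by blast
    have "card (Q \<inter> R) dvd q" "card (Q \<inter> R) dvd r ^ a"
      using card_subgroup_dvd[OF I that(1)] card_subgroup_dvd[OF I S(1)[OF that(3)]] that S by auto
    then have "card (Q \<inter> R) = 1" using cop by (metis coprime_common_divisor_nat coprime_commute)
    then show ?thesis using card_one_subgroup_iff[OF I] by blast
  qed
  have "q ^ 1 dvd card (carrier G)" using ord by (simp add: order_def)
  then obtain Q0 where Q0: "subgroup Q0 G" "card Q0 = q"
    using exists_prime_power_subgroup[OF q subgroup_self, of 1] by auto
  show False
  proof (cases "\<forall>R1\<in>S. \<forall>R2\<in>S. R1 \<noteq> R2 \<longrightarrow> R1 \<inter> R2 = {\<one>}")
    case True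
    define U where "U = (\<Union>R\<in>S. R - {\<one>})"
    have "card U = (\<Sum>R\<in>S. card (R - {\<one>}))"
      unfolding U_def using True S finS by (intro card_UN_disjoint) auto
    also have "\<dots> = (\<Sum>R\<in>S. r ^ a - 1)"
      using S(2) subgroup.one_closed[OF S(1)] by (intro sum.cong) (auto simp: card_Diff_singleton)
    finally have cU: "card U = q * (r ^ a - 1)" using cardS by simp
    have UG: "U \<subseteq> carrier G" using S(3) by (auto simp: U_def)
    \<comment> \<open>Each of the \<open>q\<close> Sylow subgroups contributes
      \<open>r^a - 1\<close> elements to \<open>U\<close>, so exactly \<open>q\<close> elements
      remain, \<open>\<one>\<close> among them.\<close>
    have cW: "card (carrier G - U) = q"
    proof -
      have "card (carrier G - U) = r ^ a * q - q * (r ^ a - 1)"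
        using UG cU ord by (simp add: card_Diff_subset order_def)
      also have "\<dots> = q" using ra1 by (simp add: right_diff_distrib' mult.commute)
      finally show ?thesis .
    qed
    have uniq: "Q = carrier G - U" if Q: "subgroup Q G" "card Q = q" for Q
    proof -
      have "Q \<subseteq> carrier G - U"
        using Qint[OF Q] subgroup.subset[OF Q(1)] by (auto simp: U_def)
      then show ?thesis using cW Q(2) card_subset_eq[of "carrier G - U" Q] by simp
    qed
    have Qc: "Q0 \<subseteq> carrier G" using Q0 subgroup.subset by auto
    have "conj_set G x Q0 = Q0" if "x \<in> carrier G" for x
      using uniq[of "conj_set G x Q0"] uniq[of Q0] that Q0 Qc by (simp add: subgroup_conj_set)
    then have "normalizer G Q0 = carrier G" using Qc by (auto simp: mem_normalizer)
    moreover have "Q0 \<noteq> {\<one>}" "Q0 \<noteq> carrier G" using Q0 q1 ord ra1 by (auto simp: order_def)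
    ultimately show False using normalizer_proper[OF Q0(1)] by blast
  next
    case False
    \<comment> \<open>The maximum is taken over pairs of distinct Sylow subgroups, so that it can be
      compared with the new pairs \<open>(R3, R)\<close> below.\<close>
    define Pr where "Pr = (\<lambda>(A, B). A \<in> S \<and> B \<in> S \<and> A \<noteq> B \<and> A \<inter> B \<noteq> {\<one>})"
    obtain A B where "Pr (A, B)" using False by (auto simp: Pr_def)
    moreover have "\<forall>y. Pr y \<longrightarrow> (\<lambda>(A, B). card (A \<inter> B)) y < Suc (order G)"
      using S by (auto simp: Pr_def order_def less_Suc_eq_le intro!: card_mono)
    ultimately obtain z where z: "Pr z" "\<forall>y. Pr y \<longrightarrow> (\<lambda>(A, B). card (A \<inter> B)) y \<le> (\<lambda>(A, B). card (A \<inter> B)) z"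
      using ex_has_greatest_nat[of Pr "(A, B)" "\<lambda>(A, B). card (A \<inter> B)" "Suc (order G)"] by blast
    obtain R1 R2 where zz: "z = (R1, R2)" by (cases z)
    have R12: "R1 \<in> S" "R2 \<in> S" "R1 \<noteq> R2" "R1 \<inter> R2 \<noteq> {\<one>}"
      using z(1) by (simp_all add: Pr_def zz)
    have max: "card (A \<inter> B) \<le> card (R1 \<inter> R2)"
      if "A \<in> S" "B \<in> S" "A \<noteq> B" "A \<inter> B \<noteq> {\<one>}" for A B
      using z(2)[rule_format, of "(A, B)"] that by (simp add: Pr_def zz)
    define D where "D = R1 \<inter> R2"
    have D: "subgroup D G" using subgroups_Inter_pair R12 S unfolding D_def by blast
    have Dc: "D \<subseteq> carrier G" using D subgroup.subset by auto
    have D1: "card D > 1"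
      using R12(4) card_one_subgroup_iff[OF D] card_subgroup_pos[OF D] unfolding D_def
      by (metis One_nat_def Suc_lessI)
    define M where "M = normalizer G D"
    have M: "subgroup M G" unfolding M_def using subgroup_normalizer[OF D] .
    \<comment> \<open>Normalizers grow in the \<open>r\<close>-group \<open>R\<close>, so
      \<open>M\<close> meets each Sylow subgroup properly above \<open>D\<close> in more than
      \<open>D\<close>.\<close>
    have grow: "card D < card (R \<inter> M)" if R: "R \<in> S" "D \<subseteq> R" "D \<noteq> R" for R
    proof -
      obtain d where d: "d \<le> a" "card D = r ^ d"
        using prime_power_subgroup_card[OF r S(1)[OF R(1)] D R(2) S(2)[OF R(1)]] .
      have "d \<noteq> a" using R S[OF R(1)] d card_subset_eq[of R D] by auto
      then have "r * card D dvd card R" using d S(2)[OF R(1)]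
        by (metis Suc_leI le_imp_power_dvd le_neq_implies_less power_Suc)
      then have "r * card D dvd card (R \<inter> M)"
        unfolding M_def using p_subgroup_normalizer_grows_in[OF r S(1)[OF R(1)] D R(2) d(2)] by blast
      moreover have "subgroup (R \<inter> M) G" using subgroups_Inter_pair S(1)[OF R(1)] M by blast
      ultimately have "r * card D \<le> card (R \<inter> M)" by (intro dvd_imp_le) auto
      moreover have "card D < r * card D" using r1 D1 by simp
      ultimately show ?thesis by linarith
    qed
    have neq: "D \<noteq> R1" "D \<noteq> R2"
      using R12 S card_subset_eq[of R1 R2] card_subset_eq[of R2 R1] unfolding D_def
      by (metis Int_lower2 finite_subgroup, metis Int_lower1 finite_subgroup)
    \<comment> \<open>Otherwise \<open>M\<close> is an \<open>r\<close>-group inside some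
      \<open>R3 \<in> S\<close>, which then shares more than \<open>D\<close> with \<open>R1\<close>
      and with \<open>R2\<close>; maximality forces \<open>R3 = R1\<close> and
      \<open>R3 = R2\<close>.\<close>
    have "q dvd card M"
    proof (rule ccontr)
      assume nq: "\<not> q dvd card M"
      then have "coprime (card M) q" using prime_imp_coprime[OF q] coprime_commute by blast
      then have "card M dvd r ^ a"
        using card_subgroup_dvd_order[OF M] ord by (simp add: coprime_dvd_mult_left_iff)
      then obtain n where "card M = r ^ n" using r by (auto simp: divides_primepow_nat)
      then obtain R3 where R3: "R3 \<in> S" "M \<subseteq> R3" using into[OF M _ R0] by blast
      have "R3 = R" if R: "R \<in> S" "D \<subseteq> R" "D \<noteq> R" for R
      proof (rule ccontr)
        assume ne: "R3 \<noteq> R"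
        have "card (R \<inter> M) \<le> card (R3 \<inter> R)" using R3 S R by (intro card_mono) auto
        then have gt: "card D < card (R3 \<inter> R)" using grow[OF R] by simp
        then have "R3 \<inter> R \<noteq> {\<one>}" using D1 by auto
        then show False using max[OF R3(1) R(1) ne] gt by (simp add: D_def)
      qed
      then show False using R12 neq by (metis D_def Int_lower1 Int_lower2)
    qed
    then obtain Q where Q: "subgroup Q G" "Q \<subseteq> M" "card Q = q"
      using exists_prime_power_subgroup[OF q M, of 1] by auto
    have Qc: "Q \<subseteq> carrier G" using Q subgroup.subset by auto
    \<comment> \<open>\<open>R1\<close> is its own normalizer and meets \<open>Q\<close> trivially,
      so the \<open>q\<close> conjugates of \<open>R1\<close> under \<open>Q\<close> are distinct
      and exhaust \<open>S\<close>.\<close>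
    have inj: "inj_on (\<lambda>x. conj_set G x R1) Q"
    proof (rule inj_onI)
      fix x y assume xy: "x \<in> Q" "y \<in> Q" and eq: "conj_set G x R1 = conj_set G y R1"
      have c: "x \<in> carrier G" "y \<in> carrier G" using xy Qc by auto
      have "conj_set G (inv y \<otimes> x) R1 = R1"
        using conj_set_mult[of R1 "inv y" x] eq c S(3)[OF R12(1)] by simp
      then have "inv y \<otimes> x \<in> normalizer G R1" using c S(3)[OF R12(1)] by (simp add: mem_normalizer)
      then have "inv y \<otimes> x \<in> Q \<inter> R1"
        using norm[OF R12(1)] xy Q(1) by (simp add: subgroup.m_closed subgroup.m_inv_closed)
      then have "inv y \<otimes> x = \<one>" using Qint[OF Q(1,3) R12(1)] by simp
      then show "x = y" using c by (metis inv_closed inv_equality inv_inv)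
    qed
    have "(\<lambda>x. conj_set G x R1) ` Q = S"
    proof (rule card_subset_eq[OF finS])
      show "(\<lambda>x. conj_set G x R1) ` Q \<subseteq> S" using Qc Sconj[OF R12(1)] by auto
      show "card ((\<lambda>x. conj_set G x R1) ` Q) = card S" using card_image[OF inj] Q(3) cardS by simp
    qed
    moreover have "D \<subseteq> conj_set G x R1" if "x \<in> Q" for x
    proof -
      have "conj_set G x D = D" using that Q(2) mem_normalizer[OF Dc] by (auto simp: M_def)
      then show ?thesis using conj_set_mono[of D R1 x] by (auto simp: D_def)
    qed
    ultimately have DS: "D \<subseteq> \<Inter>S" by blast
    have K: "subgroup (\<Inter>S) G" by (rule subgroups_Inter) (use S(1) R0 in auto)
    have Kc: "\<Inter>S \<subseteq> carrier G" using K subgroup.subset by auto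
    have "normalizer G (\<Inter>S) = carrier G"
    proof -
      have "x \<in> normalizer G (\<Inter>S)" if x: "x \<in> carrier G" for x
      proof (rule normalizer_eqI[OF Kc x])
        show "conj_set G x (\<Inter>S) \<subseteq> \<Inter>S"
        proof (rule Inter_greatest)
          fix R assume R: "R \<in> S"
          have "conj_set G (inv x) R \<in> S" using Sconj[OF R] x by auto
          then have "\<Inter>S \<subseteq> conj_set G (inv x) R" by auto
          then show "conj_set G x (\<Inter>S) \<subseteq> R" using conj_set_subset_iff[OF Kc S(3)[OF R] x] by simp
        qed
      qed
      then show ?thesis using subgroup.subset[OF subgroup_normalizer[OF K]] by auto
    qed
    moreover have "\<Inter>S \<noteq> {\<one>}" using DS D1 card_mono[of "{\<one>}" D] by auto
    moreover have "\<Inter>S \<noteq> carrier G" using R0 Sproper(2)[OF R0] S(3)[OF R0] by blast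
    ultimately show False using normalizer_proper[OF K] by blast
  qed
qed

end

section \<open>Subgroups that are not self-normalizing\<close>

definition bad_subgroup :: "('a, 'b) monoid_scheme \<Rightarrow> 'a set \<Rightarrow> bool" where
  "bad_subgroup G H \<longleftrightarrow> subgroup H G \<and> H \<noteq> {\<one>\<^bsub>G\<^esub>} \<and> normalizer G H \<noteq> H"

definition bad_orders :: "('a, 'b) monoid_scheme \<Rightarrow> nat set" where
  "bad_orders G = card ` {H. bad_subgroup G H}"

context finite_group
begin

lemma finite_bad_subgroups: "finite {H. bad_subgroup G H}"
  by (rule finite_subset[of _ "Pow (carrier G)"]) (auto simp: bad_subgroup_def dest: subgroup.subset)

lemma finite_bad_orders: "finite (bad_orders G)"
  by (simp add: bad_orders_def finite_bad_subgroups)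

lemma bad_orderI: "bad_subgroup G H \<Longrightarrow> card H \<in> bad_orders G"
  by (auto simp: bad_orders_def)

lemma bad_subgroupI:
  assumes "subgroup H G" "H \<noteq> {\<one>}" "\<not> normalizer G H \<subseteq> H"
  shows "bad_subgroup G H"
  using assms by (auto simp: bad_subgroup_def)

text \<open>The exponent \<open>Suc n\<close> leaves room for the normalizer to be larger by a
  factor \<open>p\<close>; \<open>n > 0\<close> keeps \<open>K\<close> nontrivial.\<close>

lemma p_subgroup_bad:
  assumes "prime p" "subgroup K G" "card K = p ^ n" "n > 0" "p ^ Suc n dvd order G"
  shows "bad_subgroup G K"
proof (rule bad_subgroupI[OF assms(2)])
  have p1: "p > 1" using assms(1) prime_gt_1_nat by blast
  show "K \<noteq> {\<one>}" using assms(3,4) p1 one_less_power[of p n] by auto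
  have N: "subgroup (normalizer G K) G" by (rule subgroup_normalizer[OF assms(2)])
  show "\<not> normalizer G K \<subseteq> K"
  proof
    assume "normalizer G K \<subseteq> K"
    then have "card (normalizer G K) \<le> card K" using assms(2) by (intro card_mono) auto
    moreover have "p * card K dvd card (normalizer G K)"
      using p_subgroup_normalizer_grows[OF assms(1-3)] assms(3,5) by simp
    then have "p * card K \<le> card (normalizer G K)" using N by (intro dvd_imp_le) auto
    moreover have "card K < p * card K" using p1 card_subgroup_pos[OF assms(2)] by simp
    ultimately show False by linarith
  qed
qed

lemma subgroup_commuting_product:
  assumes A: "subgroup A G" and B: "subgroup B G" and comm: "A \<subseteq> centralizer G B"
    and int: "A \<inter> B = {\<one>}"
  shows "subgroup (A <#> B) G" "card (A <#> B) = card A * card B"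
proof -
  have Ac: "A \<subseteq> carrier G" and Bc: "B \<subseteq> carrier G" using A B subgroup.subset by auto
  have cm: "a \<otimes> b = b \<otimes> a" if "a \<in> A" "b \<in> B" for a b using comm that
      by (auto simp: centralizer_def)
  have prodI: "u \<otimes> v \<in> A <#> B" if "u \<in> A" "v \<in> B" for u v
    using that by (auto simp: set_mult_def)
  have eq: "A <#> B = (\<lambda>(a, b). a \<otimes> b) ` (A \<times> B)" by (force simp: set_mult_def)
  show "subgroup (A <#> B) G"
  proof (rule subgroupI)
    show "A <#> B \<subseteq> carrier G" using Ac Bc by (auto simp: set_mult_def)
    show "A <#> B \<noteq> {}" using A B by (auto simp: set_mult_def)
    fix x assume "x \<in> A <#> B"
    then obtain a b where ab: "a \<in> A" "b \<in> B" "x = a \<otimes> b" by (auto simp: set_mult_def)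
    then have "inv x = inv a \<otimes> inv b"
      using Ac Bc cm[OF ab(1,2)] by (auto simp: subset_iff inv_mult_group)
    then show "inv x \<in> A <#> B" using ab A B by (simp add: prodI subgroup.m_inv_closed)
    fix y assume "y \<in> A <#> B"
    then obtain a' b' where ab': "a' \<in> A" "b' \<in> B" "y = a' \<otimes> b'" by (auto simp: set_mult_def)
    have c: "a \<in> carrier G" "b \<in> carrier G" "a' \<in> carrier G" "b' \<in> carrier G" using ab ab' Ac Bc by auto
    have "a \<otimes> b \<otimes> (a' \<otimes> b') = a \<otimes> (b \<otimes> a') \<otimes> b'" using c
        by (simp add: m_assoc)
    also have "\<dots> = a \<otimes> (a' \<otimes> b) \<otimes> b'" using cm[OF ab'(1) ab(2)] by simp
    also have "\<dots> = (a \<otimes> a') \<otimes> (b \<otimes> b')" using c by (simp add: m_assoc)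
    finally have "x \<otimes> y = (a \<otimes> a') \<otimes> (b \<otimes> b')" using ab ab' by simp
    then show "x \<otimes> y \<in> A <#> B"
      using ab ab' A B by (simp add: prodI subgroup.m_closed)
  qed
  have "inj_on (\<lambda>(a, b). a \<otimes> b) (A \<times> B)"
  proof (rule inj_onI, clarify)
    fix a b a' b' assume h: "a \<in> A" "b \<in> B" "a' \<in> A" "b' \<in> B" "a \<otimes> b = a' \<otimes> b'"
    have c: "a \<in> carrier G" "b \<in> carrier G" "a' \<in> carrier G" "b' \<in> carrier G" using h Ac Bc by auto
    have "inv a' \<otimes> (a \<otimes> b) \<otimes> inv b = inv a' \<otimes> (a' \<otimes> b') \<otimes> inv b"
        using h by simp
    then have e: "inv a' \<otimes> a = b' \<otimes> inv b" using c by (simp add: m_assoc)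
    moreover have "inv a' \<otimes> a \<in> A" using h A by (simp add: subgroup.m_closed subgroup.m_inv_closed)
    moreover have "b' \<otimes> inv b \<in> B" using h B by (simp add: subgroup.m_closed subgroup.m_inv_closed)
    ultimately have "inv a' \<otimes> a \<in> A \<inter> B" by auto
    then have o: "inv a' \<otimes> a = \<one>" using int by auto
    then have "a = a'" using c by (metis inv_closed inv_equality inv_inv)
    moreover have "b' = b" using e o c by (metis inv_closed inv_equality inv_inv)
    ultimately show "a = a' \<and> b = b'" by simp
  qed
  then show "card (A <#> B) = card A * card B" unfolding eq by (simp add: card_image card_cartesian_product)
qed

lemma coprime_subgroups_inter:
  assumes "subgroup A G" "subgroup B G" "coprime (card A) (card B)"
  shows "A \<inter> B = {\<one>}"
proof -
  have I: "subgroup (A \<inter> B) G" using subgroups_Inter_pair assms by blast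
  have "card (A \<inter> B) dvd card A" "card (A \<inter> B) dvd card B"
    using card_subgroup_dvd[OF I] assms by auto
  then have "card (A \<inter> B) = 1" using assms(3) coprime_common_divisor_nat by blast
  then show ?thesis using card_one_subgroup_iff[OF I] by blast
qed

end

section \<open>Bad orders forced by simplicity\<close>

context nonabelian_simple_group
begin

lemma abelian_sylow_bad:
  assumes "prime p" "p dvd order G" "subgroup P G" "card P = p ^ multiplicity p (order G)"
    and "P \<subseteq> centralizer G P"
  shows "bad_subgroup G P"
proof (rule bad_subgroupI[OF assms(3)])
  have "p dvd card P" using assms(1,2,4) by (simp add: prime_multiplicity_gt_zero_iff)
  then show "P \<noteq> {\<one>}" using assms(1) by auto
  show "\<not> normalizer G P \<subseteq> P" using abelian_sylow_normalizer[OF assms] assms(5) by blast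
qed

text \<open>Either \<open>p^2\<close> divides the order and the normalizer grows, or
  \<open>K\<close> is an abelian Sylow subgroup and transfer applies. The next lemma repeats this
  for \<open>p^2\<close>.\<close>

lemma order_prime_bad:
  assumes "prime p" "subgroup K G" "card K = p"
  shows "bad_subgroup G K"
proof -
  have pd: "p dvd order G" using card_subgroup_dvd_order[OF assms(2)] assms(3) by simp
  show ?thesis
  proof (cases "p ^ 2 dvd order G")
    case True
    then show ?thesis using p_subgroup_bad[OF assms(1,2), of 1] assms(3) by (simp add: power2_eq_square)
  next
    case False
    then have "multiplicity p (order G) = 1"
      using pd assms(1) by (intro multiplicity_eqI) (auto simp: numeral_2_eq_2)
    then show ?thesis using abelian_sylow_bad[OF assms(1) pd assms(2)] order_prime_abelian[OF assms] assms(3)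
      by simp
  qed
qed

lemma order_prime_square_bad:
  assumes "prime p" "subgroup K G" "card K = p ^ 2"
  shows "bad_subgroup G K"
proof -
  have pd: "p ^ 2 dvd order G" using card_subgroup_dvd_order[OF assms(2)] assms(3) by simp
  then have pd1: "p dvd order G" by (metis dvd_trans dvd_triv_left power2_eq_square)
  show ?thesis
  proof (cases "p ^ 3 dvd order G")
    case True
    then show ?thesis using p_subgroup_bad[OF assms(1,2), of 2] assms(3) by (simp add: numeral_3_eq_3)
  next
    case False
    then have "multiplicity p (order G) = 2"
      using pd assms(1) by (intro multiplicity_eqI) (auto simp: numeral_3_eq_3)
    then show ?thesis using abelian_sylow_bad[OF assms(1) pd1 assms(2)] order_prime_square_abelian[OF assms] assms(3)
      by simp
  qed
qed

lemma prime_in_bad_orders: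
  assumes "prime p" "p dvd order G" shows "p \<in> bad_orders G"
proof -
  obtain K where "subgroup K G" "card K = p"
    using exists_prime_power_subgroup[OF assms(1) subgroup_self, of 1] assms(2) by (auto simp: order_def)
  then show ?thesis using order_prime_bad[OF assms(1)] bad_orderI by metis
qed

lemma prime_square_in_bad_orders:
  assumes "prime p" "p ^ 2 dvd order G" shows "p ^ 2 \<in> bad_orders G"
proof -
  obtain K where "subgroup K G" "card K = p ^ 2"
    using exists_prime_power_subgroup[OF assms(1) subgroup_self, of 2] assms(2) by (auto simp: order_def)
  then show ?thesis using order_prime_square_bad[OF assms(1)] bad_orderI by metis
qed

text \<open>The fourth power matters: a Sylow subgroup of order \<open>p^3\<close> may be
  nonabelian, and then neither growth nor transfer shows that it is bad.\<close>

lemma prime_cube_in_bad_orders: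
  assumes "prime p" "p ^ 4 dvd order G" shows "p ^ 3 \<in> bad_orders G"
proof -
  have "p ^ 3 dvd p ^ 4" by (intro le_imp_power_dvd) simp
  then have "p ^ 3 dvd card (carrier G)" using assms(2) dvd_trans unfolding order_def by blast
  then obtain K where K: "subgroup K G" "card K = p ^ 3"
    using exists_prime_power_subgroup[OF assms(1) subgroup_self, of 3] by blast
  then have "bad_subgroup G K" using p_subgroup_bad[OF assms(1) K] assms(2) by (simp add: eval_nat_numeral)
  then show ?thesis using K bad_orderI by metis
qed

text \<open>Otherwise a Sylow subgroup of order \<open>r\<close> is acted on nontrivially by a group
  of order \<open>q^n\<close> with \<open>q > r\<close>, against
  \<open>p_subgroup_centralizes_order_prime\<close>.\<close>

lemma smallest_prime_square_dvd:
  assumes r: "prime r" "r dvd order G" and min: "\<And>q. prime q \<Longrightarrow> q dvd order G \<Longrightarrow> r \<le> q"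
  shows "r ^ 2 dvd order G"
proof (rule ccontr)
  assume "\<not> r ^ 2 dvd order G"
  then have mult: "multiplicity r (order G) = 1"
    using r by (intro multiplicity_eqI) (auto simp: numeral_2_eq_2)
  obtain R where R: "subgroup R G" "card R = r"
    using exists_prime_power_subgroup[OF r(1) subgroup_self, of 1] r(2) by (auto simp: order_def)
  have "card R = r ^ multiplicity r (order G)" using R(2) mult by simp
  then obtain q T n where T: "prime q" "q \<noteq> r" "subgroup T G" "card T = q ^ n" "T \<subseteq> normalizer G R"
    "\<not> T \<subseteq> centralizer G R"
    using abelian_sylow_noncentral_action[OF r R(1) _ order_prime_abelian[OF r(1) R]] by blast
  have "n \<noteq> 0"
  proof
    assume "n = 0"
    then have "T = {\<one>}" using T(3,4) card_one_subgroup_iff by simp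
    then show False using T(6) subgroup.one_closed[OF subgroup_centralizer[OF subgroup.subset[OF R(1)]]] by simp
  qed
  then have "q dvd order G" using card_subgroup_dvd_order[OF T(3)] T(4) dvd_power[of n q] dvd_trans by auto
  then have "r < q" using min T(1,2) by (metis le_neq_implies_less)
  then show False using p_subgroup_centralizes_order_prime[OF T(1,3,4) r(1) _ R T(5)] T(6) by blast
qed

end

section \<open>Sylow subgroups of order \<open>r\<^sup>3\<close>\<close>

context nonabelian_simple_group
begin

text \<open>A subgroup of order \<open>s \<noteq> r\<close> centralizing \<open>Z\<close> would generate with
    \<open>Z\<close> a self-normalizing subgroup \<open>W\<close>;
  the conjugates of \<open>W - Z\<close> in \<open>C(Z)\<close> then leave room for only one subgroup of order
      \<open>r\<^sup>3\<close>.\<close>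

lemma centralizer_eq_sylow:
  assumes r: "prime r" and R: "subgroup R G" "card R = r ^ 3" "multiplicity r (order G) = 3"
    and NR: "normalizer G R = R"
    and Z: "subgroup Z G" "Z \<subseteq> R" "R \<subseteq> centralizer G Z" "card Z = r"
    and bad: "\<And>H. bad_subgroup G H \<Longrightarrow> \<exists>p k. prime p \<and> card H = p ^ k"
    and ordC: "\<And>C s. subgroup C G \<Longrightarrow> C \<noteq> carrier G \<Longrightarrow> r ^ 3 dvd card C \<Longrightarrow> prime s \<Longrightarrow> s \<noteq> r \<Longrightarrow>
      multiplicity s (card C) = 1 \<Longrightarrow> card C = r ^ 3 * s"
  shows "centralizer G Z = R"
proof (rule ccontr)
  assume ne: "centralizer G Z \<noteq> R"
  define C where "C = centralizer G Z"
  have Zc: "Z \<subseteq> carrier G" by (rule subgroup.subset[OF Z(1)])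
  have r1: "r > 1" using r prime_gt_1_nat by blast
  have C: "subgroup C G" unfolding C_def by (rule subgroup_centralizer[OF Zc])
  have Cc: "C \<subseteq> carrier G" using C subgroup.subset by auto
  have RC: "R \<subseteq> C" using Z by (simp add: C_def)
  have ZC: "Z \<subseteq> C" using Z RC by auto
  have Z1: "Z \<noteq> {\<one>}" using Z(4) r1 by auto
  have CG: "C \<noteq> carrier G" unfolding C_def by (rule centralizer_proper[OF Z(1) Z1])
  have mC: "multiplicity r (card C) = 3"
    using sylow_multiplicity_between[OF r R(1) C RC] R by simp
  obtain k where k: "card C = r ^ 3 * k" using card_subgroup_dvd[OF R(1) C RC] R(2) by auto
  have "k \<noteq> 1" using ne R(1,2) k RC C card_subset_eq[of C R] by (auto simp: C_def)
  then obtain s where s: "prime s" "s dvd k" using prime_factor_nat by blast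
  have sr: "s \<noteq> r"
  proof
    assume "s = r"
    then have "r ^ 4 dvd card C" using s(2) k by (auto simp: eval_nat_numeral dvd_def)
    moreover have "\<not> is_unit r" using r not_prime_unit by blast
    ultimately have "4 \<le> multiplicity r (card C)" using C by (intro multiplicity_geI) auto
    then show False using mC by simp
  qed
  have s1: "s > 1" using s prime_gt_1_nat by blast
  have "s ^ 1 dvd card C" using s k by auto
  then obtain B where B: "subgroup B G" "B \<subseteq> C" "card B = s"
    using exists_prime_power_subgroup[OF s(1) C, of 1] by auto
  have Bc: "B \<subseteq> carrier G" using B subgroup.subset by auto
  have cop: "coprime r s" using primes_coprime[OF r s(1)] sr by simp
  have int: "Z \<inter> B = {\<one>}" using coprime_subgroups_inter[OF Z(1) B(1)] Z(4) B(3) cop by simp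
  have comm: "Z \<subseteq> centralizer G B" using subset_centralizer_commute[OF Zc Bc] B(2) by (simp add: C_def)
  define W where "W = Z <#> B"
  have W: "subgroup W G" "card W = r * s"
    using subgroup_commuting_product[OF Z(1) B(1) comm int] Z(4) B(3) by (auto simp: W_def)
  have Wc: "W \<subseteq> carrier G" using W subgroup.subset by auto
  have ZW: "Z \<subseteq> W"
  proof
    fix z assume z: "z \<in> Z"
    then have "z \<otimes> \<one> \<in> W" using subgroup.one_closed[OF B(1)] unfolding W_def set_mult_def by blast
    then show "z \<in> W" using z Zc by auto
  qed
  have BW: "B \<subseteq> W"
  proof
    fix b assume b: "b \<in> B"
    then have "\<one> \<otimes> b \<in> W" using subgroup.one_closed[OF Z(1)] unfolding W_def set_mult_def by blast
    then show "b \<in> W" using b Bc by auto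
  qed
  have WC: "W \<subseteq> C"
    unfolding W_def set_mult_def using ZC B(2) subgroup.m_closed[OF C] by auto
  \<comment> \<open>\<open>W\<close> has order \<open>r * s\<close>, not a prime power, whereas
    \<open>bad\<close> gives every bad subgroup prime power order.\<close>
  have NW: "normalizer G W = W"
  proof (rule ccontr)
    assume "normalizer G W \<noteq> W"
    moreover have "W \<noteq> {\<one>}" using ZW Z1 subgroup.one_closed[OF Z(1)] by auto
    ultimately have "bad_subgroup G W" using W by (simp add: bad_subgroup_def)
    then obtain p n where p: "prime p" "card W = p ^ n" using bad by blast
    then have "r dvd p ^ n" "s dvd p ^ n" using W(2) by (metis dvd_triv_left, metis dvd_triv_right)
    then have "r = p" "s = p" using r s(1) p(1) by (meson prime_dvd_power primes_dvd_imp_eq)+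
    then show False using sr by simp
  qed
  \<comment> \<open>If \<open>s^2\<close> divided \<open>card C\<close>, it would divide the order
    of the normalizer of \<open>B\<close> in \<open>C\<close>. That group centralizes
    \<open>Z\<close>, so it normalizes \<open>W = Z B\<close> and lies in \<open>W\<close>, of order
    \<open>r * s\<close>.\<close>
  have ms: "multiplicity s (card C) = 1"
  proof (rule ccontr)
    assume ne1: "multiplicity s (card C) \<noteq> 1"
    have "s * s dvd card C"
    proof (rule ccontr)
      assume "\<not> s * s dvd card C"
      then have "multiplicity s (card C) = 1"
        using \<open>s ^ 1 dvd card C\<close> by (intro multiplicity_eqI) auto
      then show False using ne1 by simp
    qed
    then have d: "s * card B dvd card (C \<inter> normalizer G B)"
      using p_subgroup_normalizer_grows_in[OF s(1) C B(1,2), of 1] B(3) by simp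
    have sub: "C \<inter> normalizer G B \<subseteq> normalizer G W"
    proof
      fix g assume g: "g \<in> C \<inter> normalizer G B"
      then have gc: "g \<in> carrier G" using Cc by auto
      have gB: "conj_set G g B = B" using g mem_normalizer[OF Bc] by auto
      show "g \<in> normalizer G W"
      proof (rule normalizer_eqI[OF Wc gc])
        show "conj_set G g W \<subseteq> W"
        proof
          fix x assume "x \<in> conj_set G g W"
          then obtain z b where zb: "z \<in> Z" "b \<in> B" "x = g \<otimes> (z \<otimes> b) \<otimes> inv g"
            by (auto simp: conj_set_def W_def set_mult_def)
          have c: "z \<in> carrier G" "b \<in> carrier G" using zb Zc Bc by auto
          have gz: "g \<otimes> z = z \<otimes> g" using g zb by (auto simp: C_def centralizer_def)
          have "x = (g \<otimes> z) \<otimes> (b \<otimes> inv g)" using zb c gc by (simp add: m_assoc)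
          also have "\<dots> = z \<otimes> (g \<otimes> b \<otimes> inv g)" unfolding gz using c gc
              by (simp add: m_assoc)
          finally have "x = z \<otimes> (g \<otimes> b \<otimes> inv g)" .
          moreover have "g \<otimes> b \<otimes> inv g \<in> B" using zb gB by (auto simp: conj_set_def)
          ultimately show "x \<in> W" using zb by (auto simp: W_def set_mult_def)
        qed
      qed
    qed
    have I: "subgroup (C \<inter> normalizer G B) G"
      using subgroups_Inter_pair[OF C subgroup_normalizer[OF B(1)]] .
    have "card (C \<inter> normalizer G B) dvd card W"
      using card_subgroup_dvd[OF I W(1)] sub NW by simp
    then have "s * s dvd r * s" using d B(3) W(2) dvd_trans by metis
    then have "s dvd r" using s1 by simp
    then show False using s(1) r sr primes_dvd_imp_eq by blast
  qed
  have cC: "card C = r ^ 3 * s" using ordC[OF C CG _ s(1) sr ms] k by simp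
  interpret C: finite_group "G\<lparr>carrier := C\<rparr>" by (rule finite_group_restrict[OF C])
  define \<W> where "\<W> = (\<lambda>g. conj_set G g W) ` C"
  have "card \<W> * card W = card C"
  proof -
    have "(\<lambda>g. conj_set (G\<lparr>carrier := C\<rparr>) g W) ` C = \<W>"
      unfolding \<W>_def using C by (auto simp: conj_set_restrict)
    moreover have "normalizer (G\<lparr>carrier := C\<rparr>) W = W"
      using normalizer_restrict[OF C WC] NW WC by auto
    ultimately show ?thesis using C.card_conjugates[of W] WC by (simp add: order_def)
  qed
  then have c\<W>: "card \<W> = r ^ 2" using cC W(2) r1 s1 by (simp add: eval_nat_numeral)
  have fin\<W>: "finite \<W>" using C by (simp add: \<W>_def)
  have conjZ: "conj_set G g Z = Z" if "g \<in> C" for g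
    using that centralizer_subset_normalizer[OF Zc] mem_normalizer[OF Zc] by (auto simp: C_def)
  have \<W>: "subgroup V G" "card V = r * s" "Z \<subseteq> V" "V \<subseteq> C" if V: "V \<in> \<W>" for V
  proof -
    obtain g where g: "g \<in> C" "V = conj_set G g W" using V by (auto simp: \<W>_def)
    then have gc: "g \<in> carrier G" using Cc by auto
    show "subgroup V G" "card V = r * s" using g gc W Wc by (auto simp: subgroup_conj_set)
    show "Z \<subseteq> V" using conj_set_mono[OF ZW, of g] conjZ[OF g(1)] g by simp
    show "V \<subseteq> C" using conj_set_mono[OF WC, of g] conj_set_self[OF C g(1)] g by simp
  qed
  define U where "U = (\<Union>V\<in>\<W>. V - Z)"
  have "card U = (\<Sum>V\<in>\<W>. card (V - Z))"
    unfolding U_def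
  proof (rule card_UN_disjoint[OF fin\<W>])
    show "\<forall>V\<in>\<W>. finite (V - Z)" using \<W> by auto
    \<comment> \<open>\<open>Z\<close> has prime index \<open>s\<close> in each conjugate of
      \<open>W\<close>, so two different ones meet exactly in \<open>Z\<close>.\<close>
    show "\<forall>V\<in>\<W>. \<forall>V'\<in>\<W>. V \<noteq> V' \<longrightarrow> (V - Z) \<inter> (V' - Z) = {}"
    proof (intro ballI impI)
      fix V V' assume VV': "V \<in> \<W>" "V' \<in> \<W>" "V \<noteq> V'"
      have I: "subgroup (V \<inter> V') G" using subgroups_Inter_pair \<W> VV' by blast
      have ZI: "Z \<subseteq> V \<inter> V'" using \<W> VV' by auto
      obtain l where l: "card (V \<inter> V') = r * l" using card_subgroup_dvd[OF Z(1) I ZI] Z(4) by auto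
      have "r * l dvd r * s" using card_subgroup_dvd[OF I, of V] \<W> VV' l by auto
      then have "l dvd s" using r1 by simp
      moreover have "l \<noteq> s"
      proof
        assume "l = s"
        then have "card (V \<inter> V') = card V" "card (V \<inter> V') = card V'" using l \<W>(2) VV' by auto
        then have "V \<inter> V' = V" "V \<inter> V' = V'"
          using card_subset_eq[of V "V \<inter> V'"] card_subset_eq[of V' "V \<inter> V'"] \<W>(1) VV' by auto
        then show False using VV'(3) by blast
      qed
      ultimately have "l = 1" using s(1) by (auto simp: prime_nat_iff)
      then have "card Z = card (V \<inter> V')" using l Z(4) by simp
      then have "Z = V \<inter> V'" using card_subset_eq[of "V \<inter> V'" Z] ZI I by simp
      then show "(V - Z) \<inter> (V' - Z) = {}" by blast
    qed
  qed
  also have "\<dots> = (\<Sum>V\<in>\<W>. r * s - r)"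
  proof (rule sum.cong)
    fix V assume V: "V \<in> \<W>"
    show "card (V - Z) = r * s - r"
      using card_Diff_subset[of Z V] \<W>[OF V] Z by simp
  qed simp
  finally have cU: "card U = r ^ 2 * (r * s - r)" using c\<W> by simp
  have UC: "U \<subseteq> C" using \<W>(4) by (auto simp: U_def)
  have "card (C - U) = r ^ 3 * s - r ^ 2 * (r * s - r)"
    using card_Diff_subset[of U C] UC C cU cC finite_subset[OF UC] by simp
  also have "r ^ 2 * (r * s - r) = r ^ 3 * s - r ^ 3"
    by (simp add: right_diff_distrib' eval_nat_numeral algebra_simps)
  also have "r ^ 3 * s - (r ^ 3 * s - r ^ 3) = r ^ 3" using s1 by simp
  finally have cCU: "card (C - U) = r ^ 3" .
  \<comment> \<open>A subgroup \<open>P\<close> of order \<open>r^3\<close> in \<open>C\<close>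
    contains \<open>Z\<close>, as \<open>C\<close> fixes \<open>Z\<close> under conjugation, and
    meets each \<open>V\<close> only in \<open>Z\<close>, as \<open>s\<close> is prime to
    \<open>r\<close>. So it avoids \<open>U\<close> and fills the \<open>r^3\<close> remaining
    places.\<close>
  have uniq: "P = C - U" if P: "subgroup P G" "card P = r ^ 3" "P \<subseteq> C" for P
  proof -
    have "P \<inter> U = {}"
    proof (rule ccontr)
      assume "P \<inter> U \<noteq> {}"
      then obtain x V where x: "x \<in> P" "V \<in> \<W>" "x \<in> V" "x \<notin> Z" by (auto simp: U_def)
      obtain c where c: "c \<in> C" "conj_set G c P \<subseteq> R"
        using p_subgroup_conj_into_sylow_of[OF r C R(1) RC _ P(1,3,2)] R(2) mC by auto
      have cc: "c \<in> carrier G" using c Cc by auto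
      have ceq: "conj_set G c P = R"
        using card_subset_eq[of R "conj_set G c P"] c cc P R subgroup.subset[OF P(1)] by simp
      have "Z \<subseteq> P"
      proof -
        have "conj_set G c Z \<subseteq> conj_set G c P" using conjZ[OF c(1)] ceq Z(2) by simp
        then show ?thesis
          using conj_set_mono[of "conj_set G c Z" "conj_set G c P" "inv c"] cc Zc subgroup.subset[OF P(1)] by simp
      qed
      then have ZI: "Z \<subseteq> P \<inter> V" using \<W>(3) x by auto
      have I: "subgroup (P \<inter> V) G" using subgroups_Inter_pair[OF P(1) \<W>(1)[OF x(2)]] .
      obtain l where l: "card (P \<inter> V) = r * l" using card_subgroup_dvd[OF Z(1) I ZI] Z(4) by auto
      have "r * l dvd r * s" using card_subgroup_dvd[OF I \<W>(1)[OF x(2)]] \<W>(2)[OF x(2)] l by auto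
      then have "l dvd s" using r1 by simp
      have "r * l dvd r ^ 3" using card_subgroup_dvd[OF I P(1)] P(2) l by auto
      then have "l dvd r ^ 3" by (metis dvd_mult_right)
      moreover have "coprime s (r ^ 3)" using cop by (simp add: coprime_commute)
      ultimately have "l = 1" using \<open>l dvd s\<close> coprime_common_divisor_nat by metis
      then have "Z = P \<inter> V" using card_subset_eq[of "P \<inter> V" Z] ZI I l Z(4) by simp
      then show False using x by auto
    qed
    then have "P \<subseteq> C - U" using P by auto
    then show ?thesis using card_subset_eq[of "C - U" P] C cCU P by simp
  qed
  have "C \<subseteq> normalizer G R"
  proof
    fix g assume g: "g \<in> C"
    then have gc: "g \<in> carrier G" using Cc by auto
    have Rc: "R \<subseteq> carrier G" using R subgroup.subset by auto
    have "conj_set G g R \<subseteq> C" using conj_set_mono[OF RC, of g] conj_set_self[OF C g] by simp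
    then have "conj_set G g R = C - U"
      using uniq[OF subgroup_conj_set[OF R(1) gc]] card_conj_set[OF Rc gc] R(2) by simp
    then have "conj_set G g R = R" using uniq[OF R(1,2) RC] by (simp only:)
    then show "g \<in> normalizer G R" using gc mem_normalizer[OF Rc] by simp
  qed
  then show False using NR RC ne by (auto simp: C_def)
qed


text \<open>\<open>R\<close> is nonabelian with centre \<open>Z\<close> of order \<open>r\<close>,
  and it is both the centralizer and the normalizer of \<open>Z\<close>. Subgroups of order
  \<open>r^2\<close> are bad, hence conjugate. Once \<open>Z\<close> is known to be the only
  subgroup of order \<open>r\<close> in those of order \<open>r^2\<close> in \<open>R\<close>, an
  element conjugating one of these to another fixes \<open>Z\<close>, so it lies in \<open>R\<close>
  and normalizes the first: contradiction. The hypotheses \<open>bad\<close> and \<open>ordC\<close>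
  collect what the cases of two and three primes share.\<close>

lemma smallest_sylow_order_cube_False:
  assumes r: "prime r" and min: "\<And>q. prime q \<Longrightarrow> q dvd order G \<Longrightarrow> r \<le> q"
    and mult: "multiplicity r (order G) = 3" and good: "r ^ 3 \<notin> bad_orders G"
    and conj: "\<And>H K. bad_subgroup G H \<Longrightarrow> bad_subgroup G K \<Longrightarrow> card H = card K \<Longrightarrow>
      \<exists>g\<in>carrier G. K = conj_set G g H"
    and bad: "\<And>H. bad_subgroup G H \<Longrightarrow> \<exists>p k. prime p \<and> card H = p ^ k"
    and ordC: "\<And>C s. subgroup C G \<Longrightarrow> C \<noteq> carrier G \<Longrightarrow> r ^ 3 dvd card C \<Longrightarrow> prime s \<Longrightarrow> s \<noteq> r \<Longrightarrow>
      multiplicity s (card C) = 1 \<Longrightarrow> card C = r ^ 3 * s"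
  shows False
proof -
  have r1: "r > 1" using r prime_gt_1_nat by blast
  have "r ^ 3 dvd order G" using multiplicity_dvd[of r "order G"] mult by simp
  then have rd: "r dvd order G" by (metis dvd_power dvd_trans zero_less_numeral)
  obtain R where R: "subgroup R G" "card R = r ^ 3"
    using exists_sylow_subgroup[OF r subgroup_self] mult by (auto simp: order_def)
  have Rs: "card R = r ^ multiplicity r (order G)" using R mult by simp
  have Rc: "R \<subseteq> carrier G" by (rule subgroup.subset[OF R(1)])
  have R1: "R \<noteq> {\<one>}" using R(2) one_less_power[OF r1, of 3] by auto
  have NR: "normalizer G R = R"
  proof (rule ccontr)
    assume "normalizer G R \<noteq> R"
    then have "bad_subgroup G R" using R R1 by (simp add: bad_subgroup_def)
    then show False using bad_orderI[of R] R(2) good by simp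
  qed
  have nonab: "\<not> R \<subseteq> centralizer G R" using abelian_sylow_normalizer[OF r rd R(1) Rs] NR by auto
  define Z where "Z = R \<inter> centralizer G R"
  have Z: "subgroup Z G" unfolding Z_def by (rule subgroup_inter_centralizer[OF R(1) Rc])
  have ZR: "Z \<subseteq> R" by (simp add: Z_def)
  have Zc: "Z \<subseteq> carrier G" by (rule subgroup.subset[OF Z])
  have no_central_square: False if "subgroup E G" "E \<subseteq> Z" "card E = r ^ 2" for E
    using abelian_of_central_index_prime[OF r R(1) that(1)] that(2,3) R(2) nonab
    by (auto simp: Z_def eval_nat_numeral)
  have cZ: "card Z = r"
  proof -
    obtain k where k: "k \<le> 3" "card Z = r ^ k" using prime_power_subgroup_card[OF r R(1) Z ZR R(2)] .
    have "r dvd card Z" using p_group_center_nontrivial[OF r R(1,2)] by (simp add: Z_def)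
    then have "k \<noteq> 0" using k r1 by (metis nat_dvd_1_iff_1 not_less_iff_gr_or_eq power_0)
    moreover have "\<not> k \<ge> 2"
    proof
      assume "k \<ge> 2"
      then have "r ^ 2 dvd card Z" using k(2) by (simp add: le_imp_power_dvd)
      then obtain E where "subgroup E G" "E \<subseteq> Z" "card E = r ^ 2"
        using exists_prime_power_subgroup[OF r Z] by blast
      then show False by (rule no_central_square)
    qed
    ultimately have "k = 1" by linarith
    then show ?thesis using k by simp
  qed
  have RCZ: "R \<subseteq> centralizer G Z"
    using subset_centralizer_commute[OF Rc Zc] by (simp add: Z_def)
  have CZ: "centralizer G Z = R"
    by (rule centralizer_eq_sylow[OF r R mult NR Z ZR RCZ cZ bad ordC])
  have big: "q dvd order G \<Longrightarrow> prime q \<Longrightarrow> q \<noteq> r \<Longrightarrow> r < q" for q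
    using min by (metis le_neq_implies_less)
  \<comment> \<open>For \<open>q > r\<close> the Sylow \<open>q\<close>-subgroups of
    \<open>N\<close> lie in the centralizer of \<open>Z\<close>, which is the \<open>r\<close>-group
    \<open>R\<close>, so \<open>N\<close> has no other primes. This is applied to the normalizers of
    \<open>Z\<close> and of \<open>E\<close>.\<close>
  have overgroup: "N = R"
    if N: "subgroup N G" "R \<subseteq> N"
      and T: "\<And>q T n. prime q \<Longrightarrow> r < q \<Longrightarrow> subgroup T G \<Longrightarrow> card T = q ^ n \<Longrightarrow> T \<subseteq> N \<Longrightarrow> T \<subseteq> centralizer G Z"
    for N
  proof -
    have "R = N"
    proof (rule subgroup_eqI_sylow[OF R(1) N])
      fix q :: nat assume q: "prime q" "q dvd card N"
      show "q ^ multiplicity q (card N) dvd card R"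
      proof (cases "q = r")
        case True
        then show ?thesis using sylow_multiplicity_between[OF r R(1) N Rs] Rs by simp
      next
        case False
        have "q dvd order G" using q(2) card_subgroup_dvd_order[OF N(1)] dvd_trans by blast
        then have "r < q" using big q(1) False by blast
        obtain T where T': "subgroup T G" "T \<subseteq> N" "card T = q ^ multiplicity q (card N)"
          using exists_sylow_subgroup[OF q(1) N(1)] by blast
        then have "T \<subseteq> R" using T[OF q(1) \<open>r < q\<close> T'(1,3,2)] CZ by simp
        then show ?thesis using card_subgroup_dvd[OF T'(1) R(1)] T'(3) by simp
      qed
    qed
    then show ?thesis by simp
  qed
  have NZ: "normalizer G Z = R"
  proof (rule overgroup[OF subgroup_normalizer[OF Z]])
    show "R \<subseteq> normalizer G Z" using RCZ centralizer_subset_normalizer[OF Zc] by blast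
    fix q T n assume "prime q" "r < q" "subgroup T G" "card T = q ^ n" "T \<subseteq> normalizer G Z"
    then show "T \<subseteq> centralizer G Z" using p_subgroup_centralizes_order_prime[OF _ _ _ r _ Z cZ] by blast
  qed
  \<comment> \<open>\<open>E\<close> has index \<open>r\<close> in \<open>P\<close>, and its
    normalizer in \<open>P\<close> is larger than \<open>E\<close>, so it is all of
    \<open>P\<close>.\<close>
  have square_normal: "P \<subseteq> normalizer G E"
    if "subgroup P G" "card P = r ^ 3" "subgroup E G" "E \<subseteq> P" "card E = r ^ 2" for P E
  proof -
    have I: "subgroup (P \<inter> normalizer G E) G"
      using subgroups_Inter_pair[OF that(1) subgroup_normalizer[OF that(3)]] .
    have "r * card E dvd card P" using that by (simp add: eval_nat_numeral)
    then have "r * card E dvd card (P \<inter> normalizer G E)"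
      using p_subgroup_normalizer_grows_in[OF r that(1,3,4,5)] by blast
    then have "card P dvd card (P \<inter> normalizer G E)" using that by (simp add: eval_nat_numeral)
    then have "card P \<le> card (P \<inter> normalizer G E)" using I by (intro dvd_imp_le) auto
    then have "P \<inter> normalizer G E = P" using that(1) by (intro card_seteq) auto
    then show ?thesis by blast
  qed
  \<comment> \<open>The abelian \<open>E\<close> and a central \<open>z\<close> outside it would lie
    in the centralizer of \<open>E\<close> in \<open>R\<close>, which then is \<open>R\<close>; so
    \<open>E\<close> would be central of order \<open>r^2\<close>.\<close>
  have Z_in_square: "Z \<subseteq> E" if E: "subgroup E G" "E \<subseteq> R" "card E = r ^ 2" for E
  proof (rule ccontr)
    assume "\<not> Z \<subseteq> E"
    then obtain z where z: "z \<in> Z" "z \<notin> E" by auto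
    have Ec: "E \<subseteq> carrier G" by (rule subgroup.subset[OF E(1)])
    let ?F = "R \<inter> centralizer G E"
    have F: "subgroup ?F G" by (rule subgroup_inter_centralizer[OF R(1) Ec])
    have EF: "E \<subseteq> ?F" using order_prime_square_abelian[OF r E(1,3)] E(2) by blast
    have zF: "z \<in> ?F" using z E(2) Zc by (auto simp: Z_def centralizer_def)
    obtain k where k: "k \<le> 3" "card ?F = r ^ k" using prime_power_subgroup_card[OF r R(1) F _ R(2)] by auto
    have "r ^ 2 < r ^ k"
      using psubset_card_mono[of ?F E] F EF zF z(2) E(3) k by auto
    then have "2 < k" using r1 by (simp add: power_strict_increasing_iff)
    then have "k = 3" using k(1) by linarith
    then have "card ?F = card R" using k(2) R(2) by simp
    then have "?F = R" using card_subset_eq[of R ?F] R(1) by auto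
    then have "R \<subseteq> centralizer G E" by blast
    then have "E \<subseteq> Z" using subset_centralizer_commute[OF Rc Ec] E(2) by (simp add: Z_def)
    then show False using no_central_square[OF E(1) _ E(3)] by blast
  qed
  \<comment> \<open>The centralizer of a noncentral \<open>x\<close> in \<open>R\<close> contains
    \<open>Z\<close> and \<open>x\<close> and is not \<open>R\<close>, so its order lies strictly
    between \<open>r\<close> and \<open>r^3\<close>. Thus every such \<open>x\<close> lies in a
    subgroup of order \<open>r^2\<close>.\<close>
  have cent: "subgroup (R \<inter> centralizer G {x}) G" "card (R \<inter> centralizer G {x}) = r ^ 2"
    "x \<in> R \<inter> centralizer G {x}" if x: "x \<in> R" "x \<notin> Z" for x
  proof -
    let ?F = "R \<inter> centralizer G {x}"
    have xc: "x \<in> carrier G" using x Rc by auto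
    show F: "subgroup ?F G" using subgroup_inter_centralizer[OF R(1), of "{x}"] xc by simp
    show xF: "x \<in> ?F" using x xc by (auto simp: centralizer_def)
    have ZF: "Z \<subseteq> ?F" using x(1) by (auto simp: Z_def centralizer_def)
    obtain k where k: "k \<le> 3" "card ?F = r ^ k" using prime_power_subgroup_card[OF r R(1) F _ R(2)] by auto
    have "r ^ 1 < r ^ k"
      using psubset_card_mono[of ?F Z] F ZF xF x(2) cZ k by auto
    then have "1 < k" using r1 power_less_imp_less_exp by blast
    moreover have "k \<noteq> 3"
    proof
      assume "k = 3"
      then have "?F = R" using card_subset_eq[of R ?F] R k by auto
      then have "R \<subseteq> centralizer G {x}" by blast
      then have "{x} \<subseteq> centralizer G R" using subset_centralizer_commute[OF Rc, of "{x}"] xc by simp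
      then show False using x by (simp add: Z_def)
    qed
    ultimately have "k = 2" using k(1) by linarith
    then show "card ?F = r ^ 2" using k(2) by simp
  qed
  have only_Z: "A = Z" if E: "subgroup E G" "E \<subseteq> R" "card E = r ^ 2"
    and A: "subgroup A G" "A \<subseteq> E" "card A = r" for E A
  proof (rule ccontr)
    assume AZ: "A \<noteq> Z"
    have ZE: "Z \<subseteq> E" by (rule Z_in_square[OF E])
    have Ac: "A \<subseteq> carrier G" by (rule subgroup.subset[OF A(1)])
    have Ec: "E \<subseteq> carrier G" by (rule subgroup.subset[OF E(1)])
    obtain g where g: "g \<in> carrier G" "A = conj_set G g Z"
      using conj[OF order_prime_bad[OF r Z cZ] order_prime_bad[OF r A(1,3)]] cZ A(3) by auto
    define R' where "R' = centralizer G A"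
    have R': "subgroup R' G" "card R' = r ^ 3"
      unfolding R'_def using subgroup_centralizer[OF Ac] centralizer_conj_set[OF Zc g(1)] g CZ R(2) Rc by auto
    have Eab: "E \<subseteq> centralizer G E" by (rule order_prime_square_abelian[OF r E(1,3)])
    have ER': "E \<subseteq> R'" using Eab A(2) by (auto simp: R'_def centralizer_def)
    have R'R: "R' \<noteq> R"
    proof
      assume "R' = R"
      then have "A \<subseteq> centralizer G R"
        using subset_centralizer_commute[OF Rc Ac] by (simp add: R'_def)
      then have "A \<subseteq> Z" using A E by (auto simp: Z_def)
      then show False using AZ card_subset_eq[of Z A] Z A(3) cZ by simp
    qed
    \<comment> \<open>\<open>A\<close> is conjugate to \<open>Z\<close>, so \<open>R'\<close> is
      another group of order \<open>r^3\<close>; it contains \<open>E\<close> and normalizes it. The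
      normalizer of \<open>E\<close> therefore exceeds \<open>R\<close>, and
      \<open>overgroup\<close> yields \<open>T\<close>.\<close>
    have "\<exists>q T n. prime q \<and> r < q \<and> subgroup T G \<and> card T = q ^ n \<and> T \<subseteq> normalizer G E \<and> \<not> T \<subseteq> centralizer G Z"
    proof (rule ccontr)
      assume "\<not> ?thesis"
      then have "normalizer G E = R"
        using overgroup[OF subgroup_normalizer[OF E(1)] square_normal[OF R E]] by blast
      then have "R' \<subseteq> R" using square_normal[OF R' E(1) ER' E(3)] by simp
      then show False using R'R card_subset_eq[of R R'] R R' by simp
    qed
    then obtain q T n where T: "prime q" "r < q" "subgroup T G" "card T = q ^ n" "T \<subseteq> normalizer G E"
      "\<not> T \<subseteq> centralizer G Z" by blast
    have "\<not> T \<subseteq> centralizer G E" using T(6) ZE by (auto simp: centralizer_def)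
    then have r2: "r = 2"
      using p_subgroup_centralizes_order_prime_square[OF T(1,3,4) r T(2) E(1,3) T(5)] by blast
    have invol: "x \<otimes> x = \<one>" if "subgroup K G" "card K = 2" "x \<in> K" for x K
    proof -
      interpret K: finite_group "G\<lparr>carrier := K\<rparr>" by (rule finite_group_restrict[OF that(1)])
      have "x [^] (2::nat) = \<one>"
        using K.pow_order_eq_1[of x] that by (simp add: order_def flip: nat_pow_consistent)
      then show ?thesis using that subgroup.mem_carrier[OF that(1)] by (simp add: numeral_2_eq_2)
    qed
    \<comment> \<open>In the abelian \<open>E\<close> the solutions of
      \<open>x \<otimes> x = \<one>\<close> form a subgroup, which contains the two different groups
      \<open>A\<close> and \<open>Z\<close> of order 2.\<close>
    have E_invol: "x \<otimes> x = \<one>" if xE: "x \<in> E" for x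
    proof -
      define I where "I = {x \<in> E. x \<otimes> x = \<one>}"
      have I: "subgroup I G"
      proof (rule subgroupI)
        show "I \<subseteq> carrier G" using Ec by (auto simp: I_def)
        have "\<one> \<in> I" using subgroup.one_closed[OF E(1)] by (simp add: I_def)
        then show "I \<noteq> {}" by blast
        fix x assume x: "x \<in> I"
        have xc: "x \<in> carrier G" using x Ec by (auto simp: I_def)
        have "inv x \<otimes> inv x = inv (x \<otimes> x)" using xc by (simp add: inv_mult_group)
        then show "inv x \<in> I" using x subgroup.m_inv_closed[OF E(1)] by (simp add: I_def)
        fix y assume y: "y \<in> I"
        have yc: "y \<in> carrier G" using y Ec by (auto simp: I_def)
        have xy: "y \<otimes> x = x \<otimes> y" using x y Eab by (auto simp: I_def centralizer_def)
        have "x \<otimes> y \<otimes> (x \<otimes> y) = x \<otimes> (y \<otimes> x) \<otimes> y" using xc yc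
            by (simp add: m_assoc)
        also have "\<dots> = (x \<otimes> x) \<otimes> (y \<otimes> y)" unfolding xy using xc yc by (simp add: m_assoc)
        finally show "x \<otimes> y \<in> I" using x y subgroup.m_closed[OF E(1)] by (simp add: I_def)
      qed
      have AI: "A \<subseteq> I" "Z \<subseteq> I"
        using invol[OF A(1)] invol[OF Z] A ZE cZ r2 by (auto simp: I_def)
      have IE: "I \<subseteq> E" by (auto simp: I_def)
      obtain k where k: "k \<le> 2" "card I = r ^ k" using prime_power_subgroup_card[OF r E(1) I IE E(3)] .
      have "A \<noteq> I" using AZ AI card_subset_eq[of A Z] A(1,3) cZ by auto
      then have "r ^ 1 < r ^ k" using psubset_card_mono[of I A] AI I A(3) k by auto
      then have "1 < k" using r1 power_less_imp_less_exp by blast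
      then have "k = 2" using k(1) by linarith
      then have "card I = card E" using k(2) E(3) by simp
      then have "I = E" using card_subset_eq[of E I] IE E(1) by simp
      then show ?thesis using xE by (auto simp: I_def)
    qed
    \<comment> \<open>A noncentral \<open>x\<close> lies in its centralizer in \<open>R\<close>,
      which has order 4 and so is conjugate to \<open>E\<close>. Exponent 2 then makes
      \<open>R\<close> abelian.\<close>
    have R_invol: "x \<otimes> x = \<one>" if x: "x \<in> R" for x
    proof (cases "x \<in> Z")
      case True then show ?thesis using E_invol ZE by auto
    next
      case False
      note F = cent[OF x False]
      obtain h where h: "h \<in> carrier G" "R \<inter> centralizer G {x} = conj_set G h E"
        using conj[OF order_prime_square_bad[OF r E(1,3)] order_prime_square_bad[OF r F(1,2)]] E(3) F(2) by auto
      then obtain e where e: "e \<in> E" "x = h \<otimes> e \<otimes> inv h" using F(3) by (auto simp: conj_set_def)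
      then show ?thesis using h(1) Ec E_invol[OF e(1)] by (auto simp: conj_mult_distrib subset_iff)
    qed
    have "x \<otimes> y = y \<otimes> x" if "x \<in> R" "y \<in> R" for x y
    proof -
      have c: "x \<in> carrier G" "y \<in> carrier G" using that Rc by auto
      have i: "inv u = u" if "u \<in> R" for u using R_invol[OF that] that Rc by (auto intro!: inv_equality)
      have "x \<otimes> y = inv (x \<otimes> y)" using i[of "x \<otimes> y"] subgroup.m_closed[OF R(1)] that by simp
      also have "\<dots> = y \<otimes> x" using c i that by (simp add: inv_mult_group)
      finally show ?thesis .
    qed
    then show False using nonab Rc by (auto simp: centralizer_def)
  qed
  obtain E where E: "subgroup E G" "E \<subseteq> R" "card E = r ^ 2"
    using exists_prime_power_subgroup[OF r R(1), of 2] R(2) by (auto simp: le_imp_power_dvd)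
  have "E \<noteq> R" using E(3) R(2) r1 by auto
  \<comment> \<open>An element outside \<open>E\<close> produces a second subgroup of order
    \<open>r^2\<close> in \<open>R\<close>; the element conjugating \<open>E\<close> to it will
    normalize \<open>Z\<close>, hence \<open>E\<close>.\<close>
  then obtain x where x: "x \<in> R" "x \<notin> E" using E(2) by auto
  have "x \<notin> Z" using Z_in_square[OF E] x by auto
  note F = cent[OF x(1) this]
  obtain g where g: "g \<in> carrier G" "R \<inter> centralizer G {x} = conj_set G g E"
    using conj[OF order_prime_square_bad[OF r E(1,3)] order_prime_square_bad[OF r F(1,2)]] E(3) F(2) by auto
  have "conj_set G g Z = Z"
  proof (rule only_Z[OF F(1) _ F(2)])
    show "conj_set G g Z \<subseteq> R \<inter> centralizer G {x}"
      using conj_set_mono[OF Z_in_square[OF E], of g] g(2) by simp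
  qed (use g(1) Z Zc cZ in \<open>auto simp: subgroup_conj_set\<close>)
  then have "g \<in> normalizer G Z" using g(1) mem_normalizer[OF Zc] by simp
  then have "g \<in> normalizer G E" using NZ square_normal[OF R E] by auto
  then have "conj_set G g E = E" using mem_normalizer[OF subgroup.subset[OF E(1)]] by simp
  then show False using g(2) F(3) x(2) by auto
qed

end

section \<open>The possible orders\<close>

lemma prime_power_inj:
  fixes p q :: nat
  assumes "prime p" "prime q" "p ^ k = q ^ l" "k > 0"
  shows "p = q" "k = l"
proof -
  have "p dvd q ^ l" using assms by (metis dvd_power)
  then show pq: "p = q" using assms(1,2) by (meson prime_dvd_power primes_dvd_imp_eq)
  show "k = l" using assms(3) prime_gt_1_nat[OF assms(1)] pq by simp
qed

lemma prime_power_neq: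
  fixes p q :: nat
  assumes "prime p" "prime q" "k > 0" "p \<noteq> q \<or> k \<noteq> l"
  shows "p ^ k \<noteq> q ^ l"
  using assms prime_power_inj by blast

context nonabelian_simple_group
begin

text \<open>The prime divisors and \<open>r^2\<close> are bad orders, so there are at most three
  primes. With two primes, \<open>b \<noteq> 1\<close> adds \<open>q^2\<close>. All four places are
  then taken: the fourth power of a prime divisor, or with three primes the square of
  \<open>p\<close> or \<open>q\<close>, would add a fifth order. The exponents \<open>1\<close> keep
  every order in the shape that \<open>prime_power_neq\<close> handles.\<close>

lemma four_bad_orders_cases:
  assumes "card (bad_orders G) \<le> 4"
  obtains
    (two) r q a b where "prime r" "prime q" "r < q" "order G = r ^ a * q ^ b" "2 \<le> a" "a \<le> 3"
      "2 \<le> b" "b \<le> 3" "bad_orders G = {r ^ 1, r ^ 2, q ^ 1, q ^ 2}" "card (bad_orders G) = 4"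
  | (three) r p q a where "prime r" "prime p" "prime q" "r < p" "p < q"
      "order G = r ^ a * (p * q)" "2 \<le> a" "a \<le> 3" "bad_orders G = {r ^ 1, r ^ 2, p ^ 1, q ^ 1}"
      "card (bad_orders G) = 4"
proof -
  define \<pi> where "\<pi> = prime_factors (order G)"
  have pi: "p \<in> \<pi> \<longleftrightarrow> prime p \<and> p dvd order G" for p
    using order_pos by (auto simp: \<pi>_def prime_factors_dvd)
  have fin\<pi>: "finite \<pi>" by (simp add: \<pi>_def)
  have prod: "order G = (\<Prod>p\<in>\<pi>. p ^ multiplicity p (order G))"
    unfolding \<pi>_def by (rule prime_factorization_nat[OF order_pos])
  have "\<pi> \<noteq> {}"
  proof
    assume "\<pi> = {}"
    then have "order G = 1" using prod by simp
    then show False using order_gt_one by simp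
  qed
  define r where "r = Min \<pi>"
  have r\<pi>: "r \<in> \<pi>" and rmin: "\<And>q. q \<in> \<pi> \<Longrightarrow> r \<le> q"
    using fin\<pi> \<open>\<pi> \<noteq> {}\<close> by (auto simp: r_def)
  have r: "prime r" "r dvd order G" using r\<pi> pi by auto
  have r2: "r ^ 2 dvd order G" by (rule smallest_prime_square_dvd[OF r]) (use rmin pi in blast)
  have BO\<pi>: "\<pi> \<subseteq> bad_orders G" using prime_in_bad_orders pi by blast
  have BOr: "r ^ 2 \<in> bad_orders G" by (rule prime_square_in_bad_orders[OF r(1) r2])
  have mult_ge: "k \<le> multiplicity p (order G)" if "prime p" "p ^ k dvd order G" for p k
    using that order_pos not_prime_unit by (intro multiplicity_geI) auto
  have mult_dvd: "p ^ k dvd order G" if "k \<le> multiplicity p (order G)" for p k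
    using that multiplicity_dvd' by blast
  have a2: "2 \<le> multiplicity r (order G)" using mult_ge[OF r(1) r2] .
  have pos: "1 \<le> multiplicity p (order G)" if "p \<in> \<pi>" for p using mult_ge[of p 1] that pi by simp
  have "card (insert (r ^ 2) \<pi>) \<le> card (bad_orders G)"
    using BO\<pi> BOr finite_bad_orders by (intro card_mono) auto
  moreover have r2\<pi>: "r ^ 2 \<notin> \<pi>"
  proof
    assume "r ^ 2 \<in> \<pi>"
    then have "prime (r ^ 2)" using pi by blast
    then show False using prime_power_inj(2)[of "r ^ 2" r 1 2] r(1) by simp
  qed
  ultimately have c\<pi>: "card \<pi> \<le> 3" using assms fin\<pi> by simp
  moreover have "card \<pi> \<noteq> 0" using fin\<pi> \<open>\<pi> \<noteq> {}\<close> by simp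
  ultimately consider "card \<pi> = 1" | "card \<pi> = 2" | "card \<pi> = 3" by linarith
  then show thesis
  proof cases
    case 1
    then have "\<pi> = {r}" using r\<pi> by (auto simp: card_1_singleton_iff)
    then have "order G = r ^ multiplicity r (order G)" using prod by simp
    then show thesis using order_not_prime_power[OF r(1)] by blast
  next
    case 2
    then have "card (\<pi> - {r}) = 1" using r\<pi> by simp
    then obtain q where "\<pi> - {r} = {q}" by (auto simp: card_1_singleton_iff)
    then have \<pi>eq: "\<pi> = {r, q}" and qr: "q \<noteq> r" using r\<pi> by auto
    have q: "prime q" "q dvd order G" using \<pi>eq pi by auto
    have rq: "r < q" using rmin[of q] \<pi>eq qr by auto
    define a where "a = multiplicity r (order G)"
    define b where "b = multiplicity q (order G)"
    have ord: "order G = r ^ a * q ^ b" using prod \<pi>eq qr by (simp add: a_def b_def)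
    have "b \<noteq> 1"
      using order_not_prime_power_times_prime[OF r(1) q(1) qr[symmetric], of a] ord by (metis power_one_right)
    then have b2: "2 \<le> b" using pos[of q] \<pi>eq by (simp add: b_def)
    then have "q ^ 2 \<in> bad_orders G" using prime_square_in_bad_orders[OF q(1)] mult_dvd b_def by auto
    then have sub: "{r ^ 1, r ^ 2, q ^ 1, q ^ 2} \<subseteq> bad_orders G" using BO\<pi> BOr \<pi>eq by auto
    have c4: "card {r ^ 1, r ^ 2, q ^ 1, q ^ 2} = 4"
    proof -
      have "r ^ 1 \<noteq> r ^ 2" "r ^ 1 \<noteq> q ^ 1" "r ^ 1 \<noteq> q ^ 2" "r ^ 2 \<noteq> q ^ 1"
          "r ^ 2 \<noteq> q ^ 2" "q ^ 1 \<noteq> q ^ 2"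
        by (rule prime_power_neq; use r(1) q(1) qr in simp)+
      then show ?thesis by simp
    qed
    have BO: "bad_orders G = {r ^ 1, r ^ 2, q ^ 1, q ^ 2}"
      using card_seteq[OF finite_bad_orders sub] c4 assms by simp
    have cube: "x ^ 3 \<notin> bad_orders G" if "prime x" for x
    proof -
      have "x ^ 3 \<noteq> r ^ 1" "x ^ 3 \<noteq> r ^ 2" "x ^ 3 \<noteq> q ^ 1" "x ^ 3 \<noteq> q ^ 2"
        by (rule prime_power_neq; use that r(1) q(1) in simp)+
      then show ?thesis unfolding BO by blast
    qed
    have le3: "multiplicity x (order G) \<le> 3" if "prime x" for x
      using cube[OF that] prime_cube_in_bad_orders[OF that] mult_dvd[of 4 x] by fastforce
    show thesis
      by (rule two[OF r(1) q(1) rq ord]) (use a2 b2 le3 r q BO c4 in \<open>auto simp: a_def b_def\<close>)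
  next
    case 3
    then have "card (\<pi> - {r}) = 2" using r\<pi> by simp
    then obtain p q where pq: "\<pi> - {r} = {p, q}" "p \<noteq> q" by (auto simp: card_2_iff)
    obtain p q where pq: "\<pi> - {r} = {p, q}" "p < q"
    proof (cases "p < q")
      case True then show ?thesis using pq that[of p q] by auto
    next
      case False then show ?thesis using pq that[of q p] by auto
    qed
    then have \<pi>eq: "\<pi> = {r, p, q}" and ne: "p \<noteq> r" "q \<noteq> r" "p \<noteq> q" using r\<pi> by auto
    have p: "prime p" "p dvd order G" and q: "prime q" "q dvd order G" using \<pi>eq pi by auto
    have rp: "r < p" using rmin[of p] \<pi>eq ne by auto
    define a where "a = multiplicity r (order G)"
    have sub: "{r ^ 1, r ^ 2, p ^ 1, q ^ 1} \<subseteq> bad_orders G" using BO\<pi> BOr \<pi>eq by auto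
    have c4: "card {r ^ 1, r ^ 2, p ^ 1, q ^ 1} = 4"
    proof -
      have "r ^ 1 \<noteq> r ^ 2" "r ^ 1 \<noteq> p ^ 1" "r ^ 1 \<noteq> q ^ 1" "r ^ 2 \<noteq> p ^ 1"
          "r ^ 2 \<noteq> q ^ 1" "p ^ 1 \<noteq> q ^ 1"
        by (rule prime_power_neq; use r(1) p(1) q(1) ne in simp)+
      then show ?thesis by simp
    qed
    have BO: "bad_orders G = {r ^ 1, r ^ 2, p ^ 1, q ^ 1}"
      using card_seteq[OF finite_bad_orders sub] c4 assms by simp
    have cube: "x ^ 3 \<notin> bad_orders G" if "prime x" for x
    proof -
      have "x ^ 3 \<noteq> r ^ 1" "x ^ 3 \<noteq> r ^ 2" "x ^ 3 \<noteq> p ^ 1" "x ^ 3 \<noteq> q ^ 1"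
        by (rule prime_power_neq; use that r(1) p(1) q(1) in simp)+
      then show ?thesis unfolding BO by blast
    qed
    have square: "x ^ 2 \<notin> bad_orders G" if "prime x" "x \<noteq> r" for x
    proof -
      have "x ^ 2 \<noteq> r ^ 1" "x ^ 2 \<noteq> r ^ 2" "x ^ 2 \<noteq> p ^ 1" "x ^ 2 \<noteq> q ^ 1"
        by (rule prime_power_neq; use that r(1) p(1) q(1) in simp)+
      then show ?thesis unfolding BO by blast
    qed
    have a3: "a \<le> 3"
      using cube[OF r(1)] prime_cube_in_bad_orders[OF r(1)] mult_dvd[of 4 r] unfolding a_def by fastforce
    have one: "multiplicity x (order G) = 1" if "x \<in> \<pi>" "x \<noteq> r" for x
    proof -
      have "\<not> 2 \<le> multiplicity x (order G)"
        using square[of x] prime_square_in_bad_orders[of x] mult_dvd[of 2 x] that pi by blast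
      then show ?thesis using pos[OF that(1)] by linarith
    qed
    have ord: "order G = r ^ a * (p * q)"
      using prod \<pi>eq ne one[of p] one[of q] by (simp add: a_def)
    show thesis
      by (rule three[OF r(1) p(1) q(1) rp pq(2) ord]) (use a2 a3 BO c4 in \<open>auto simp: a_def\<close>)
  qed
qed

text \<open>An upper bound of four already leads to exactly four orders in each case, so a smaller
  number is contradictory.\<close>

lemma card_bad_orders_ge_4: "4 \<le> card (bad_orders G)"
proof (rule ccontr)
  assume "\<not> ?thesis"
  then have lt: "card (bad_orders G) < 4" and le: "card (bad_orders G) \<le> 4" by auto
  show False by (rule four_bad_orders_cases[OF le]) (use lt in auto)
qed

text \<open>The sign cannot be injective on 60 elements, so by simplicity it is trivial; the image
  consists of even permutations, of which there are 60.\<close>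

lemma iso_alt_group_5:
  assumes ord: "order G = 60" and \<phi>: "\<phi> \<in> hom G (sym_group 5)" "inj_on \<phi> (carrier G)"
  shows "G \<cong> alt_group 5"
proof -
  interpret \<phi>: group_hom G "sym_group 5" \<phi>
    using \<phi>(1) by (simp add: group_hom_def group_hom_axioms_def sym_group_is_group)
  interpret \<sigma>: group_hom G sign_img "sign \<circ> \<phi>"
    using \<phi>(1) sign_is_hom[of 5]
    by (auto simp: group_hom_def group_hom_axioms_def sign_img_is_group hom_def Pi_iff)
  have "kernel G sign_img (sign \<circ> \<phi>) \<noteq> {\<one>}"
  proof
    assume "kernel G sign_img (sign \<circ> \<phi>) = {\<one>}"
    then have "inj_on (sign \<circ> \<phi>) (carrier G)" by (rule \<sigma>.trivial_ker_imp_inj)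
    then have "card (carrier G) \<le> card (carrier sign_img)"
      using \<sigma>.hom_closed by (intro card_inj_on_le[of "sign \<circ> \<phi>"]) (auto simp: sign_img_def)
    then show False using ord by (simp add: order_def sign_img_def)
  qed
  then have "kernel G sign_img (sign \<circ> \<phi>) = carrier G" using normal_trivial[OF \<sigma>.normal_kernel]
      by blast
  then have sub: "\<phi> ` carrier G \<subseteq> carrier (alt_group 5)"
    using \<phi>.hom_closed unfolding alt_group_is_sign_kernel kernel_def by auto
  have calt: "card (carrier (alt_group 5)) = 60"
    using alt_group_card_carrier[of 5] by (simp add: eval_nat_numeral)
  then have "\<phi> ` carrier G = carrier (alt_group 5)"
    using sub card_image[OF \<phi>(2)] ord by (intro card_subset_eq) (auto simp: order_def intro: card_ge_0_finite)
  then have bij: "bij_betw \<phi> (carrier G) (carrier (alt_group 5))" using \<phi>(2) by (simp add: bij_betw_def)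
  have "\<phi> \<in> hom G (alt_group 5)"
    by (rule homI) (use sub \<phi>.hom_mult in \<open>auto simp: alt_group_mult sym_group_mult\<close>)
  then have "\<phi> \<in> iso G (alt_group 5)" using bij by (simp add: iso_def)
  then show ?thesis by (rule is_isoI)
qed

end

lemma multiplicity_prime_power_times:
  fixes p m :: nat
  assumes "prime p" "\<not> p dvd m"
  shows "multiplicity p (p ^ a * m) = a"
  by (rule multiplicity_eqI) (use assms prime_gt_0_nat[OF assms(1)] in \<open>auto simp: mult.commute[of p]\<close>)

section \<open>Conjugacy classes against orders of bad subgroups\<close>

context finite_group
begin

lemma subgroup_conj_class_eq: "subgroup_conj_class G H = (\<lambda>g. conj_set G g H) ` carrier G"
  by (auto simp: subgroup_conj_class_def conj_set_eq_cosets)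

lemma D_num_eq: "D_num G = card (subgroup_conj_class G ` {H. bad_subgroup G H})"
  unfolding D_num_def bad_subgroup_def by (rule arg_cong[of _ _ card]) auto

lemma card_subgroup_conj_class:
  "subgroup H G \<Longrightarrow> K \<in> subgroup_conj_class G H \<Longrightarrow> card K = card H"
  by (auto simp: subgroup_conj_class_eq subgroup.subset)

lemma subgroup_conj_class_self: "subgroup H G \<Longrightarrow> H \<in> subgroup_conj_class G H"
  unfolding subgroup_conj_class_eq by (intro image_eqI[of _ _ \<one>]) (auto simp: subgroup.subset)

lemma card_some_subgroup_conj_class:
  assumes "bad_subgroup G H"
  shows "card (SOME K. K \<in> subgroup_conj_class G H) = card H"
proof -
  have H: "subgroup H G" using assms by (simp add: bad_subgroup_def)
  then have "(SOME K. K \<in> subgroup_conj_class G H) \<in> subgroup_conj_class G H"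
    using subgroup_conj_class_self by (intro someI) auto
  then show ?thesis using card_subgroup_conj_class[OF H] by blast
qed

text \<open>The order is constant on a class, so any chosen member gives it. As an image of the
  classes, the orders are at most as many; equality means that the map is injective.\<close>

lemma bad_orders_eq_image:
  "bad_orders G = (\<lambda>c. card (SOME K. K \<in> c)) ` subgroup_conj_class G ` {H. bad_subgroup G H}"
  unfolding bad_orders_def image_image
  by (rule image_cong) (simp_all add: card_some_subgroup_conj_class)

lemma card_bad_orders_le_D_num: "card (bad_orders G) \<le> D_num G"
  unfolding bad_orders_eq_image D_num_eq by (intro card_image_le finite_imageI finite_bad_subgroups)

lemma bad_subgroups_same_card_conj:
  assumes eq: "card (bad_orders G) = D_num G"
    and H: "bad_subgroup G H" and K: "bad_subgroup G K" and HK: "card H = card K"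
  shows "\<exists>g\<in>carrier G. K = conj_set G g H"
proof -
  let ?C = "subgroup_conj_class G ` {H. bad_subgroup G H}"
  have inj: "inj_on (\<lambda>c. card (SOME K. K \<in> c)) ?C"
    using eq unfolding bad_orders_eq_image D_num_eq
    by (intro eq_card_imp_inj_on finite_imageI finite_bad_subgroups)
  have "subgroup_conj_class G H = subgroup_conj_class G K"
    by (rule inj_onD[OF inj]) (use card_some_subgroup_conj_class H K HK in auto)
  then have "K \<in> subgroup_conj_class G H"
    using subgroup_conj_class_self K by (simp add: bad_subgroup_def)
  then show ?thesis by (auto simp: subgroup_conj_class_eq)
qed

end

section \<open>Elimination of the remaining orders\<close>

context nonabelian_simple_group
begin

text \<open>A Sylow subgroup of order \<open>r^2\<close> is abelian, so some group of order
  \<open>q^n\<close> acts on it nontrivially, with \<open>q > r\<close> by minimality; coprime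
  action leaves only \<open>2, 3\<close>.\<close>

lemma smallest_sylow_order_square:
  assumes r: "prime r" and min: "\<And>q. prime q \<Longrightarrow> q dvd order G \<Longrightarrow> r \<le> q"
    and mult: "multiplicity r (order G) = 2"
  obtains R where "r = 2" "3 dvd order G" "subgroup R G" "card R = 4" "3 dvd card (normalizer G R)"
proof -
  have "r ^ 2 dvd order G" using multiplicity_dvd[of r "order G"] mult by simp
  then have rd: "r dvd order G" by (metis dvd_power dvd_trans zero_less_numeral)
  obtain R where R: "subgroup R G" "card R = r ^ 2"
    using exists_sylow_subgroup[OF r subgroup_self] mult by (auto simp: order_def)
  have Rs: "card R = r ^ multiplicity r (order G)" using R(2) mult by simp
  obtain q T n where T: "prime q" "q \<noteq> r" "subgroup T G" "card T = q ^ n" "T \<subseteq> normalizer G R"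
    "\<not> T \<subseteq> centralizer G R"
    using abelian_sylow_noncentral_action[OF r rd R(1) Rs order_prime_square_abelian[OF r R]] by blast
  \<comment> \<open>Minimality of \<open>r\<close> bounds \<open>q\<close> only if \<open>q\<close>
    divides the order of \<open>G\<close>, so \<open>T\<close> must be nontrivial.\<close>
  have "n \<noteq> 0"
  proof
    assume "n = 0"
    then have "T = {\<one>}" using T(3,4) card_one_subgroup_iff by simp
    then show False using T(6) subgroup.one_closed[OF subgroup_centralizer[OF subgroup.subset[OF R(1)]]] by simp
  qed
  then have qT: "q dvd card T" using T(4) by simp
  then have qd: "q dvd order G" using card_subgroup_dvd_order[OF T(3)] dvd_trans by blast
  then have "r < q" using min T(1,2) by (metis le_neq_implies_less)
  then have r2: "r = 2" "q = 3"
    using p_subgroup_centralizes_order_prime_square[OF T(1,3,4) r _ R T(5)] T(6) by auto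
  have "q dvd card (normalizer G R)"
    using card_subgroup_dvd[OF T(3) subgroup_normalizer[OF R(1)] T(5)] qT dvd_trans by blast
  then show ?thesis using that r2 qd R by simp
qed

lemma sylow_index_eq:
  assumes "subgroup Q G" "card Q = c" "order G = c * m"
  obtains k where "k dvd m" "card (normalizer G Q) = c * k" "order G div card (normalizer G Q) = m div k"
proof -
  have N: "subgroup (normalizer G Q) G" by (rule subgroup_normalizer[OF assms(1)])
  obtain k where k: "card (normalizer G Q) = c * k"
    using card_subgroup_dvd[OF assms(1) N subgroup_subset_normalizer[OF assms(1)]] assms(2) by auto
  have c: "c > 0" using assms(1,2) card_subgroup_pos by blast
  have "c * k dvd c * m" using card_subgroup_dvd_order[OF N] k assms(3) by simp
  then have "k dvd m" using c by simp
  moreover have "order G div card (normalizer G Q) = m div k" using k assms(3) c by simp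
  ultimately show ?thesis using that k by blast
qed

lemma normalizer_card_ne_order:
  assumes "subgroup Q G" "card Q \<noteq> 1" "card Q \<noteq> order G"
  shows "card (normalizer G Q) \<noteq> order G"
proof
  assume "card (normalizer G Q) = order G"
  then have "normalizer G Q = carrier G"
    using card_subset_eq[of "carrier G"] subgroup.subset[OF subgroup_normalizer[OF assms(1)]] by (simp add: order_def)
  moreover have "Q \<noteq> {\<one>}" "Q \<noteq> carrier G" using assms(2,3) by (auto simp: order_def)
  ultimately show False using normalizer_proper[OF assms(1)] by blast
qed

text \<open>For \<open>a = 2\<close> the order is \<open>4 * 3^b\<close>, at least 36, while a Sylow
  3-subgroup has index 4 and \<open>4! = 24\<close>. For \<open>a = 3\<close> the result on
  \<open>r^3\<close> applies.\<close>

lemma two_prime_case_False: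
  assumes r: "prime r" and q: "prime q" and rq: "r < q" and ord: "order G = r ^ a * q ^ b"
    and a: "2 \<le> a" "a \<le> 3" and b: "2 \<le> b" "b \<le> 3"
    and BO: "bad_orders G = {r ^ 1, r ^ 2, q ^ 1, q ^ 2}"
    and conj: "\<And>H K. bad_subgroup G H \<Longrightarrow> bad_subgroup G K \<Longrightarrow> card H = card K \<Longrightarrow>
      \<exists>g\<in>carrier G. K = conj_set G g H"
  shows False
proof -
  have prime_dvd: "s = r \<or> s = q" if "prime s" "s dvd order G" for s
    using that r q ord by (metis prime_dvd_mult_nat prime_dvd_power primes_dvd_imp_eq)
  have min: "r \<le> s" if "prime s" "s dvd order G" for s using prime_dvd[OF that] rq by auto
  have "\<not> r dvd q ^ b" using r q rq by (metis nat_neq_iff prime_dvd_power primes_dvd_imp_eq)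
  then have mult: "multiplicity r (order G) = a" using multiplicity_prime_power_times[OF r] ord by simp
  consider "a = 2" | "a = 3" using a by linarith
  then show False
  proof cases
    case 1
    obtain "r = 2" "3 dvd order G" using smallest_sylow_order_square[OF r min] mult 1 by metis
    then have q3: "q = 3" using prime_dvd[of 3] by simp
    have ord': "order G = 3 ^ b * 4" using ord 1 \<open>r = 2\<close> q3 by simp
    obtain Q where Q: "subgroup Q G" "card Q = 3 ^ b"
      using exists_prime_power_subgroup[OF _ subgroup_self, of 3 b] ord' by (auto simp: order_def)
    obtain k where k: "k dvd 4" "card (normalizer G Q) = 3 ^ b * k"
      "order G div card (normalizer G Q) = 4 div k" using sylow_index_eq[OF Q ord'] .
    have "\<not> 3 dvd order G div card Q" using ord' Q(2) by simp
    then have cong: "[4 div k = 1] (mod 3)" using sylow_number_cong[OF _ Q] k(3) by simp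
    have b9: "(9::nat) \<le> 3 ^ b" using power_increasing[OF b(1), of "3::nat"] by simp
    have "k \<le> 4" "k \<noteq> 0" using k(1) by (auto dest: dvd_imp_le intro!: Nat.gr0I)
    then consider "k = 1" | "k = 2" | "k = 3" | "k = 4" by linarith
    then show False
    proof cases
      case 1
      have "Q \<noteq> carrier G" using Q(2) ord' by (auto simp: order_def)
      then have "order G \<le> fact (order G div card Q)" by (rule order_le_fact_index[OF Q(1)])
      moreover have "order G div card Q = 4" using ord' Q(2) by simp
      ultimately show False using ord' b9 by (simp add: fact_numeral)
    next
      case 2
      then show False using cong by (simp add: cong_def)
    next
      case 3
      then show False using k(1) by simp
    next
      case 4
      then show False using normalizer_card_ne_order[OF Q(1)] k(2) Q(2) ord' b(1) by simp
    qed
  next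
    case 2
    show False
    proof (rule smallest_sylow_order_cube_False[OF r min _ _ conj])
      show "multiplicity r (order G) = 3" using mult 2 by simp
      have "r ^ 3 \<noteq> r ^ 1" "r ^ 3 \<noteq> r ^ 2" "r ^ 3 \<noteq> q ^ 1" "r ^ 3 \<noteq> q ^ 2"
        by (rule prime_power_neq; use r q in simp)+
      then show "r ^ 3 \<notin> bad_orders G" unfolding BO by blast
      show "\<exists>p k. prime p \<and> card H = p ^ k" if "bad_subgroup G H" for H
        using bad_orderI[OF that] r q unfolding BO by blast
      \<comment> \<open>The cofactor of \<open>r^3\<close> is a power of \<open>q\<close>, and
        multiplicity one leaves \<open>q\<close> itself.\<close>
      show "card C = r ^ 3 * s"
        if C: "subgroup C G" "r ^ 3 dvd card C" and s: "prime s" "s \<noteq> r" "multiplicity s (card C) = 1" for C s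
      proof -
        have "s dvd card C" using s(3) not_dvd_imp_multiplicity_0 by fastforce
        then have "s dvd order G" using card_subgroup_dvd_order[OF C(1)] dvd_trans by blast
        then have sq: "s = q" using prime_dvd s by blast
        obtain m where m: "card C = r ^ 3 * m" using C(2) by auto
        have "r ^ 3 * m dvd r ^ 3 * q ^ b" using card_subgroup_dvd_order[OF C(1)] m ord 2 by simp
        then have "m dvd q ^ b" using prime_gt_0_nat[OF r] by simp
        then obtain j where j: "m = q ^ j" using q by (auto simp: divides_primepow_nat)
        have "\<not> q dvd r ^ 3" using r q rq by (metis nat_neq_iff prime_dvd_power primes_dvd_imp_eq)
        then have "multiplicity q (q ^ j * r ^ 3) = j" by (rule multiplicity_prime_power_times[OF q])
        then have "j = 1" using s(3) sq m j by (simp add: mult.commute)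
        then show ?thesis using m j sq by simp
      qed
    qed
  qed
qed

text \<open>Once \<open>r = 2\<close> and \<open>p = 3\<close>, the order is \<open>12 q\<close>,
  and Sylow's congruence leaves \<open>q = 5\<close>. The five points are the cosets of the
  normalizer of \<open>R\<close>.\<close>

lemma three_prime_case_iso_alt_group_5:
  assumes r: "prime r" and p: "prime p" and q: "prime q" and rp: "r < p" and pq: "p < q"
    and ord: "order G = r ^ a * (p * q)" and a: "2 \<le> a" "a \<le> 3"
    and BO: "bad_orders G = {r ^ 1, r ^ 2, p ^ 1, q ^ 1}"
    and conj: "\<And>H K. bad_subgroup G H \<Longrightarrow> bad_subgroup G K \<Longrightarrow> card H = card K \<Longrightarrow>
      \<exists>g\<in>carrier G. K = conj_set G g H"
  shows "G \<cong> alt_group 5"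
proof -
  have prime_dvd: "s = r \<or> s = p \<or> s = q" if "prime s" "s dvd order G" for s
    using that r p q ord by (metis prime_dvd_mult_nat prime_dvd_power primes_dvd_imp_eq)
  have min: "r \<le> s" if "prime s" "s dvd order G" for s using prime_dvd[OF that] rp pq by auto
  have nd: "\<not> r dvd p * q" using r p q rp pq by (metis less_trans nat_neq_iff prime_dvd_mult_nat primes_dvd_imp_eq)
  then have mult: "multiplicity r (order G) = a" using multiplicity_prime_power_times[OF r] ord by simp
  have "a \<noteq> 3"
  proof
    assume a3: "a = 3"
    show False
    proof (rule smallest_sylow_order_cube_False[OF r min _ _ conj])
      show "multiplicity r (order G) = 3" using mult a3 by simp
      have "r ^ 3 \<noteq> r ^ 1" "r ^ 3 \<noteq> r ^ 2" "r ^ 3 \<noteq> p ^ 1" "r ^ 3 \<noteq> q ^ 1"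
        by (rule prime_power_neq; use r p q in simp)+
      then show "r ^ 3 \<notin> bad_orders G" unfolding BO by blast
      show "\<exists>p k. prime p \<and> card H = p ^ k" if "bad_subgroup G H" for H
        using bad_orderI[OF that] r p q unfolding BO by blast
      \<comment> \<open>With three primes it is \<open>C \<noteq> carrier G\<close> that keeps
        \<open>p\<close> and \<open>q\<close> from both dividing \<open>card C\<close>.\<close>
      show "card C = r ^ 3 * s"
        if C: "subgroup C G" "C \<noteq> carrier G" "r ^ 3 dvd card C"
          and s: "prime s" "s \<noteq> r" "multiplicity s (card C) = 1" for C s
      proof -
        obtain m where m: "card C = r ^ 3 * m" using C(3) by auto
        have "s dvd card C" using s(3) not_dvd_imp_multiplicity_0 by fastforce
        then have sm: "s dvd m" using m s r by (metis prime_dvd_mult_nat prime_dvd_power primes_dvd_imp_eq)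
        have "r ^ 3 * m dvd r ^ 3 * (p * q)" using card_subgroup_dvd_order[OF C(1)] m ord a3 by simp
        then have mpq: "m dvd p * q" using prime_gt_0_nat[OF r] by simp
        have ne: "m \<noteq> p * q"
        proof
          assume "m = p * q"
          then have "C = carrier G"
            using card_subset_eq[of "carrier G" C] subgroup.subset[OF C(1)] m ord a3 by (simp add: order_def)
          then show False using C(2) by simp
        qed
        have "s dvd p * q" using sm mpq dvd_trans by blast
        then have "s = p \<or> s = q" using s(1) p q by (metis prime_dvd_mult_nat primes_dvd_imp_eq)
        then obtain t where t: "p * q = s * t" "prime t" using p q by (metis mult.commute)
        obtain l where l: "m = s * l" using sm by auto
        have "l dvd t" using mpq t(1) l prime_gt_0_nat[OF s(1)] by simp
        then have "l = 1" using t l ne by (auto simp: prime_nat_iff)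
        then show ?thesis using m l by simp
      qed
    qed
  qed
  then have a2: "a = 2" using a by linarith
  obtain R where R: "r = 2" "3 dvd order G" "subgroup R G" "card R = 4" "3 dvd card (normalizer G R)"
    using smallest_sylow_order_square[OF r min] mult a2 by metis
  have p3: "p = 3" using prime_dvd[of 3] R(1,2) rp pq by auto
  have q5: "q \<ge> 5"
  proof -
    have "q \<noteq> 4" using q by auto
    then show ?thesis using pq p3 by linarith
  qed
  have ord': "order G = q * 12" using ord a2 R(1) p3 by simp
  have "q ^ 1 dvd card (carrier G)" using ord' by (simp add: order_def)
  then obtain Q where Q: "subgroup Q G" "card Q = q"
    using exists_prime_power_subgroup[OF q subgroup_self, of 1] by auto
  obtain k where k: "k dvd 12" "card (normalizer G Q) = q * k"
    "order G div card (normalizer G Q) = 12 div k" using sylow_index_eq[OF Q ord'] .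
  have nq12: "\<not> q dvd 12"
  proof
    assume "q dvd 12"
    then have "q dvd 2 * (2 * 3)" by simp
    then have "q dvd 2 \<or> q dvd 3" using q by (metis prime_dvd_mult_nat)
    then show False using q5 by (auto dest!: dvd_imp_le)
  qed
  have q0: "q > 0" using q5 by simp
  have "\<not> q dvd order G div card Q" using ord' Q(2) q0 nq12 by simp
  then have cong: "[12 div k = 1] (mod q)" using sylow_number_cong[OF q Q(1), of 1] Q(2) k(3) by simp
  have multq: "card Q = q ^ multiplicity q (order G)"
    using multiplicity_prime_power_times[OF q nq12, of 1] ord' Q(2) by simp
  \<comment> \<open>\<open>k\<close> is the index of \<open>Q\<close> in its normalizer:
    \<open>k = 1\<close> contradicts transfer, and \<open>k = 12\<close> would make \<open>Q\<close>
    normal.\<close>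
  have k1: "k \<noteq> 1"
  proof
    assume "k = 1"
    then have "normalizer G Q = Q"
      using k(2) Q card_subset_eq[of "normalizer G Q" Q] subgroup_subset_normalizer[OF Q(1)]
        subgroup_normalizer[OF Q(1)] by simp
    moreover have "q dvd order G" using ord' by simp
    ultimately show False
      using abelian_sylow_normalizer[OF q _ Q(1) multq] order_prime_abelian[OF q Q] by simp
  qed
  have k12: "k \<noteq> 12" using normalizer_card_ne_order[OF Q(1)] k(2) Q(2) ord' q5 by auto
  have "k \<le> 12" "k \<noteq> 0" using k(1) by (auto dest: dvd_imp_le intro!: Nat.gr0I)
  then have "k = 1 \<or> k = 2 \<or> k = 3 \<or> k = 4 \<or> k = 5 \<or> k = 6 \<or> k = 7 \<or> k = 8 \<or> k = 9 \<or> k = 10 \<or> k = 11 \<or> k = 12"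
    by presburger
  then have "k = 2 \<or> k = 3 \<or> k = 4 \<or> k = 6" using k(1) k1 k12 by (elim disjE) simp_all
  \<comment> \<open>The four numbers are \<open>12 div k - 1\<close> for
    \<open>k = 2, 3, 4, 6\<close>, the number of conjugates of \<open>Q\<close> minus one.\<close>
  then have "q dvd 5 \<or> q dvd 3 \<or> q dvd 2 \<or> q dvd 1"
    using cong cong_altdef_nat[of 1 "12 div k" q] by (elim disjE) simp_all
  then have q5': "q = 5" using q5 by (auto dest!: dvd_imp_le)
  have ord60: "order G = 60" using ord' q5' by simp
  obtain l where l: "l dvd 15" "card (normalizer G R) = 4 * l" "order G div card (normalizer G R) = 15 div l"
    using sylow_index_eq[OF R(3,4)] ord60 by auto
  \<comment> \<open>\<open>l\<close> divides 15 and is divisible by 3, and \<open>l = 15\<close>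
    would make \<open>R\<close> normal; so \<open>l = 3\<close> and the index is 5.\<close>
  have "3 dvd 4 * l" using R(5) l(2) by simp
  then have "3 dvd l" using prime_dvd_mult_nat[of 3 4 l] by simp
  then obtain j where j: "l = 3 * j" by auto
  have "j dvd 5" using l(1) j by simp
  then have "j = 1 \<or> j = 5" using q q5' by (auto simp: prime_nat_iff)
  moreover have "j \<noteq> 5" using normalizer_card_ne_order[OF R(3)] R(4) l(2) j ord60 by auto
  ultimately have idx: "order G div card (normalizer G R) = 5" using l(3) j by simp
  have "normalizer G R \<noteq> carrier G" using idx ord60 by (auto simp: order_def)
  then obtain \<phi> where "\<phi> \<in> hom G (sym_group 5)" "inj_on \<phi> (carrier G)"
    using embeds_sym_group_index[OF subgroup_normalizer[OF R(3)]] idx by metis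
  then show ?thesis by (rule iso_alt_group_5[OF ord60])
qed

lemma D_num_4_iso_alt_group_5:
  assumes D: "D_num G = 4"
  shows "G \<cong> alt_group 5"
proof -
  have le: "card (bad_orders G) \<le> 4" using card_bad_orders_le_D_num D by simp
  then have "card (bad_orders G) = D_num G" using card_bad_orders_ge_4 D by simp
  then have conj: "\<And>H K. bad_subgroup G H \<Longrightarrow> bad_subgroup G K \<Longrightarrow> card H = card K \<Longrightarrow>
      \<exists>g\<in>carrier G. K = conj_set G g H"
    by (rule bad_subgroups_same_card_conj)
  show ?thesis
  proof (rule four_bad_orders_cases[OF le])
    fix r q a b :: nat
    assume "prime r" "prime q" "r < q" "order G = r ^ a * q ^ b" "2 \<le> a" "a \<le> 3" "2 \<le> b" "b \<le> 3"
      "bad_orders G = {r ^ 1, r ^ 2, q ^ 1, q ^ 2}"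
    from two_prime_case_False[OF this conj] show ?thesis ..
  next
    fix r p q a :: nat
    assume "prime r" "prime p" "prime q" "r < p" "p < q" "order G = r ^ a * (p * q)" "2 \<le> a" "a \<le> 3"
      "bad_orders G = {r ^ 1, r ^ 2, p ^ 1, q ^ 1}"
    from three_prime_case_iso_alt_group_5[OF this conj] show ?thesis .
  qed
qed

end

section \<open>Reduction to simple groups\<close>

context finite_group
begin

text \<open>The normalizer in \<open>N\<close> is \<open>N \<inter> normalizer G H\<close>, so a
  subgroup of \<open>N\<close> that is self-normalizing in \<open>G\<close> is so in
  \<open>N\<close>.\<close>

lemma bad_subgroup_of_restrict:
  assumes N: "subgroup N G" and H: "bad_subgroup (G\<lparr>carrier := N\<rparr>) H"
  shows "bad_subgroup G H"
  using H normalizer_restrict[OF N, of H] by (auto simp: bad_subgroup_def subgroup_restrict_iff[OF N])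

text \<open>A subgroup of the quotient is a set of cosets, so its union is its full
  preimage.\<close>

lemma mem_Union_quotient_subgroup:
  assumes M: "M \<lhd> G" and K: "subgroup K (G Mod M)"
  shows "x \<in> \<Union>K \<longleftrightarrow> x \<in> carrier G \<and> M #> x \<in> K"
proof -
  have Ms: "subgroup M G" by (rule normal_imp_subgroup[OF M])
  have Kc: "K \<subseteq> rcosets M" using subgroup.subset[OF K] by (simp add: FactGroup_def)
  show ?thesis
  proof
    assume "x \<in> \<Union>K"
    then obtain c where c: "c \<in> K" "x \<in> c" by auto
    then obtain a where a: "a \<in> carrier G" "c = M #> a" using Kc by (auto simp: RCOSETS_def)
    have "x \<in> carrier G" using c a Ms by (metis subgroup.elemrcos_carrier is_group)
    moreover have "M #> x = c" using repr_independence[of x M a] c a Ms by simp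
    ultimately show "x \<in> carrier G \<and> M #> x \<in> K" using c by simp
  next
    assume "x \<in> carrier G \<and> M #> x \<in> K"
    then show "x \<in> \<Union>K" using rcos_self[OF _ Ms] by blast
  qed
qed

lemma quotient_subgroup_union:
  assumes M: "M \<lhd> G" and K: "subgroup K (G Mod M)"
  shows "subgroup (\<Union>K) G" "M \<subseteq> \<Union>K" "card (\<Union>K) = card M * card K"
proof -
  interpret M: normal M G by (rule M)
  have Ms: "subgroup M G" by (rule normal_imp_subgroup[OF M])
  interpret Q: group "G Mod M" by (rule M.factorgroup_is_group)
  interpret h: group_hom G "G Mod M" "\<lambda>a. M #> a"
    using M.r_coset_hom_Mod by (simp add: group_hom_def group_hom_axioms_def Q.is_group is_group)
  note mem = mem_Union_quotient_subgroup[OF M K]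
  show "subgroup (\<Union>K) G"
  proof (rule subgroupI)
    show "\<Union>K \<subseteq> carrier G" using mem by blast
    have "M #> \<one> \<in> K" using subgroup.one_closed[OF K] by (simp add: M.subset)
    then show "\<Union>K \<noteq> {}" using mem by blast
    fix a assume a: "a \<in> \<Union>K"
    then have "inv\<^bsub>G Mod M\<^esub> (M #> a) \<in> K" using mem subgroup.m_inv_closed[OF K] by blast
    then show "inv a \<in> \<Union>K" using a mem h.hom_inv[of a] by simp
    fix b assume b: "b \<in> \<Union>K"
    then have "(M #> a) \<otimes>\<^bsub>G Mod M\<^esub> (M #> b) \<in> K" using a mem subgroup.m_closed[OF K] by blast
    then show "a \<otimes> b \<in> \<Union>K" using a b mem h.hom_mult[of a b] by simp
  qed
  have "M \<in> K" using subgroup.one_closed[OF K] by simp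
  then show "M \<subseteq> \<Union>K" by blast
  have Kc: "K \<subseteq> rcosets M" using subgroup.subset[OF K] by (simp add: FactGroup_def)
  have sub: "c \<subseteq> carrier G" if "c \<in> rcosets M" for c using that M.rcosets_carrier[OF is_group] by auto
  have "finite K" by (rule finite_subset[of _ "Pow (carrier G)"]) (use Kc sub in auto)
  moreover have "finite (\<Union>K)" using Kc sub by (intro finite_subset_carrier) auto
  ultimately have "card M * card K = card (\<Union>K)"
    using Kc rcos_disjoint[OF Ms] card_rcosets_equal[OF _ M.subset]
    by (intro card_partition) (auto simp: pairwise_def disjnt_def subset_iff)
  then show "card (\<Union>K) = card M * card K" by simp
qed

lemma quotient_conj_mem:
  assumes M: "M \<lhd> G" and K: "subgroup K (G Mod M)" and x: "x \<in> carrier G"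
    and n: "conj_set (G Mod M) (M #> x) K \<subseteq> K"
  shows "conj_set G x (\<Union>K) \<subseteq> \<Union>K"
proof -
  interpret M: normal M G by (rule M)
  interpret Q: group "G Mod M" by (rule M.factorgroup_is_group)
  interpret h: group_hom G "G Mod M" "\<lambda>a. M #> a"
    using M.r_coset_hom_Mod by (simp add: group_hom_def group_hom_axioms_def Q.is_group is_group)
  note mem = mem_Union_quotient_subgroup[OF M K]
  show ?thesis
  proof
    fix y assume "y \<in> conj_set G x (\<Union>K)"
    then obtain u where u: "u \<in> \<Union>K" "y = x \<otimes> u \<otimes> inv x" by (auto simp: conj_set_def)
    have uK: "u \<in> carrier G" "M #> u \<in> K" using mem u(1) by auto
    have "M #> y = (M #> x) \<otimes>\<^bsub>G Mod M\<^esub> (M #> u) \<otimes>\<^bsub>G Mod M\<^esub> inv\<^bsub>G Mod M\<^esub> (M #> x)"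
      using u(2) uK(1) x h.hom_mult[of "x \<otimes> u" "inv x"] h.hom_mult[of x u] h.hom_inv[of x] by simp
    then have "M #> y \<in> conj_set (G Mod M) (M #> x) K" using uK(2) by (auto simp: conj_set_def)
    then show "y \<in> \<Union>K" using mem n uK(1) x u(2) by auto
  qed
qed

lemma finite_group_quotient:
  assumes M: "M \<lhd> G"
  shows "finite_group (G Mod M)"
proof -
  interpret M: normal M G by (rule M)
  have "finite (carrier (G Mod M))" by (simp add: carrier_FactGroup)
  then show ?thesis by (simp add: finite_group_def finite_group_axioms_def M.factorgroup_is_group)
qed

text \<open>A coset normalizing \<open>K\<close> but outside it has representatives normalizing the
  preimage but outside it. The last two conclusions serve the count: the lifted order is neither
  that of \<open>M\<close> nor that of the whole group.\<close>

lemma bad_subgroup_of_quotient: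
  assumes M: "M \<lhd> G" and K: "bad_subgroup (G Mod M) K"
  shows "bad_subgroup G (\<Union>K)" "card (\<Union>K) = card M * card K" "card K \<noteq> 1"
      "\<Union>K \<noteq> carrier G"
proof -
  interpret M: normal M G by (rule M)
  interpret Q: finite_group "G Mod M" by (rule finite_group_quotient[OF M])
  have Ks: "subgroup K (G Mod M)" and K1: "K \<noteq> {\<one>\<^bsub>G Mod M\<^esub>}" and KN:
      "normalizer (G Mod M) K \<noteq> K"
    using K by (auto simp: bad_subgroup_def)
  note U = quotient_subgroup_union[OF M Ks] and mem = mem_Union_quotient_subgroup[OF M Ks]
  show "card (\<Union>K) = card M * card K" by (rule U(3))
  show cK: "card K \<noteq> 1" using Q.card_one_subgroup_iff[OF Ks] K1 by simp
  have Kc: "K \<subseteq> carrier (G Mod M)" by (rule subgroup.subset[OF Ks])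
  obtain u where u: "u \<in> normalizer (G Mod M) K" "u \<notin> K"
    using KN Q.subgroup_subset_normalizer[OF Ks] by blast
  then have uc: "u \<in> carrier (G Mod M)" "conj_set (G Mod M) u K = K" using Q.mem_normalizer[OF Kc] by auto
  then obtain x where x: "x \<in> carrier G" "u = M #> x" by (auto simp: carrier_FactGroup)
  have xn: "x \<notin> \<Union>K" using mem x u(2) by simp
  then show "\<Union>K \<noteq> carrier G" using x(1) by blast
  have "x \<in> normalizer G (\<Union>K)"
    using normalizer_eqI[OF subgroup.subset[OF U(1)] x(1)] quotient_conj_mem[OF M Ks x(1)] uc(2) x(2) by simp
  moreover have "\<Union>K \<noteq> {\<one>}"
  proof
    assume "\<Union>K = {\<one>}"
    then have "card M * card K = 1" using U(3) by simp
    then show False using cK by simp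
  qed
  ultimately show "bad_subgroup G (\<Union>K)" using xn U(1) by (auto simp: bad_subgroup_def)
qed

text \<open>A commutative quotient would put all commutators into \<open>M\<close>, against
  perfectness. A normal subgroup of the quotient lifts to a normal subgroup of order
  \<open>card M * card K\<close>, so it is trivial or everything by maximality.\<close>

lemma nonabelian_simple_quotient:
  assumes perfect: "derived G (carrier G) = carrier G" and M: "M \<lhd> G" "M \<noteq> carrier G"
    and max: "\<And>M'. M' \<lhd> G \<Longrightarrow> M' \<noteq> carrier G \<Longrightarrow> card M' \<le> card M"
  shows "nonabelian_simple_group (G Mod M)"
proof -
  interpret M: normal M G by (rule M(1))
  interpret Q: finite_group "G Mod M" by (rule finite_group_quotient[OF M(1)])
  interpret h: group_hom G "G Mod M" "\<lambda>a. M #> a"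
    using M.r_coset_hom_Mod by (simp add: group_hom_def group_hom_axioms_def Q.is_group is_group)
  have Ms: "subgroup M G" by (rule normal_imp_subgroup[OF M(1)])
  have nonab: "\<exists>u\<in>carrier (G Mod M). \<exists>v\<in>carrier (G Mod M). u \<otimes>\<^bsub>G Mod M\<^esub> v \<noteq> v \<otimes>\<^bsub>G Mod M\<^esub> u"
  proof (rule ccontr)
    assume "\<not> ?thesis"
    then have comm: "u \<otimes>\<^bsub>G Mod M\<^esub> v = v \<otimes>\<^bsub>G Mod M\<^esub> u"
      if "u \<in> carrier (G Mod M)" "v \<in> carrier (G Mod M)" for u v using that by blast
    have "x \<otimes> y \<otimes> inv x \<otimes> inv y \<in> M" if xy: "x \<in> carrier G" "y \<in> carrier G" for x y
    proof -
      have "M #> (x \<otimes> y) = M #> (y \<otimes> x)"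
        using comm[of "M #> x" "M #> y"] xy h.hom_mult[of x y] h.hom_mult[of y x] h.hom_closed by simp
      then have "x \<otimes> y \<in> M #> (y \<otimes> x)" using rcos_self[of "x \<otimes> y" M] xy Ms by simp
      then have "x \<otimes> y \<otimes> inv (y \<otimes> x) \<in> M" using M.rcos_module_imp[OF is_group] xy by blast
      then show ?thesis using xy by (simp add: inv_mult_group m_assoc)
    qed
    then have "derived_set G (carrier G) \<subseteq> M" by auto
    then have "derived G (carrier G) \<subseteq> M"
      unfolding derived_def by (rule generate_subgroup_incl[OF _ Ms])
    then show False using perfect M(2) M.subset by auto
  qed
  moreover have "order (G Mod M) > 1"
  proof (rule ccontr)
    assume "\<not> order (G Mod M) > 1"
    then have "order (G Mod M) = 1" using Q.order_pos by linarith
    then have "carrier (G Mod M) = {\<one>\<^bsub>G Mod M\<^esub>}" using Q.order_one_triv_iff by blast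
    then show False using nonab by auto
  qed
  moreover have "K = carrier (G Mod M) \<or> K = {\<one>\<^bsub>G Mod M\<^esub>}" if K: "K \<lhd> G Mod M" for K
  proof -
    have Ks: "subgroup K (G Mod M)" by (rule normal_imp_subgroup[OF K])
    note U = quotient_subgroup_union[OF M(1) Ks] and mem = mem_Union_quotient_subgroup[OF M(1) Ks]
    have "\<Union>K \<lhd> G"
    proof (rule normal_invI[OF U(1)])
      fix x u assume x: "x \<in> carrier G" and u: "u \<in> \<Union>K"
      have "conj_set (G Mod M) (M #> x) K \<subseteq> K"
        using normal.inv_op_closed2[OF K] h.hom_closed[OF x] by (auto simp: conj_set_def)
      then have "conj_set G x (\<Union>K) \<subseteq> \<Union>K" by (rule quotient_conj_mem[OF M(1) Ks x])
      then show "x \<otimes> u \<otimes> inv x \<in> \<Union>K" using u by (auto simp: conj_set_def)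
    qed
    show ?thesis
    proof (cases "\<Union>K = carrier G")
      case True
      have "u \<in> K" if u: "u \<in> carrier (G Mod M)" for u
      proof -
        obtain x where "x \<in> carrier G" "u = M #> x" using u by (auto simp: carrier_FactGroup)
        then show ?thesis using mem True by blast
      qed
      then show ?thesis using subgroup.subset[OF Ks] by blast
    next
      case False
      then have "card M * card K \<le> card M" using max[OF \<open>\<Union>K \<lhd> G\<close>] U(3) by simp
      then have "card K \<le> 1" using card_subgroup_pos[OF Ms] by simp
      then have "card K = 1" using Q.card_subgroup_pos[OF Ks] by linarith
      then show ?thesis using Q.card_one_subgroup_iff[OF Ks] by simp
    qed
  qed
  ultimately show ?thesis
    by unfold_locales (auto simp del: mult_FactGroup one_FactGroup)
qed

text \<open>\<open>N\<close> has least order among the nonsolvable normal subgroups. Its derived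
  subgroup is normal in \<open>G\<close> too and, if smaller, solvable, which would make
  \<open>N\<close> solvable; so \<open>N\<close> is perfect. A largest proper normal subgroup
  \<open>M\<close> of \<open>N\<close> gives the simple section.\<close>

lemma nonsolvable_imp_simple:
  assumes nonsol: "\<not> solvable G" and BO: "card (bad_orders G) \<le> 4"
  shows "nonabelian_simple_group G"
proof -
  define \<N> where "\<N> N \<longleftrightarrow> N \<lhd> G \<and> \<not> solvable_seq G N" for N
  have "\<N> (carrier G)" using nonsol normal_self by (simp add: \<N>_def solvable_def)
  then obtain N where N: "\<N> N" and minN: "\<And>N'. \<N> N' \<Longrightarrow> card N \<le> card N'"
    using ex_has_least_nat[of \<N> "carrier G" card] by blast
  have Nn: "N \<lhd> G" and Nns: "\<not> solvable_seq G N" using N by (auto simp: \<N>_def)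
  have Ns: "subgroup N G" by (rule normal_imp_subgroup[OF Nn])
  have Nc: "N \<subseteq> carrier G" by (rule subgroup.subset[OF Ns])
  have perfN: "derived G N = N"
  proof (rule ccontr)
    assume ne: "derived G N \<noteq> N"
    have "derived G N \<subseteq> N" by (rule derived_incl[OF _ Ns]) simp
    then have "card (derived G N) < card N" using ne Ns by (intro psubset_card_mono) auto
    then have "\<not> \<N> (derived G N)" using minN by (metis not_less)
    then have "solvable_seq G (derived G N)" using derived_is_normal[OF Nn] by (simp add: \<N>_def)
    then show False using augment_solvable_seq[OF Ns] Nns by blast
  qed
  have N1: "N \<noteq> {\<one>}" using Nns solvable_seq.unity[of G] by auto
  let ?N = "G\<lparr>carrier := N\<rparr>"
  interpret N: finite_group ?N by (rule finite_group_restrict[OF Ns])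
  have perf: "derived ?N (carrier ?N) = carrier ?N"
    using derived_consistent[OF _ Ns, of N] perfN by simp
  define \<M> where "\<M> M \<longleftrightarrow> M \<lhd> ?N \<and> M \<noteq> carrier ?N" for M
  have "\<M> {\<one>}" using N.one_is_normal N1 by (auto simp: \<M>_def)
  moreover have "card M < Suc (card N)" if "\<M> M" for M
    using N.card_subgroup_dvd_order[OF normal_imp_subgroup, of M] that card_subgroup_pos[OF Ns]
    by (auto simp: \<M>_def order_def less_Suc_eq_le intro: dvd_imp_le)
  ultimately obtain M where M: "\<M> M" and maxM: "\<And>M'. \<M> M' \<Longrightarrow> card M' \<le> card M"
    using ex_has_greatest_nat[of \<M> "{\<one>}" card "Suc (card N)"] by blast
  have Mn: "M \<lhd> ?N" "M \<noteq> carrier ?N" using M by (auto simp: \<M>_def)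
  have Ms: "subgroup M ?N" by (rule normal_imp_subgroup[OF Mn(1)])
  then have MG: "subgroup M G" "M \<subseteq> N" using subgroup_restrict_iff[OF Ns] by auto
  interpret S: nonabelian_simple_group "?N Mod M"
    by (rule N.nonabelian_simple_quotient[OF perf Mn]) (use maxM in \<open>auto simp: \<M>_def\<close>)
  have m0: "card M > 0" using MG(1) by (rule card_subgroup_pos)
  have lift: "card M * k \<in> bad_orders G \<and> k \<noteq> 1 \<and> card M * k \<noteq> card N" if k:
      "k \<in> bad_orders (?N Mod M)" for k
  proof -
    obtain K where K: "bad_subgroup (?N Mod M) K" "card K = k" using k by (auto simp: bad_orders_def)
    note B = N.bad_subgroup_of_quotient[OF Mn(1) K(1)]
    have "card (\<Union>K) \<in> bad_orders G" by (rule bad_orderI[OF bad_subgroup_of_restrict[OF Ns B(1)]])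
    moreover have "card (\<Union>K) \<noteq> card N"
    proof
      assume "card (\<Union>K) = card N"
      moreover have "\<Union>K \<subseteq> N" using B(1) subgroup.subset by (fastforce simp: bad_subgroup_def)
      ultimately have "\<Union>K = N" using card_subset_eq[of N] Ns by simp
      then show False using B(4) by simp
    qed
    ultimately show ?thesis using B(2,3) K(2) by simp
  qed
  have inj: "inj_on (\<lambda>k. card M * k) (bad_orders (?N Mod M))" using m0 by (auto simp: inj_on_def)
  \<comment> \<open>The section already supplies four orders, which lift injectively, so every bad
    order of \<open>G\<close> has the form \<open>card M * k\<close>. By \<open>lift\<close> neither
    \<open>card M\<close> nor \<open>card N\<close> is of this form.\<close>
  have no_more: "x \<in> (\<lambda>k. card M * k) ` bad_orders (?N Mod M)" if x: "x \<in> bad_orders G" for x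
  proof (rule ccontr)
    assume nx: "x \<notin> (\<lambda>k. card M * k) ` bad_orders (?N Mod M)"
    have "card (insert x ((\<lambda>k. card M * k) ` bad_orders (?N Mod M))) \<le> card (bad_orders G)"
      using lift x finite_bad_orders by (intro card_mono) auto
    then have "Suc (card (bad_orders (?N Mod M))) \<le> 4"
      using BO nx card_image[OF inj] S.finite_bad_orders by simp
    then show False using S.card_bad_orders_ge_4 by simp
  qed
  have "M = {\<one>}"
  proof (rule ccontr)
    assume M1: "M \<noteq> {\<one>}"
    have "normalizer ?N M = N" using N.normal_iff_normalizer[of M] Mn(1) by simp
    then have "bad_subgroup ?N M" using Ms M1 Mn(2) by (simp add: bad_subgroup_def)
    then have "card M \<in> bad_orders G" using bad_subgroup_of_restrict[OF Ns] bad_orderI by blast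
    then obtain k where "k \<in> bad_orders (?N Mod M)" "card M = card M * k" using no_more by blast
    then show False using lift[of k] m0 by simp
  qed
  have "N = carrier G"
  proof (rule ccontr)
    assume NG: "N \<noteq> carrier G"
    have "normalizer G N = carrier G" using normal_iff_normalizer Nn by blast
    then have "bad_subgroup G N" using Ns N1 NG by (simp add: bad_subgroup_def)
    then have "card N \<in> bad_orders G" by (rule bad_orderI)
    then obtain k where "k \<in> bad_orders (?N Mod M)" "card N = card M * k" using no_more by blast
    then show False using lift[of k] by simp
  qed
  then have NG: "?N = G" by simp
  have "H = carrier G \<or> H = {\<one>}" if H: "H \<lhd> G" for H
  proof (cases "H = carrier G")
    case False
    then have "\<M> H" using H NG \<open>N = carrier G\<close> by (simp add: \<M>_def)
    then have "card H \<le> 1" using maxM[of H] \<open>M = {\<one>}\<close> by simp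
    moreover have Hs: "subgroup H G" by (rule normal_imp_subgroup[OF H])
    ultimately have "card H = 1" using card_subgroup_pos[OF Hs] by linarith
    then show ?thesis using card_one_subgroup_iff[OF Hs] by simp
  qed simp
  moreover have nonab: "\<exists>x\<in>carrier G. \<exists>y\<in>carrier G. x \<otimes> y \<noteq> y \<otimes> x"
  proof (rule ccontr)
    assume "\<not> ?thesis"
    then interpret comm_group G by (intro group_comm_groupI) auto
    have "derived G N = {\<one>}" by (rule derived_eq_singleton[OF Nc])
    then show False using perfN N1 by simp
  qed
  moreover have "order G > 1"
  proof (rule ccontr)
    assume "\<not> order G > 1"
    then have "order G = 1" using order_pos by linarith
    then show False using order_one_triv_iff N1 \<open>N = carrier G\<close> by blast
  qed
  ultimately show ?thesis by unfold_locales auto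
qed

end

theorem mainTheorem18:
  fixes G :: "('a, 'b) monoid_scheme"
  assumes "group G" and "finite (carrier G)" and "\<not> solvable G"
    and "D_num G = 4"
  shows "G \<cong> alt_group 5"
proof -
  interpret finite_group G
    using assms(1,2) by (simp add: finite_group_def finite_group_axioms_def)
  interpret nonabelian_simple_group G
    by (rule nonsolvable_imp_simple[OF assms(3)]) (use card_bad_orders_le_D_num assms(4) in simp)
  show ?thesis by (rule D_num_4_iso_alt_group_5[OF assms(4)])
qed

end
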